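(* There is an absolute constant $c\ge 1$ such that the following holds. For any integer $\alpha\ge 1$ and any outdegree threshold $\Delta\ge c\,\alpha$ (i.e., $\Delta=\Omega(\alpha)$), there is a distributed algorithm in the $\mathcal{CONGEST}$ model which, for any arboricity-$\alpha$ preserving sequence of edge and vertex updates starting from the empty graph, maintains a $\Delta$-orientation of the current network and has the following properties: (i) its amortized message complexity is optimal up to a constant factor: whenever $\delta\ge\alpha$, $\Delta\ge c\,\delta$, and some algorithm maintains a $\delta$-orientation on the same sequence of $t$ updates while performing $f$ edge flips, the total number of messages sent by our algorithm over the sequence is $O(t+f)$; (ii) its amortized update time is at most its amortized message complexity, up to a constant factor; (iii) at all times, the local memory usage at every vertex is $O(\Delta)$. In particular, for $\Delta=O(\alpha)$ one obtains an $O(\alpha)$-orientation with $O(\log n)$ amortized update time and $O(\log n)$ amortized message complexity, with $O(\alpha)$ local memory usage, where $n$ is the number of vertices.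
   Context: A graph $G=(V,E)$ has arboricity $\max_{U\subseteq V,|U|\ge 2}\lceil |E(U)|/(|U|-1)\rceil$, where $E(U)$ is the set of edges with both endpoints in $U$. An arboricity-$\alpha$ preserving sequence is a sequence of insertions and deletions of edges and vertices, starting from the empty graph, such that the current graph has arboricity at most $\alpha$ at all times (deleting a vertex deletes its incident edges; a vertex is inserted with no incident edges). A $\Delta$-orientation is an orientation of all edges in which every vertex has outdegree at most $\Delta$; flipping an edge reverses its orientation. Dynamic distributed model (local wakeup model): each vertex is a processor; after each update only the affected vertices wake up (the updated vertex, or both endpoints of the updated edge), and an update procedure then runs in fault-free synchronous rounds in which each processor exchanges messages with its neighbors, until it terminates; updates are assumed to be spaced so that the procedure finishes before the next update. In the $\mathcal{CONGEST}$ model each message has $O(\log n)$ bits. The amortized update time (resp. amortized message complexity) is the maximum, over update sequences, of the average number of communication rounds (resp. messages sent) per update. The local memory usage at a processor is the amount of information (measured in words/identifiers of $O(\log n)$ bits) stored at it. *)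

theory Defs
  imports Complex_Main "HOL-Library.Extended_Nonnegative_Real"
begin

text \<open>Vertices are processor identifiers. A finite simple graph is a pair of a vertex set and a
  set of two-element edges.\<close>

type_synonym graph = "nat set \<times> nat set set"

definition verts :: "graph \<Rightarrow> nat set" where
  "verts G = fst G"

definition edges :: "graph \<Rightarrow> nat set set" where
  "edges G = snd G"

definition empty_graph :: graph where
  "empty_graph = ({}, {})"

definition induced_edges :: "graph \<Rightarrow> nat set \<Rightarrow> nat set set" where
  "induced_edges G U = {e \<in> edges G. e \<subseteq> U}"

text \<open>The inserted 0 only matters for graphs with fewer than two vertices, where the maximum would
  range over the empty set.\<close>

definition arboricity :: "graph \<Rightarrow> nat" where
  "arboricity G =
     Max (insert 0 {nat \<lceil>real (card (induced_edges G U)) / (real (card U) - 1)\<rceil> | U.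
                      U \<subseteq> verts G \<and> 2 \<le> card U})"

datatype update = InsVertex nat | DelVertex nat | InsEdge nat nat | DelEdge nat nat

fun apply_update :: "graph \<Rightarrow> update \<Rightarrow> graph" where
  "apply_update (V, E) (InsVertex v) = (insert v V, E)"
| "apply_update (V, E) (DelVertex v) = (V - {v}, {e \<in> E. v \<notin> e})"
| "apply_update (V, E) (InsEdge u v) = (V, insert {u, v} E)"
| "apply_update (V, E) (DelEdge u v) = (V, E - {{u, v}})"

fun legal :: "graph \<Rightarrow> update \<Rightarrow> bool" where
  "legal (V, E) (InsVertex v) \<longleftrightarrow> v \<notin> V"
| "legal (V, E) (DelVertex v) \<longleftrightarrow> v \<in> V"
| "legal (V, E) (InsEdge u v) \<longleftrightarrow> u \<in> V \<and> v \<in> V \<and> u \<noteq> v \<and> {u, v} \<notin> E"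
| "legal (V, E) (DelEdge u v) \<longleftrightarrow> {u, v} \<in> E"

definition graph_after :: "update list \<Rightarrow> graph" where
  "graph_after us = foldl apply_update empty_graph us"

definition arboricity_preserving :: "nat \<Rightarrow> update list \<Rightarrow> bool" where
  "arboricity_preserving \<alpha> us \<longleftrightarrow>
     (\<forall>i < length us. legal (graph_after (take i us)) (us ! i)) \<and>
     (\<forall>i \<le> length us. arboricity (graph_after (take i us)) \<le> \<alpha>)"

text \<open>At most \<open>n\<close> vertices at all times, and identifiers of \<open>k * log 2 n\<close> bits (identifiers of
  deleted vertices may, but need not, be reused).\<close>

definition size_bounded :: "nat \<Rightarrow> nat \<Rightarrow> update list \<Rightarrow> bool" where
  "size_bounded k n us \<longleftrightarrow>
     (\<forall>i \<le> length us. card (verts (graph_after (take i us))) \<le> n \<and>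
                       verts (graph_after (take i us)) \<subseteq> {..<n ^ k})"

text \<open>The pair \<open>(u, v)\<close> stands for the edge \<open>{u, v}\<close> directed from \<open>u\<close> to \<open>v\<close>.\<close>

definition is_orientation :: "graph \<Rightarrow> (nat \<times> nat) set \<Rightarrow> bool" where
  "is_orientation G D \<longleftrightarrow>
     (\<forall>(u, v) \<in> D. {u, v} \<in> edges G) \<and>
     (\<forall>u v. {u, v} \<in> edges G \<longrightarrow> ((u, v) \<in> D \<longleftrightarrow> (v, u) \<notin> D))"

definition bounded_orientation :: "nat \<Rightarrow> graph \<Rightarrow> (nat \<times> nat) set \<Rightarrow> bool" where
  "bounded_orientation d G D \<longleftrightarrow>
     is_orientation G D \<and> (\<forall>u \<in> verts G. card {v. (u, v) \<in> D} \<le> d)"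

text \<open>The behaviour of an arbitrary (possibly offline, centralized) algorithm on a fixed sequence is
  the sequence \<open>D 0, D 1, \<dots>\<close> of its orientations; \<open>D i\<close> is the one held after \<open>i\<close> updates. A new
  edge may be directed freely, so only surviving edges whose direction changes count as flips.\<close>

definition maintained_by :: "nat \<Rightarrow> update list \<Rightarrow> (nat \<Rightarrow> (nat \<times> nat) set) \<Rightarrow> bool" where
  "maintained_by d us D \<longleftrightarrow>
     (\<forall>i \<le> length us. bounded_orientation d (graph_after (take i us)) (D i))"

definition flips :: "update list \<Rightarrow> (nat \<Rightarrow> (nat \<times> nat) set) \<Rightarrow> nat" where
  "flips us D = (\<Sum>i < length us. card {(u, v). (u, v) \<in> D i \<and> (v, u) \<in> D (Suc i)})"

text \<open>An update as seen by an affected processor; for edge updates the argument is the identifier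
  of the other endpoint.\<close>

datatype event = Inserted | Deleted | EdgeInserted nat | EdgeDeleted nat

text \<open>Memory cells and messages are natural numbers, whose size in bits is bounded separately by
  \<open>congest\<close> and \<open>memory_bounded\<close>. Only messages addressed to current neighbors are sent,
  so a processor can address all its incident links without storing its neighbors.\<close>

record action =
  new_memory :: "nat list"
  outbox :: "nat \<Rightarrow> nat option"
  stay_awake :: bool

text \<open>All processors run the same program, which sees its own identifier, its own memory and,
  in a round, the messages just received (indexed by sender); it has no other access to the
  network. The orientation is held by the tails: \<open>out_nbrs\<close> reads the out-neighbors of a
  processor off its memory.\<close>

record algorithm =
  wake :: "nat \<Rightarrow> nat list \<Rightarrow> event \<Rightarrow> action"
  react :: "nat \<Rightarrow> nat list \<Rightarrow> (nat \<Rightarrow> nat option) \<Rightarrow> action"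
  out_nbrs :: "nat \<Rightarrow> nat list \<Rightarrow> nat set"

text \<open>\<open>transit c u v\<close> is the message on its way from \<open>u\<close> to \<open>v\<close>, if any.\<close>

record config =
  memory :: "nat \<Rightarrow> nat list"
  transit :: "nat \<Rightarrow> nat \<Rightarrow> nat option"
  awake :: "nat set"

definition perform ::
  "graph \<Rightarrow> nat set \<Rightarrow> (nat \<Rightarrow> action) \<Rightarrow> (nat \<Rightarrow> nat list) \<Rightarrow> config" where
  "perform G S act M =
     \<lparr>memory = (\<lambda>v. if v \<in> S then new_memory (act v) else M v),
      transit = (\<lambda>u v. if u \<in> S \<and> {u, v} \<in> edges G then outbox (act u) v else None),
      awake = {v \<in> S. stay_awake (act v)}\<rparr>"

fun affected :: "update \<Rightarrow> nat set" where
  "affected (InsVertex v) = {v}"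
| "affected (DelVertex v) = {v}"
| "affected (InsEdge u v) = {u, v}"
| "affected (DelEdge u v) = {u, v}"

fun event_at :: "update \<Rightarrow> nat \<Rightarrow> event" where
  "event_at (InsVertex v) w = Inserted"
| "event_at (DelVertex v) w = Deleted"
| "event_at (InsEdge u v) w = EdgeInserted (if w = u then v else u)"
| "event_at (DelEdge u v) w = EdgeDeleted (if w = u then v else u)"

text \<open>The network on which the update procedure runs. Edge deletions are abrupt; a vertex being
  deleted is woken and takes part in the procedure, and it disappears with its incident edges
  when the procedure has terminated.\<close>

fun comm_graph :: "graph \<Rightarrow> update \<Rightarrow> graph" where
  "comm_graph G (DelVertex v) = G"
| "comm_graph G (InsVertex v) = apply_update G (InsVertex v)"
| "comm_graph G (InsEdge u v) = apply_update G (InsEdge u v)"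
| "comm_graph G (DelEdge u v) = apply_update G (DelEdge u v)"

definition wakeup ::
  "algorithm \<Rightarrow> graph \<Rightarrow> update \<Rightarrow> (nat \<Rightarrow> nat list) \<Rightarrow> config" where
  "wakeup A G x M = perform G (affected x) (\<lambda>v. wake A v (M v) (event_at x v)) M"

text \<open>One synchronous communication round. A sleeping processor takes part only if it receives a
  message.\<close>

definition comm_round :: "algorithm \<Rightarrow> graph \<Rightarrow> config \<Rightarrow> config" where
  "comm_round A G c =
     perform G {v. v \<in> awake c \<or> (\<exists>u. transit c u v \<noteq> None)}
       (\<lambda>v. react A v (memory c v) (\<lambda>u. transit c u v)) (memory c)"

definition quiescent :: "config \<Rightarrow> bool" where
  "quiescent c \<longleftrightarrow> awake c = {} \<and> (\<forall>u v. transit c u v = None)"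

definition messages_in :: "config \<Rightarrow> nat" where
  "messages_in c = card {(u, v). transit c u v \<noteq> None}"

definition config_after ::
  "algorithm \<Rightarrow> graph \<Rightarrow> (nat \<Rightarrow> nat list) \<Rightarrow> update \<Rightarrow> nat \<Rightarrow> config" where
  "config_after A G M x j =
     (comm_round A (comm_graph G x) ^^ j) (wakeup A (comm_graph G x) x M)"

text \<open>Meaningful only for a procedure that terminates, i.e. reaches a quiescent configuration.\<close>

definition num_rounds :: "algorithm \<Rightarrow> graph \<Rightarrow> (nat \<Rightarrow> nat list) \<Rightarrow> update \<Rightarrow> nat" where
  "num_rounds A G M x = (LEAST j. quiescent (config_after A G M x j))"

definition num_messages :: "algorithm \<Rightarrow> graph \<Rightarrow> (nat \<Rightarrow> nat list) \<Rightarrow> update \<Rightarrow> nat" where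
  "num_messages A G M x = (\<Sum>j < num_rounds A G M x. messages_in (config_after A G M x j))"

fun discard_deleted :: "update \<Rightarrow> (nat \<Rightarrow> nat list) \<Rightarrow> (nat \<Rightarrow> nat list)" where
  "discard_deleted (DelVertex v) M = M(v := [])"
| "discard_deleted _ M = M"

definition run_update ::
  "algorithm \<Rightarrow> graph \<times> (nat \<Rightarrow> nat list) \<Rightarrow> update \<Rightarrow> graph \<times> (nat \<Rightarrow> nat list)" where
  "run_update A = (\<lambda>(G, M) x.
     (apply_update G x,
      discard_deleted x (memory (config_after A G M x (num_rounds A G M x)))))"

definition memory_after :: "algorithm \<Rightarrow> update list \<Rightarrow> nat \<Rightarrow> nat list" where
  "memory_after A us = snd (foldl (run_update A) (empty_graph, \<lambda>_. []) us)"

text \<open>The configuration after \<open>j\<close> rounds of the procedure for update number \<open>i\<close> of \<open>us\<close>.\<close>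

definition config_at :: "algorithm \<Rightarrow> update list \<Rightarrow> nat \<Rightarrow> nat \<Rightarrow> config" where
  "config_at A us i j =
     config_after A (graph_after (take i us)) (memory_after A (take i us)) (us ! i) j"

definition terminating :: "algorithm \<Rightarrow> update list \<Rightarrow> bool" where
  "terminating A us \<longleftrightarrow> (\<forall>i < length us. \<exists>j. quiescent (config_at A us i j))"

definition orientation_after :: "algorithm \<Rightarrow> update list \<Rightarrow> (nat \<times> nat) set" where
  "orientation_after A us =
     {(u, v). u \<in> verts (graph_after us) \<and> v \<in> out_nbrs A u (memory_after A us u)}"

definition maintains_orientation :: "nat \<Rightarrow> algorithm \<Rightarrow> update list \<Rightarrow> bool" where
  "maintains_orientation d A us \<longleftrightarrow> maintained_by d us (\<lambda>i. orientation_after A (take i us))"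

text \<open>A number below \<open>n ^ b\<close> is a word of \<open>b * log 2 n\<close> bits.\<close>

definition congest :: "nat \<Rightarrow> nat \<Rightarrow> algorithm \<Rightarrow> update list \<Rightarrow> bool" where
  "congest b n A us \<longleftrightarrow>
     (\<forall>i < length us. \<forall>j u v m. transit (config_at A us i j) u v = Some m \<longrightarrow> m < n ^ b)"

text \<open>At all times, in particular also in each round of each procedure, every present processor
  stores at most \<open>s\<close> words of \<open>b * log 2 n\<close> bits.\<close>

definition memory_bounded :: "real \<Rightarrow> nat \<Rightarrow> nat \<Rightarrow> algorithm \<Rightarrow> update list \<Rightarrow> bool" where
  "memory_bounded s b n A us \<longleftrightarrow>
     (\<forall>i < length us. \<forall>j. \<forall>v \<in> verts (comm_graph (graph_after (take i us)) (us ! i)).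
        real (length (memory (config_at A us i j) v)) \<le> s \<and>
        (\<forall>w \<in> set (memory (config_at A us i j) v). w < n ^ b))"

definition total_rounds :: "algorithm \<Rightarrow> update list \<Rightarrow> nat" where
  "total_rounds A us =
     (\<Sum>i < length us.
        num_rounds A (graph_after (take i us)) (memory_after A (take i us)) (us ! i))"

definition total_messages :: "algorithm \<Rightarrow> update list \<Rightarrow> nat" where
  "total_messages A us =
     (\<Sum>i < length us.
        num_messages A (graph_after (take i us)) (memory_after A (take i us)) (us ! i))"

text \<open>Worst-case averages over all nonempty arboricity-\<open>\<alpha>\<close> preserving sequences on at most \<open>n\<close>
  vertices with identifiers of \<open>k * log 2 n\<close> bits.\<close>

definition update_sequences :: "nat \<Rightarrow> nat \<Rightarrow> nat \<Rightarrow> update list set" where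
  "update_sequences \<alpha> k n = {us. us \<noteq> [] \<and> arboricity_preserving \<alpha> us \<and> size_bounded k n us}"

definition amortized_update_time :: "algorithm \<Rightarrow> nat \<Rightarrow> nat \<Rightarrow> nat \<Rightarrow> ennreal" where
  "amortized_update_time A \<alpha> k n =
     (SUP us \<in> update_sequences \<alpha> k n. ennreal (real (total_rounds A us) / real (length us)))"

definition amortized_message_complexity :: "algorithm \<Rightarrow> nat \<Rightarrow> nat \<Rightarrow> nat \<Rightarrow> ennreal" where
  "amortized_message_complexity A \<alpha> k n =
     (SUP us \<in> update_sequences \<alpha> k n. ennreal (real (total_messages A us) / real (length us)))"

end

theory Submission
  imports Defs
begin

text \<open>A sequential depth-first search replaces the parallel anti-reset cascade. When an insertion
  pushes the outdegree of \<open>u\<close> above \<open>\<Delta>\<close>, a single token starting at \<open>u\<close> offers the reversal of each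
  outgoing edge to its head. A head with spare capacity accepts; a full head that is visited for the
  first time marks itself and searches its own outgoing edges first, and then accepts its parent's
  edge if it got rid of an edge; a marked head refuses. Finally a flood from \<open>u\<close> clears the marks.

  Every edge searched but not reversed lies inside the set \<open>S\<close> of marked vertices, so there are at most
  \<open>\<alpha>|S|\<close> of these among the at least \<open>\<Delta>|S|\<close> searched edges; in particular \<open>u\<close> succeeds, since otherwise
  no vertex of \<open>S\<close> does. Against any \<open>\<delta>\<close>-orientation at most \<open>\<delta>|S|\<close> of the reversals are wrong, so the
  number of edges directed differently drops by at least \<open>(\<Delta> - \<alpha> - 2\<delta>)|S|\<close>, which pays for the
  \<open>O(\<Delta>|S|)\<close> messages. No processor ever stays awake without receiving a message, so rounds are bounded
  by messages.

  For the logarithmic bound, a \<open>2\<alpha>\<close>-orientation with \<open>log\<^sub>2 n\<close> flips per insertion exists: while all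
  vertices within distance \<open>i\<close> have outdegree at least \<open>2\<alpha>\<close>, the reachable set doubles with \<open>i\<close>, so a
  directed path of length at most \<open>log\<^sub>2 n\<close> leads to a vertex of smaller outdegree and can be flipped.\<close>

section \<open>The algorithm\<close>

text \<open>The memory bound shapes the search, since it applies in every round of the procedure and
  not only at its end. A full processor must therefore make room before it takes over an edge, and
  giving away one edge makes room for exactly one. Letting a single token do all the work costs
  nothing here, because update time is only compared with message complexity; in return at most one
  message is in transit until the final flood, so the distributed run can be analysed as a
  sequential walk. The orientation it is compared with enters the analysis alone: the drop of the
  disagreement holds for all of them at once. The constants arise as follows. A search of s vertices
  sends at most 6 \<Delta> s messages. If \<alpha> \<le> \<delta> and 6 \<delta> \<le> \<Delta>,
  then \<Delta> - \<alpha> - 2 \<delta> is at least half of \<Delta>, so 12 times the drop pays for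
  them. A new edge costs 12 for a possible disagreement and 1 for the edge itself, 13 in total.
  Comparison with a 2 \<alpha>-orientation turns 6 \<delta> \<le> \<Delta> into 12 \<alpha> \<le>
  \<Delta>.\<close>

text \<open>A processor is marked while it belongs to the current search; its parent set is then empty at
  the root and a singleton elsewhere. Edges already given away are kept in \<open>flipped\<close> because the
  flood that clears the marks has to follow them.\<close>

record pstate =
  marked :: bool
  outs :: "nat set"
  todo :: "nat set"
  flipped :: "nat set"
  parent :: "nat set"

definition idle :: "nat set \<Rightarrow> pstate" where
  "idle X = \<lparr>marked = False, outs = X, todo = {}, flipped = {}, parent = {}\<rparr>"

lemma idle_simps [simp]:
  "marked (idle X) = False" "outs (idle X) = X" "todo (idle X) = {}"
  "flipped (idle X) = {}" "parent (idle X) = {}"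
  by (simp_all add: idle_def)

section \<open>Encoding of processor states as lists of words\<close>

definition finite_state :: "pstate \<Rightarrow> bool" where
  "finite_state s \<longleftrightarrow> finite (outs s) \<and> finite (todo s) \<and> finite (flipped s) \<and> finite (parent s)"

text \<open>Residues modulo 5 tag the five fields, so one set of numbers carries the whole state.
  The empty idle state becomes the empty list, which is also the memory of a vertex before its
  insertion and after its deletion.\<close>

definition state_words :: "pstate \<Rightarrow> nat set" where
  "state_words s = (if marked s then {0} else {}) \<union> (\<lambda>x. 5 * x + 1) ` outs s \<union>
     (\<lambda>x. 5 * x + 2) ` todo s \<union> (\<lambda>x. 5 * x + 3) ` flipped s \<union> (\<lambda>x. 5 * x + 4) ` parent s"

definition encode :: "pstate \<Rightarrow> nat list" where
  "encode s = sorted_list_of_set (state_words s)"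

definition decode :: "nat list \<Rightarrow> pstate" where
  "decode M = \<lparr>marked = 0 \<in> set M, outs = {x. 5 * x + 1 \<in> set M}, todo = {x. 5 * x + 2 \<in> set M},
     flipped = {x. 5 * x + 3 \<in> set M}, parent = {x. 5 * x + 4 \<in> set M}\<rparr>"

text \<open>Tags with different residues never collide. Finiteness enters because
  \<open>sorted_list_of_set\<close> sends an infinite set to the empty list.\<close>

lemma decode_encode:
  assumes "finite_state s"
  shows "decode (encode s) = s"
proof -
  have "finite (state_words s)"
    using assms by (simp add: state_words_def finite_state_def)
  then have s: "set (encode s) = state_words s"
    by (simp add: encode_def)
  have "0 \<in> state_words s \<longleftrightarrow> marked s"
    by (auto simp: state_words_def)
  moreover have "5 * x + 1 \<in> state_words s \<longleftrightarrow> x \<in> outs s" for x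
    by (auto simp: state_words_def; presburger)
  moreover have "5 * x + 2 \<in> state_words s \<longleftrightarrow> x \<in> todo s" for x
    by (auto simp: state_words_def; presburger)
  moreover have "5 * x + 3 \<in> state_words s \<longleftrightarrow> x \<in> flipped s" for x
    by (auto simp: state_words_def; presburger)
  moreover have "5 * x + 4 \<in> state_words s \<longleftrightarrow> x \<in> parent s" for x
    by (auto simp: state_words_def; presburger)
  ultimately show ?thesis
    unfolding decode_def s by simp
qed

lemma finite_state_idle [simp]: "finite_state (idle X) \<longleftrightarrow> finite X"
  by (simp add: finite_state_def)

lemma encode_idle_empty [simp]: "encode (idle {}) = []"
  by (simp add: encode_def state_words_def)

lemma decode_Nil: "decode [] = idle {}"
  by (simp add: decode_def idle_def)

section \<open>Messages and transitions of the token algorithm\<close>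

abbreviation (input) Probe :: nat where "Probe \<equiv> 0"
abbreviation (input) Accept :: nat where "Accept \<equiv> 1"
abbreviation (input) Refuse :: nat where "Refuse \<equiv> 2"
abbreviation (input) Release :: nat where "Release \<equiv> 3"
abbreviation (input) Leave :: nat where "Leave \<equiv> 4"

definition send :: "nat set \<Rightarrow> nat \<Rightarrow> nat \<Rightarrow> nat option" where
  "send W m = (\<lambda>w. if w \<in> W then Some m else None)"

text \<open>Acceptance is tied to \<open>flipped\<close> being nonempty: an arc given away is what
  frees the place for the arc of the parent. A release goes along all searched arcs, including those
  already given away.\<close>

definition advance :: "pstate \<Rightarrow> pstate \<times> (nat \<Rightarrow> nat option)" where
  "advance s =
     (if todo s \<noteq> {} then (s, send {Min (todo s)} Probe)
      else if parent s = {} then (idle (outs s), send (outs s \<union> flipped s) Release)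
      else if flipped s \<noteq> {} then (s\<lparr>outs := outs s \<union> parent s\<rparr>, send (parent s) Accept)
      else (s, send (parent s) Refuse))"

definition search :: "nat set \<Rightarrow> nat set \<Rightarrow> pstate" where
  "search X P = \<lparr>marked = True, outs = X, todo = X, flipped = {}, parent = P\<rparr>"

text \<open>An idle processor never has outdegree above \<open>\<Delta>\<close> in an actual run; refusing in that case
  makes the memory bound an invariant of the reaction to arbitrary messages.\<close>

definition handle :: "nat \<Rightarrow> pstate \<Rightarrow> nat \<Rightarrow> nat \<Rightarrow> pstate \<times> (nat \<Rightarrow> nat option)" where
  "handle \<Delta> s u m =
     (if m = Probe then
        (if marked s \<or> \<Delta> < card (outs s) then (s, send {u} Refuse)
         else if card (outs s) < \<Delta> then (s\<lparr>outs := insert u (outs s)\<rparr>, send {u} Accept)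
         else advance (search (outs s) {u}))
      else if m = Accept \<and> u \<in> todo s then
        advance (s\<lparr>outs := outs s - {u}, todo := todo s - {u}, flipped := insert u (flipped s)\<rparr>)
      else if m = Refuse then advance (s\<lparr>todo := todo s - {u}\<rparr>)
      else if m = Release \<and> marked s then (idle (outs s), send (outs s \<union> flipped s) Release)
      else if m = Leave then (s\<lparr>outs := outs s - {u}, todo := todo s - {u}\<rparr>, send {} 0)
      else (s, send {} 0))"

text \<open>All messages but the one from the least sender are dropped. Nothing is lost in a run:
  probes and answers travel one at a time, \<open>Leave\<close> has a single sender, and
  simultaneous \<open>Release\<close> messages have the same effect.\<close>

definition respond :: "nat \<Rightarrow> pstate \<Rightarrow> (nat \<Rightarrow> nat option) \<Rightarrow> pstate \<times> (nat \<Rightarrow> nat option)" where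
  "respond \<Delta> s r =
     (if \<exists>u. r u \<noteq> None
      then handle \<Delta> s (LEAST u. r u \<noteq> None) (the (r (LEAST u. r u \<noteq> None)))
      else (s, send {} 0))"

text \<open>The endpoint with the smaller identifier becomes the tail of a new edge, which settles
  its direction without communication. A deleted processor addresses \<open>UNIV\<close> because it
  does not store its in-neighbors; \<open>perform\<close> delivers to current neighbors
  only.\<close>

fun start :: "nat \<Rightarrow> nat \<Rightarrow> pstate \<Rightarrow> event \<Rightarrow> pstate \<times> (nat \<Rightarrow> nat option)" where
  "start \<Delta> v s Inserted = (idle {}, send {} 0)"
| "start \<Delta> v s Deleted = (idle {}, send UNIV Leave)"
| "start \<Delta> v s (EdgeInserted w) =
     (if w \<le> v then (s, send {} 0)
      else if card (insert w (outs s)) \<le> \<Delta> then (idle (insert w (outs s)), send {} 0)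
      else advance (search (insert w (outs s)) {}))"
| "start \<Delta> v s (EdgeDeleted w) = (idle (outs s - {w}), send {} 0)"

definition action_of :: "pstate \<times> (nat \<Rightarrow> nat option) \<Rightarrow> action" where
  "action_of p = \<lparr>new_memory = encode (fst p), outbox = snd p, stay_awake = False\<rparr>"

definition token_algorithm :: "nat \<Rightarrow> algorithm" where
  "token_algorithm \<Delta> =
     \<lparr>wake = (\<lambda>v M ev. action_of (start \<Delta> v (decode M) ev)),
      react = (\<lambda>v M r. action_of (respond \<Delta> (decode M) r)),
      out_nbrs = (\<lambda>v M. outs (decode M))\<rparr>"

definition conf :: "(nat \<Rightarrow> pstate) \<Rightarrow> (nat \<Rightarrow> nat \<Rightarrow> nat option) \<Rightarrow> config" where
  "conf \<sigma> t = \<lparr>memory = (\<lambda>v. encode (\<sigma> v)), transit = t, awake = {}\<rparr>"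

lemma conf_simps [simp]:
  "memory (conf \<sigma> t) = (\<lambda>v. encode (\<sigma> v))" "transit (conf \<sigma> t) = t" "awake (conf \<sigma> t) = {}"
  by (simp_all add: conf_def)

lemma respond_None [simp]: "respond \<Delta> s (\<lambda>_. None) = (s, send {} 0)"
  by (simp add: respond_def)

lemma send_empty [simp]: "send {} m = (\<lambda>_. None)"
  by (simp add: send_def)

section \<open>Rounds and message counts\<close>

text \<open>Sleeping processors need no case distinction: without incoming messages
  \<open>respond\<close> returns the state unchanged and sends nothing, and their memory is already
  the encoding of that state.\<close>

lemma comm_round_conf:
  assumes "\<And>v. finite_state (\<sigma> v)"
  shows "comm_round (token_algorithm \<Delta>) G (conf \<sigma> t) =
    conf (\<lambda>v. fst (respond \<Delta> (\<sigma> v) (\<lambda>u. t u v)))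
      (\<lambda>u v. if {u, v} \<in> edges G then snd (respond \<Delta> (\<sigma> u) (\<lambda>w. t w u)) v else None)"
  using assms
  by (auto simp: comm_round_def perform_def conf_def token_algorithm_def action_of_def
      decode_encode respond_def fun_eq_iff)

definition emit :: "graph \<Rightarrow> nat \<Rightarrow> (nat \<Rightarrow> nat option) \<Rightarrow> nat \<Rightarrow> nat \<Rightarrow> nat option" where
  "emit G b f = (\<lambda>u v. if u = b \<and> {b, v} \<in> edges G then f v else None)"

text \<open>With one message in transit only its receiver acts, so a round of the network is a
  single call of \<open>handle\<close>. This is what makes the search a sequential
  computation.\<close>

lemma comm_round_single:
  assumes fin: "\<And>v. finite_state (\<sigma> v)" and ab: "{a, b} \<in> edges G"
  shows "comm_round (token_algorithm \<Delta>) G (conf \<sigma> (emit G a (send {b} m))) =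
    conf (\<sigma>(b := fst (handle \<Delta> (\<sigma> b) a m))) (emit G b (snd (handle \<Delta> (\<sigma> b) a m)))"
proof -
  have *: "(\<lambda>u. emit G a (send {b} m) u v) =
      (if v = b then (\<lambda>u. if u = a then Some m else None) else (\<lambda>_. None))" for v
    using ab by (auto simp: emit_def send_def fun_eq_iff)
  have L: "(LEAST u. (if u = a then Some m else None) \<noteq> None) = a"
    by (rule Least_equality) (auto split: if_splits)
  have r: "respond \<Delta> s (\<lambda>u. if u = a then Some m else None) = handle \<Delta> s a m" for s
    unfolding respond_def L by auto
  show ?thesis
    unfolding comm_round_conf[OF fin] *
    by (auto simp: r emit_def fun_eq_iff conf_def)
qed

text \<open>Only an upper bound on the messages is recorded, so costs add up along a run and may be
  rounded up. Messages in transit in the final configuration are not counted; they are charged to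
  the continuation.\<close>

definition reaches :: "nat \<Rightarrow> graph \<Rightarrow> config \<Rightarrow> nat \<Rightarrow> config \<Rightarrow> bool" where
  "reaches \<Delta> G c m c' \<longleftrightarrow> (\<exists>j. (comm_round (token_algorithm \<Delta>) G ^^ j) c = c' \<and>
     (\<Sum>i<j. messages_in ((comm_round (token_algorithm \<Delta>) G ^^ i) c)) \<le> m)"

lemma reaches_refl: "reaches \<Delta> G c m c"
  unfolding reaches_def by (rule exI[of _ 0]) simp

lemma reaches_step: "reaches \<Delta> G c (messages_in c) (comm_round (token_algorithm \<Delta>) G c)"
  unfolding reaches_def by (rule exI[of _ 1]) simp

lemma reaches_trans:
  assumes "reaches \<Delta> G c m c'" "reaches \<Delta> G c' m' c''"
  shows "reaches \<Delta> G c (m + m') c''"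
proof -
  let ?r = "comm_round (token_algorithm \<Delta>) G"
  from assms obtain j j' where
    j: "(?r ^^ j) c = c'" "(\<Sum>i<j. messages_in ((?r ^^ i) c)) \<le> m" and
    j': "(?r ^^ j') c' = c''" "(\<Sum>i<j'. messages_in ((?r ^^ i) c')) \<le> m'"
    unfolding reaches_def by blast
  have shift: "(?r ^^ (j + i)) c = (?r ^^ i) c'" for i
    by (subst add.commute) (simp only: funpow_add comp_apply j(1))
  have "(\<Sum>i<j + j'. messages_in ((?r ^^ i) c)) =
      (\<Sum>i<j. messages_in ((?r ^^ i) c)) + (\<Sum>i<j'. messages_in ((?r ^^ (j + i)) c))"
    by (induction j') auto
  then show ?thesis
    unfolding reaches_def using j(2) j' shift by (intro exI[of _ "j + j'"]) simp
qed

lemma reaches_mono: "reaches \<Delta> G c m c' \<Longrightarrow> m \<le> m' \<Longrightarrow> reaches \<Delta> G c m' c'"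
  unfolding reaches_def using order_trans by blast

lemma messages_emit:
  assumes "finite W"
  shows "messages_in (conf \<sigma> (emit G b (send W m))) \<le> card W"
proof -
  have "{(u, v). emit G b (send W m) u v \<noteq> None} \<subseteq> (\<lambda>v. (b, v)) ` W"
    by (auto simp: emit_def send_def split: if_splits)
  then have "card {(u, v). emit G b (send W m) u v \<noteq> None} \<le> card ((\<lambda>v. (b, v)) ` W)"
    using assms by (intro card_mono) auto
  also have "\<dots> \<le> card W"
    using assms by (rule card_image_le)
  finally show ?thesis
    by (simp add: messages_in_def)
qed

lemma reaches_single:
  assumes "\<And>v. finite_state (\<sigma> v)" "{a, b} \<in> edges G"
  shows "reaches \<Delta> G (conf \<sigma> (emit G a (send {b} m))) 1
    (conf (\<sigma>(b := fst (handle \<Delta> (\<sigma> b) a m))) (emit G b (snd (handle \<Delta> (\<sigma> b) a m))))"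
  using reaches_step[of \<Delta> G "conf \<sigma> (emit G a (send {b} m))"] messages_emit[of "{b}" \<sigma> G a m]
  unfolding comm_round_single[OF assms] by (auto intro: reaches_mono)

section \<open>The depth-first search\<close>

definition orients :: "nat set set \<Rightarrow> (nat \<Rightarrow> nat set) \<Rightarrow> bool" where
  "orients E X \<longleftrightarrow> (\<forall>a b. b \<in> X a \<longrightarrow> {a, b} \<in> E) \<and> (\<forall>a b. {a, b} \<in> E \<longrightarrow> (b \<in> X a \<longleftrightarrow> a \<notin> X b))"

definition reverse :: "(nat \<Rightarrow> nat set) \<Rightarrow> nat \<Rightarrow> nat \<Rightarrow> nat \<Rightarrow> nat set" where
  "reverse X u v = X(u := X u - {v}, v := insert u (X v))"

definition disagreement :: "(nat \<times> nat) set \<Rightarrow> (nat \<Rightarrow> nat set) \<Rightarrow> nat" where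
  "disagreement D X = card {(a, b). b \<in> X a \<and> (b, a) \<in> D}"

text \<open>For an edge now pointing from \<open>a\<close> to \<open>b\<close>, this is the change
  of \<open>disagreement\<close> caused by its reversal: +1 if \<open>D\<close> has the present
  direction, -1 if \<open>D\<close> has the new one.\<close>

definition gain :: "(nat \<times> nat) set \<Rightarrow> nat \<Rightarrow> nat \<Rightarrow> int" where
  "gain D a b = (if (a, b) \<in> D then 1 else 0) - (if (b, a) \<in> D then 1 else 0)"

definition marked_set :: "(nat \<Rightarrow> pstate) \<Rightarrow> nat set" where
  "marked_set \<sigma> = {x. marked (\<sigma> x)}"

abbreviation outs_of :: "(nat \<Rightarrow> pstate) \<Rightarrow> nat \<Rightarrow> nat set" where
  "outs_of \<sigma> \<equiv> \<lambda>x. outs (\<sigma> x)"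

lemma marked_set_upd [simp]:
  "marked_set (\<sigma>(v := s)) = (if marked s then insert v (marked_set \<sigma>) else marked_set \<sigma> - {v})"
  by (auto simp: marked_set_def)

lemma mem_marked_set [simp]: "x \<in> marked_set \<sigma> \<longleftrightarrow> marked (\<sigma> x)"
  by (simp add: marked_set_def)

lemma search_simps [simp]:
  "marked (search X P)" "outs (search X P) = X" "todo (search X P) = X"
  "flipped (search X P) = {}" "parent (search X P) = P"
  by (simp_all add: search_def)

lemma orients_edge: "orients E X \<Longrightarrow> b \<in> X a \<Longrightarrow> {a, b} \<in> E"
  by (simp add: orients_def)

lemma orients_antisym: "orients E X \<Longrightarrow> b \<in> X a \<Longrightarrow> a \<notin> X b"
  unfolding orients_def by blast

lemma orients_insert:
  assumes "orients E X" "{a, b} \<notin> E" "a \<noteq> b"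
  shows "orients (insert {a, b} E) (X(a := insert b (X a)))"
proof -
  have ab: "b \<notin> X a" using orients_edge[OF assms(1)] assms(2) by blast
  have "{b, a} \<notin> E" using assms(2) by (simp add: insert_commute)
  then have ba: "a \<notin> X b" using orients_edge[OF assms(1)] by blast
  show ?thesis
    unfolding orients_def
  proof (intro conjI allI impI)
    show "{p, q} \<in> insert {a, b} E" if "q \<in> (X(a := insert b (X a))) p" for p q
      using that orients_edge[OF assms(1), of q p] by (auto split: if_splits)
    show "q \<in> (X(a := insert b (X a))) p \<longleftrightarrow> p \<notin> (X(a := insert b (X a))) q"
      if "{p, q} \<in> insert {a, b} E" for p q
    proof (cases "{p, q} = {a, b}")
      case True
      then have "p = a \<and> q = b \<or> p = b \<and> q = a" by (auto simp: doubleton_eq_iff)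
      then show ?thesis using ab ba assms(3) by auto
    next
      case False
      then have "q \<in> X p \<longleftrightarrow> p \<notin> X q" using that assms(1) by (simp add: orients_def)
      then show ?thesis using False by (auto simp: insert_commute)
    qed
  qed
qed

lemma orients_restrict:
  assumes "orients E X" "E' \<subseteq> E"
  shows "orients E' (\<lambda>a. {b \<in> X a. {a, b} \<in> E'})"
  unfolding orients_def
proof (intro conjI allI impI)
  fix a b assume ab: "{a, b} \<in> E'"
  then have "{b, a} \<in> E'" by (simp only: insert_commute)
  moreover have "b \<in> X a \<longleftrightarrow> a \<notin> X b" using assms ab unfolding orients_def by blast
  ultimately show "b \<in> {b \<in> X a. {a, b} \<in> E'} \<longleftrightarrow> a \<notin> {a \<in> X b. {b, a} \<in> E'}"
    using ab by blast
qed blast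

definition resting :: "nat \<Rightarrow> pstate \<Rightarrow> bool" where
  "resting \<Delta> s \<longleftrightarrow> s = idle (outs s) \<and> card (outs s) \<le> \<Delta>"

text \<open>The assumptions mention only the graph, so the locale predicate takes \<open>G\<close>
  alone; \<Delta> is a free parameter of the context.\<close>

locale network =
  fixes \<Delta> :: nat and G :: graph
  assumes finite_verts: "finite (verts G)"
    and edge_cases: "\<And>e. e \<in> edges G \<Longrightarrow> \<exists>u v. u \<in> verts G \<and> v \<in> verts G \<and> u \<noteq> v \<and> e = {u, v}"
begin

lemma edgeD:
  assumes "{u, v} \<in> edges G"
  shows "u \<in> verts G" "v \<in> verts G" "u \<noteq> v"
  using edge_cases[OF assms] by (auto simp: doubleton_eq_iff)

lemma orients_finite:
  assumes "orients (edges G) X"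
  shows "finite {(a, b). b \<in> X a \<and> P a b}"
proof (rule finite_subset)
  show "{(a, b). b \<in> X a \<and> P a b} \<subseteq> verts G \<times> verts G"
    using assms edgeD unfolding orients_def by blast
qed (use finite_verts in simp)

lemma orients_subset: "orients (edges G) X \<Longrightarrow> X a \<subseteq> verts G"
  using edgeD unfolding orients_def by blast

lemma orients_reverse:
  assumes "orients (edges G) X" "v \<in> X u"
  shows "orients (edges G) (reverse X u v)"
proof -
  have "{u, v} \<in> edges G" using orients_edge[OF assms] .
  then have "u \<noteq> v" using edgeD by blast
  show ?thesis
    unfolding orients_def
  proof (intro conjI allI impI)
    fix a b assume "b \<in> reverse X u v a"
    then have "b \<in> X a \<or> {a, b} = {u, v}"
      by (auto simp: reverse_def split: if_splits)
    then show "{a, b} \<in> edges G"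
      using orients_edge[OF assms(1)] \<open>{u, v} \<in> edges G\<close> by metis
  next
    fix a b assume ab: "{a, b} \<in> edges G"
    then have "b \<in> X a \<longleftrightarrow> a \<notin> X b" "a \<noteq> b"
      using assms(1) edgeD by (auto simp: orients_def)
    then show "b \<in> reverse X u v a \<longleftrightarrow> a \<notin> reverse X u v b"
      using assms(2) \<open>u \<noteq> v\<close> by (auto simp: reverse_def)
  qed
qed

lemma disagreement_reverse:
  assumes "orients (edges G) X" "v \<in> X u"
  shows "int (disagreement D (reverse X u v)) = int (disagreement D X) + gain D u v"
proof -
  have uv: "{u, v} \<in> edges G" using orients_edge[OF assms] .
  then have "u \<noteq> v" using edgeD by blast
  have nv: "u \<notin> X v" using orients_antisym[OF assms] .
  \<comment> \<open>Before and after the reversal, the disagreeing arcs are this common part plus at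
    most one arc over the edge between \<open>u\<close> and \<open>v\<close>.\<close>
  define B where "B = {(a, b). b \<in> X a \<and> (b, a) \<in> D \<and> (a, b) \<noteq> (u, v)}"
  have fin: "finite B"
    unfolding B_def using orients_finite[OF assms(1)] by simp
  have "{(a, b). b \<in> X a \<and> (b, a) \<in> D} = (if (v, u) \<in> D then insert (u, v) B else B)"
    using assms(2) by (auto simp: B_def)
  then have 1: "disagreement D X = card B + (if (v, u) \<in> D then 1 else 0)"
    unfolding disagreement_def using fin by (auto simp: B_def)
  have "{(a, b). b \<in> reverse X u v a \<and> (b, a) \<in> D} = (if (u, v) \<in> D then insert (v, u) B else B)"
    using \<open>u \<noteq> v\<close> by (auto simp: B_def reverse_def split: if_splits)
  then have 2: "disagreement D (reverse X u v) = card B + (if (u, v) \<in> D then 1 else 0)"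
    unfolding disagreement_def using fin nv by (auto simp: B_def)
  show ?thesis
    unfolding 1 2 gain_def by simp
qed

section \<open>Invariants of the search and the outcomes of its parts\<close>

text \<open>Outdegrees of marked processors are left open because those on the path of the token are
  in the middle of their own search.\<close>

definition searching :: "(nat \<Rightarrow> pstate) \<Rightarrow> bool" where
  "searching \<sigma> \<longleftrightarrow> (\<forall>x. finite_state (\<sigma> x)) \<and> (\<forall>x. \<not> marked (\<sigma> x) \<longrightarrow> resting \<Delta> (\<sigma> x)) \<and>
     marked_set \<sigma> \<subseteq> verts G \<and> orients (edges G) (outs_of \<sigma>)"

text \<open>A finished processor other than the root has \<Delta> searched arcs, divided between
  \<open>outs\<close> and \<open>flipped\<close>; the possible extra one is the arc of its parent.
  Since \<open>outs\<close> stays inside the marked set, arcs that were not reversed are edges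
  induced by that set.\<close>

definition explored :: "(nat \<Rightarrow> pstate) \<Rightarrow> nat \<Rightarrow> bool" where
  "explored \<sigma> x \<longleftrightarrow> \<Delta> \<le> card (outs (\<sigma> x)) + card (flipped (\<sigma> x)) \<and>
     card (outs (\<sigma> x)) + card (flipped (\<sigma> x)) \<le> \<Delta> + 1 \<and>
     card (outs (\<sigma> x)) \<le> \<Delta> \<and> outs (\<sigma> x) \<subseteq> marked_set \<sigma> \<and>
     (\<forall>y\<in>flipped (\<sigma> x). {x, y} \<in> edges G)"

text \<open>Every part of the newly explored set \<open>N\<close> that avoids \<open>T\<close> is entered by a searched edge from
  the rest of \<open>N\<close>; this is what lets the release flood reach all of \<open>N\<close> from \<open>T\<close>.\<close>

definition rooted :: "nat set \<Rightarrow> nat set \<Rightarrow> (nat \<Rightarrow> pstate) \<Rightarrow> bool" where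
  "rooted N T \<sigma> \<longleftrightarrow> (\<forall>Z. Z \<subseteq> N \<and> Z \<noteq> {} \<and> Z \<inter> T = {} \<longrightarrow>
     (\<exists>y \<in> N - Z. Z \<inter> (outs (\<sigma> y) \<union> flipped (\<sigma> y)) \<noteq> {}))"

definition total_gain :: "(nat \<times> nat) set \<Rightarrow> (nat \<Rightarrow> pstate) \<Rightarrow> nat set \<Rightarrow> int" where
  "total_gain D \<sigma> N = (\<Sum>x\<in>N. \<Sum>y\<in>flipped (\<sigma> x). gain D x y)"

definition extends :: "(nat \<Rightarrow> pstate) \<Rightarrow> (nat \<Rightarrow> pstate) \<Rightarrow> nat set \<Rightarrow> bool" where
  "extends \<sigma> \<sigma>' N \<longleftrightarrow> marked_set \<sigma>' = marked_set \<sigma> \<union> N \<and> N \<inter> marked_set \<sigma> = {} \<and> N \<subseteq> verts G \<and>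
     (\<forall>x\<in>N. explored \<sigma>' x)"

text \<open>Outcome of a probe of \<open>v\<close> by \<open>u\<close>. After an accepting reply both \<open>u\<close> and \<open>v\<close> list the edge until
  \<open>u\<close> has received it; \<open>settled\<close> is the orientation that is then reached.\<close>

definition settled :: "nat \<Rightarrow> nat \<Rightarrow> bool \<Rightarrow> (nat \<Rightarrow> pstate) \<Rightarrow> nat \<Rightarrow> nat set" where
  "settled u v ok \<sigma> = (if ok then (outs_of \<sigma>)(u := outs (\<sigma> u) - {v}) else outs_of \<sigma>)"

definition probe_outcome ::
  "(nat \<Rightarrow> pstate) \<Rightarrow> nat \<Rightarrow> nat \<Rightarrow> (nat \<Rightarrow> pstate) \<Rightarrow> nat set \<Rightarrow> bool \<Rightarrow> bool" where
  "probe_outcome \<sigma> u v \<sigma>' N ok \<longleftrightarrow>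
     (\<forall>x. finite_state (\<sigma>' x)) \<and> (\<forall>x. \<not> marked (\<sigma>' x) \<longrightarrow> resting \<Delta> (\<sigma>' x)) \<and>
     extends \<sigma> \<sigma>' N \<and> (\<forall>x. marked (\<sigma> x) \<longrightarrow> \<sigma>' x = \<sigma> x) \<and>
     orients (edges G) (settled u v ok \<sigma>') \<and>
     (\<not> ok \<longrightarrow> marked (\<sigma>' v) \<and> (\<forall>x\<in>N. flipped (\<sigma>' x) = {})) \<and>
     (\<forall>D. int (disagreement D (settled u v ok \<sigma>')) = int (disagreement D (outs_of \<sigma>)) +
        total_gain D \<sigma>' N + (if ok then gain D u v else 0)) \<and>
     rooted N {v} \<sigma>'"

text \<open>One message is the probe itself, and each newly explored processor causes \<Delta>
  probes with their answers. The answer to the initial probe is still in transit at the end and is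
  paid for by the prober.\<close>

definition probe_terminates :: "(nat \<Rightarrow> pstate) \<Rightarrow> bool" where
  "probe_terminates \<sigma> \<longleftrightarrow> (\<forall>u v. marked (\<sigma> u) \<longrightarrow> v \<in> outs (\<sigma> u) \<longrightarrow>
     (\<exists>\<sigma>' N ok. reaches \<Delta> G (conf \<sigma> (emit G u (send {v} Probe))) (1 + 2 * \<Delta> * card N)
         (conf \<sigma>' (emit G v (send {u} (if ok then Accept else Refuse)))) \<and>
       probe_outcome \<sigma> u v \<sigma>' N ok))"

text \<open>\<open>R\<close> collects the heads that took over their arc from \<open>v\<close>. As
  \<open>v\<close> was marked before, it is not in \<open>N\<close>, and its own reversals form a
  separate sum.\<close>

definition scan_outcome ::
  "(nat \<Rightarrow> pstate) \<Rightarrow> nat \<Rightarrow> (nat \<Rightarrow> pstate) \<Rightarrow> nat set \<Rightarrow> nat set \<Rightarrow> bool" where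
  "scan_outcome \<sigma> v \<sigma>' N R \<longleftrightarrow>
     searching \<sigma>' \<and> extends \<sigma> \<sigma>' N \<and> (\<forall>x. marked (\<sigma> x) \<and> x \<noteq> v \<longrightarrow> \<sigma>' x = \<sigma> x) \<and>
     \<sigma>' v = (\<sigma> v)\<lparr>outs := outs (\<sigma> v) - R, todo := {}, flipped := flipped (\<sigma> v) \<union> R\<rparr> \<and>
     R \<subseteq> todo (\<sigma> v) \<and> todo (\<sigma> v) - R \<subseteq> marked_set \<sigma>' \<and>
     (R = {} \<longrightarrow> (\<forall>x\<in>N. flipped (\<sigma>' x) = {})) \<and>
     (\<forall>D. int (disagreement D (outs_of \<sigma>')) = int (disagreement D (outs_of \<sigma>)) +
        total_gain D \<sigma>' N + (\<Sum>y\<in>R. gain D v y)) \<and>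
     rooted N (todo (\<sigma> v)) \<sigma>'"

definition after_advance :: "(nat \<Rightarrow> pstate) \<Rightarrow> nat \<Rightarrow> config" where
  "after_advance \<sigma> v = conf (\<sigma>(v := fst (advance (\<sigma> v)))) (emit G v (snd (advance (\<sigma> v))))"

lemma explored_mono:
  "explored \<sigma> x \<Longrightarrow> \<sigma>' x = \<sigma> x \<Longrightarrow> marked_set \<sigma> \<subseteq> marked_set \<sigma>' \<Longrightarrow> explored \<sigma>' x"
  unfolding explored_def by auto

lemma rooted_empty [simp]: "rooted {} T \<sigma>"
  by (auto simp: rooted_def)

lemma total_gain_empty [simp]: "total_gain D \<sigma> {} = 0"
  by (simp add: total_gain_def)

lemma total_gain_cong: "(\<And>x. x \<in> N \<Longrightarrow> flipped (\<sigma> x) = flipped (\<sigma>' x)) \<Longrightarrow> total_gain D \<sigma> N = total_gain D \<sigma>' N"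
  by (simp add: total_gain_def)

lemma total_gain_Un:
  "finite N \<Longrightarrow> finite N' \<Longrightarrow> N \<inter> N' = {} \<Longrightarrow>
    total_gain D \<sigma> (N \<union> N') = total_gain D \<sigma> N + total_gain D \<sigma> N'"
  by (simp add: total_gain_def sum.union_disjoint)

text \<open>A set that meets \<open>N\<close> is entered already within \<open>N\<close>: whatever
  enters its part in \<open>N\<close> lies in \<open>N\<close> and hence outside the set. Otherwise
  the set lies in \<open>N'\<close>, where the second hypothesis applies.\<close>

lemma rooted_Un:
  assumes "rooted N T \<sigma>" "rooted N' T' \<sigma>'"
    and "\<And>x. x \<in> N \<Longrightarrow> \<sigma>' x = \<sigma> x"
  shows "rooted (N \<union> N') (T \<union> T') \<sigma>'"
  unfolding rooted_def
proof (intro allI impI)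
  fix Z assume Z: "Z \<subseteq> N \<union> N' \<and> Z \<noteq> {} \<and> Z \<inter> (T \<union> T') = {}"
  show "\<exists>y\<in>(N \<union> N') - Z. Z \<inter> (outs (\<sigma>' y) \<union> flipped (\<sigma>' y)) \<noteq> {}"
  proof (cases "Z \<inter> N = {}")
    case True
    then have "Z \<subseteq> N' \<and> Z \<noteq> {} \<and> Z \<inter> T' = {}" using Z by blast
    then have "\<exists>y \<in> N' - Z. Z \<inter> (outs (\<sigma>' y) \<union> flipped (\<sigma>' y)) \<noteq> {}"
      using assms(2) unfolding rooted_def by presburger
    then show ?thesis by blast
  next
    case False
    have "Z \<inter> N \<subseteq> N \<and> Z \<inter> N \<noteq> {} \<and> (Z \<inter> N) \<inter> T = {}" using False Z by blast
    then have "\<exists>y \<in> N - Z \<inter> N. Z \<inter> N \<inter> (outs (\<sigma> y) \<union> flipped (\<sigma> y)) \<noteq> {}"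
      using assms(1) unfolding rooted_def by presburger
    then obtain y where y: "y \<in> N" "y \<notin> Z" "Z \<inter> (outs (\<sigma> y) \<union> flipped (\<sigma> y)) \<noteq> {}"
      by blast
    then show ?thesis using assms(3)[OF y(1)] by (intro bexI[of _ y]) auto
  qed
qed

lemma scan:
  assumes "\<And>\<rho>. searching \<rho> \<Longrightarrow> card (verts G - marked_set \<rho>) \<le> k \<Longrightarrow> probe_terminates \<rho>"
    and "searching \<sigma>" "card (verts G - marked_set \<sigma>) \<le> k" "marked (\<sigma> v)" "todo (\<sigma> v) \<subseteq> outs (\<sigma> v)"
  shows "\<exists>\<sigma>' N R. reaches \<Delta> G (after_advance \<sigma> v)
      (2 * card (todo (\<sigma> v)) + 2 * \<Delta> * card N) (after_advance \<sigma>' v) \<and> scan_outcome \<sigma> v \<sigma>' N R"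
  using assms(2-)
proof (induction "card (todo (\<sigma> v))" arbitrary: \<sigma>)
  case 0
  have "finite (todo (\<sigma> v))"
    using 0(2) by (auto simp: searching_def finite_state_def)
  then have t: "todo (\<sigma> v) = {}" using 0(1) by simp
  have "scan_outcome \<sigma> v \<sigma> {} {}"
    using 0 t by (auto simp: scan_outcome_def extends_def)
  then show ?case using reaches_refl by blast
next
  case (Suc j)
  let ?T = "todo (\<sigma> v)"
  have "finite ?T" "?T \<noteq> {}"
    using Suc by (auto simp: searching_def finite_state_def)
  define t where "t = Min ?T"
  have tT: "t \<in> ?T" using \<open>finite ?T\<close> \<open>?T \<noteq> {}\<close> by (simp add: t_def)
  then have tX: "t \<in> outs (\<sigma> v)" using Suc.prems by blast
  have or: "orients (edges G) (outs_of \<sigma>)" using Suc.prems(1) by (simp add: searching_def)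
  have vt: "{v, t} \<in> edges G" using orients_edge[OF or tX] .
  then have tv: "{t, v} \<in> edges G" by (simp add: insert_commute)
  have "t \<noteq> v" using edgeD vt by blast
  have "probe_terminates \<sigma>"
    using assms(1) Suc.prems by blast
  then obtain \<sigma>1 N1 ok where
    r1: "reaches \<Delta> G (conf \<sigma> (emit G v (send {t} Probe))) (1 + 2 * \<Delta> * card N1)
         (conf \<sigma>1 (emit G t (send {v} (if ok then Accept else Refuse))))" and
    p1: "probe_outcome \<sigma> v t \<sigma>1 N1 ok"
    unfolding probe_terminates_def using tX Suc.prems by blast
  have fin1: "finite_state (\<sigma>1 x)" for x using p1 by (auto simp: probe_outcome_def)
  have s1v: "\<sigma>1 v = \<sigma> v" using p1 Suc.prems by (auto simp: probe_outcome_def)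
  have e1: "extends \<sigma> \<sigma>1 N1" using p1 by (auto simp: probe_outcome_def)
  have vN1: "v \<notin> N1" using e1 Suc.prems by (auto simp: extends_def)
  have finN1: "finite N1" using e1 finite_verts finite_subset by (auto simp: extends_def)
  define s where "s = (if ok then (\<sigma> v)\<lparr>outs := outs (\<sigma> v) - {t}, todo := ?T - {t},
      flipped := insert t (flipped (\<sigma> v))\<rparr> else (\<sigma> v)\<lparr>todo := ?T - {t}\<rparr>)"
  have h: "handle \<Delta> (\<sigma>1 v) t (if ok then Accept else Refuse) = advance s"
    using tT by (auto simp: handle_def s_def s1v)
  define \<sigma>2 where "\<sigma>2 = \<sigma>1(v := s)"
  have r2: "reaches \<Delta> G (conf \<sigma>1 (emit G t (send {v} (if ok then Accept else Refuse)))) 1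
      (after_advance \<sigma>2 v)"
    using reaches_single[of \<sigma>1, OF fin1 tv, of \<Delta> "if ok then Accept else Refuse"]
    unfolding h after_advance_def \<sigma>2_def by simp
  have start: "after_advance \<sigma> v = conf \<sigma> (emit G v (send {t} Probe))"
    using \<open>?T \<noteq> {}\<close> by (simp add: after_advance_def advance_def t_def)
  have smk: "marked s" "todo s = ?T - {t}" "todo s \<subseteq> outs s"
    using Suc.prems by (auto simp: s_def)
  have mk2: "marked_set \<sigma>2 = marked_set \<sigma>1"
    using smk(1) s1v Suc.prems by (auto simp: \<sigma>2_def)
  \<comment> \<open>On receipt of the answer \<open>v\<close> drops the arc that both ends listed in
    the meantime, which is the orientation that \<open>settled\<close> anticipates.\<close>
  have outs2: "outs_of \<sigma>2 = settled v t ok \<sigma>1"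
    by (auto simp: \<sigma>2_def settled_def s_def s1v fun_eq_iff)
  have fins: "finite_state s"
    using Suc.prems(1) by (auto simp: searching_def finite_state_def s_def)
  have se2: "searching \<sigma>2"
    unfolding searching_def
  proof (intro conjI allI impI)
    show "finite_state (\<sigma>2 x)" for x using fins fin1 by (auto simp: \<sigma>2_def)
    show "resting \<Delta> (\<sigma>2 x)" if "\<not> marked (\<sigma>2 x)" for x
      using that p1 smk(1) by (auto simp: \<sigma>2_def probe_outcome_def split: if_splits)
    show "marked_set \<sigma>2 \<subseteq> verts G"
      unfolding mk2 using e1 Suc.prems(1) by (auto simp: extends_def searching_def)
    show "orients (edges G) (outs_of \<sigma>2)"
      unfolding outs2 using p1 by (auto simp: probe_outcome_def)
  qed
  \<comment> \<open>Marks are only added during a probe, so the bound \<open>k\<close> is still met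
    when the remaining entries are scanned.\<close>
  have "card (verts G - marked_set \<sigma>2) \<le> card (verts G - marked_set \<sigma>)"
    unfolding mk2 using e1 finite_verts by (intro card_mono) (auto simp: extends_def)
  then have k2: "card (verts G - marked_set \<sigma>2) \<le> k" using Suc.prems by linarith
  have v2: "\<sigma>2 v = s" by (simp add: \<sigma>2_def)
  have cT: "card (todo s) = j"
    using smk(2) tT \<open>finite ?T\<close> Suc.hyps(2) by simp
  obtain \<sigma>' N2 R2 where
    r3: "reaches \<Delta> G (after_advance \<sigma>2 v) (2 * card (todo s) + 2 * \<Delta> * card N2) (after_advance \<sigma>' v)"
    and p2: "scan_outcome \<sigma>2 v \<sigma>' N2 R2"
    using Suc.hyps(1)[of \<sigma>2] se2 k2 smk cT unfolding v2 by blast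
  have e2: "extends \<sigma>2 \<sigma>' N2" using p2 by (auto simp: scan_outcome_def)
  have finN2: "finite N2" using e2 finite_verts finite_subset by (auto simp: extends_def)
  have dj: "N1 \<inter> N2 = {}" using e1 e2 by (auto simp: extends_def mk2)
  have keep: "\<sigma>' x = \<sigma>1 x" if "x \<in> N1" for x
  proof -
    have "x \<in> marked_set \<sigma>1" using that e1 unfolding extends_def by blast
    then show ?thesis using p2 vN1 that unfolding scan_outcome_def
      by (metis fun_upd_other mem_marked_set \<sigma>2_def)
  qed
  define R where "R = (if ok then insert t R2 else R2)"
  have tR2: "t \<notin> R2" using p2 smk(2) by (auto simp: scan_outcome_def v2)
  have R2: "R2 \<subseteq> ?T - {t}" "?T - {t} - R2 \<subseteq> marked_set \<sigma>'"
    using p2 smk(2) by (auto simp: scan_outcome_def v2)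
  have mk': "marked_set \<sigma>' = marked_set \<sigma> \<union> (N1 \<union> N2)"
    using e1 e2 by (auto simp: extends_def mk2)
  have finR2: "finite R2" using R2 \<open>finite ?T\<close> finite_subset by blast
  have "scan_outcome \<sigma> v \<sigma>' (N1 \<union> N2) R"
    unfolding scan_outcome_def
  proof (intro conjI allI impI ballI)
    show "searching \<sigma>'" using p2 by (auto simp: scan_outcome_def)
    have "explored \<sigma>' x" if "x \<in> N1" for x
      using explored_mono[of \<sigma>1 x \<sigma>', OF _ keep[OF that]] e1 e2 that mk2 unfolding extends_def by blast
    then show "extends \<sigma> \<sigma>' (N1 \<union> N2)"
      using e1 e2 mk' mk2 unfolding extends_def by blast
    show "\<sigma>' x = \<sigma> x" if "marked (\<sigma> x) \<and> x \<noteq> v" for x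
    proof -
      have "\<sigma>1 x = \<sigma> x" using that p1 by (auto simp: probe_outcome_def)
      moreover have "\<sigma>2 x = \<sigma>1 x" using that by (simp add: \<sigma>2_def)
      ultimately show ?thesis using that p2 unfolding scan_outcome_def by metis
    qed
    have "\<sigma>' v = s\<lparr>outs := outs s - R2, todo := {}, flipped := flipped s \<union> R2\<rparr>"
      using p2 v2 by (auto simp: scan_outcome_def)
    then show "\<sigma>' v = (\<sigma> v)\<lparr>outs := outs (\<sigma> v) - R, todo := {}, flipped := flipped (\<sigma> v) \<union> R\<rparr>"
      by (auto simp: s_def R_def Diff_insert2[of _ t R2])
    show "R \<subseteq> ?T" using R2 tT by (auto simp: R_def)
    \<comment> \<open>A head that refuses is marked and stays marked, so every arc left with
      \<open>v\<close> ends inside the search.\<close>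
    have "\<not> ok \<Longrightarrow> t \<in> marked_set \<sigma>'"
      using p1 mk' e1 by (auto simp: probe_outcome_def extends_def)
    then show "?T - R \<subseteq> marked_set \<sigma>'" using R2 by (auto simp: R_def)
    show "flipped (\<sigma>' x) = {}" if "R = {}" "x \<in> N1 \<union> N2" for x
    proof -
      have "\<not> ok" "R2 = {}" using that by (auto simp: R_def split: if_splits)
      then show ?thesis
        using that(2) p1 p2 keep unfolding probe_outcome_def scan_outcome_def by (metis Un_iff)
    qed
    show "int (disagreement D (outs_of \<sigma>')) = int (disagreement D (outs_of \<sigma>)) +
        total_gain D \<sigma>' (N1 \<union> N2) + (\<Sum>y\<in>R. gain D v y)" for D
    proof -
      have "total_gain D \<sigma>1 N1 = total_gain D \<sigma>' N1"
        using keep by (intro total_gain_cong) simp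
      moreover have "int (disagreement D (outs_of \<sigma>')) = int (disagreement D (outs_of \<sigma>2)) +
          total_gain D \<sigma>' N2 + (\<Sum>y\<in>R2. gain D v y)"
        using p2 by (auto simp: scan_outcome_def)
      moreover have "int (disagreement D (outs_of \<sigma>2)) = int (disagreement D (outs_of \<sigma>)) +
          total_gain D \<sigma>1 N1 + (if ok then gain D v t else 0)"
        unfolding outs2 using p1 by (auto simp: probe_outcome_def)
      ultimately show ?thesis
        using tR2 finR2 by (simp add: R_def total_gain_Un[OF finN1 finN2 dj])
    qed
    have "rooted (N1 \<union> N2) ({t} \<union> (?T - {t})) \<sigma>'"
      using p1 p2 keep smk(2) by (intro rooted_Un) (auto simp: probe_outcome_def scan_outcome_def v2)
    moreover have "{t} \<union> (?T - {t}) = ?T" using tT by auto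
    ultimately show "rooted (N1 \<union> N2) ?T \<sigma>'" by simp
  qed
  moreover have "reaches \<Delta> G (after_advance \<sigma> v) (2 * card ?T + 2 * \<Delta> * card (N1 \<union> N2)) (after_advance \<sigma>' v)"
  proof (rule reaches_mono[OF reaches_trans[OF reaches_trans[OF r1[folded start] r2] r3]])
    show "1 + 2 * \<Delta> * card N1 + 1 + (2 * card (todo s) + 2 * \<Delta> * card N2) \<le>
        2 * card ?T + 2 * \<Delta> * card (N1 \<union> N2)"
      using cT Suc.hyps(2) by (simp add: card_Un_disjoint[OF finN1 finN2 dj] algebra_simps)
  qed
  ultimately show ?case by blast
qed

text \<open>Induction on the number of unmarked vertices. A marked head and a head with spare
  capacity answer at once; a full head marks itself before it scans, so all probes it sends fall
  under the induction hypothesis.\<close>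

lemma probe: "searching \<sigma> \<Longrightarrow> probe_terminates \<sigma>"
proof (induction "card (verts G - marked_set \<sigma>)" arbitrary: \<sigma> rule: less_induct)
  case less
  show ?case
    unfolding probe_terminates_def
  proof (intro allI impI)
    fix u v assume u: "marked (\<sigma> u)" and v: "v \<in> outs (\<sigma> u)"
    let ?X = "outs (\<sigma> v)"
    let ?c = "conf \<sigma> (emit G u (send {v} Probe))"
    have or: "orients (edges G) (outs_of \<sigma>)" and fin: "\<And>x. finite_state (\<sigma> x)"
      using less.prems by (auto simp: searching_def)
    have uv: "{u, v} \<in> edges G" using orients_edge[OF or v] .
    have "u \<noteq> v" "v \<in> verts G" using edgeD uv by blast+
    have uX: "u \<notin> ?X" using orients_antisym[OF or v] .
    have r1: "reaches \<Delta> G ?c 1 (conf (\<sigma>(v := fst (handle \<Delta> (\<sigma> v) u Probe)))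
        (emit G v (snd (handle \<Delta> (\<sigma> v) u Probe))))"
      using reaches_single[OF fin uv] .
    have finX: "finite ?X" using fin[of v] by (simp add: finite_state_def)
    consider (marked) "marked (\<sigma> v)" | (space) "\<not> marked (\<sigma> v)" "card ?X < \<Delta>" |
      (full) "\<not> marked (\<sigma> v)" "card ?X = \<Delta>"
      using less.prems by (force simp: searching_def resting_def)
    then show "\<exists>\<sigma>' N ok. reaches \<Delta> G ?c (1 + 2 * \<Delta> * card N)
         (conf \<sigma>' (emit G v (send {u} (if ok then Accept else Refuse)))) \<and> probe_outcome \<sigma> u v \<sigma>' N ok"
    proof cases
      case marked
      have "probe_outcome \<sigma> u v \<sigma> {} False"
        using less.prems marked
        by (auto simp: probe_outcome_def searching_def extends_def settled_def)
      then show ?thesis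
        using r1 marked
        by (intro exI[of _ \<sigma>] exI[of _ "{}"] exI[of _ False]) (simp add: handle_def)
    next
      case space
      let ?\<sigma> = "\<sigma>(v := (\<sigma> v)\<lparr>outs := insert u ?X\<rparr>)"
      have idle: "\<sigma> v = idle ?X" using less.prems space by (auto simp: searching_def resting_def)
      have se: "settled u v True ?\<sigma> = reverse (outs_of \<sigma>) u v"
        using \<open>u \<noteq> v\<close> by (auto simp: settled_def reverse_def fun_eq_iff)
      have "probe_outcome \<sigma> u v ?\<sigma> {} True"
        unfolding probe_outcome_def se
      proof (intro conjI allI impI)
        show "finite_state (?\<sigma> x)" for x using fin[of x] fin[of v] by (auto simp: finite_state_def)
        show "resting \<Delta> (?\<sigma> x)" if "\<not> marked (?\<sigma> x)" for x
        proof (cases "x = v")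
          case True
          have "(\<sigma> v)\<lparr>outs := insert u ?X\<rparr> = idle (insert u ?X)"
            by (subst idle) (simp add: idle_def)
          then show ?thesis using True space finX by (simp add: resting_def card_insert_if)
        qed (use that less.prems in \<open>auto simp: searching_def\<close>)
        show "extends \<sigma> ?\<sigma> {}" using space by (auto simp: extends_def)
        show "orients (edges G) (reverse (outs_of \<sigma>) u v)"
          using orients_reverse[OF or v] .
        show "int (disagreement D (reverse (outs_of \<sigma>) u v)) = int (disagreement D (outs_of \<sigma>)) +
            total_gain D ?\<sigma> {} + (if True then gain D u v else 0)" for D
          using disagreement_reverse[OF or v] by simp
      qed (use space in auto)
      then show ?thesis
        using r1 space
        by (intro exI[of _ ?\<sigma>] exI[of _ "{}"] exI[of _ True]) (simp add: handle_def)
    next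
      case full
      define \<sigma>1 where "\<sigma>1 = \<sigma>(v := search ?X {u})"
      have h: "handle \<Delta> (\<sigma> v) u Probe = advance (\<sigma>1 v)"
        using full by (simp add: handle_def \<sigma>1_def)
      have r1': "reaches \<Delta> G ?c 1 (after_advance \<sigma>1 v)"
        using r1 unfolding h after_advance_def by (simp add: \<sigma>1_def)
      have outs1: "outs_of \<sigma>1 = outs_of \<sigma>" by (auto simp: \<sigma>1_def fun_eq_iff)
      have mk1: "marked_set \<sigma>1 = insert v (marked_set \<sigma>)" by (simp add: \<sigma>1_def)
      have se1: "searching \<sigma>1"
        using less.prems \<open>v \<in> verts G\<close> unfolding searching_def outs1 mk1
        by (auto simp: \<sigma>1_def finite_state_def)
      have lt: "card (verts G - marked_set \<sigma>1) < card (verts G - marked_set \<sigma>)"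
        proof (rule psubset_card_mono)
        show "verts G - marked_set \<sigma>1 \<subset> verts G - marked_set \<sigma>"
          using full(1) \<open>v \<in> verts G\<close> mk1 by (auto simp: psubset_eq)
      qed (use finite_verts in simp)
      have IH: "probe_terminates \<rho>" if "searching \<rho>"
        "card (verts G - marked_set \<rho>) \<le> card (verts G - marked_set \<sigma>1)" for \<rho>
        using less.hyps that lt by (meson le_less_trans)
      have v1: "\<sigma>1 v = search ?X {u}" by (simp add: \<sigma>1_def)
      obtain \<sigma>2 N R where
        r2: "reaches \<Delta> G (after_advance \<sigma>1 v) (2 * card ?X + 2 * \<Delta> * card N) (after_advance \<sigma>2 v)" and
        p2: "scan_outcome \<sigma>1 v \<sigma>2 N R"
        using scan[OF IH se1 order_refl, of v] by (auto simp: v1)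
      have e2: "extends \<sigma>1 \<sigma>2 N" and se2: "searching \<sigma>2" using p2 by (auto simp: scan_outcome_def)
      have finN: "finite N" using e2 finite_verts finite_subset by (auto simp: extends_def)
      have vN: "v \<notin> N" using e2 by (auto simp: extends_def mk1)
      have mk2: "marked_set \<sigma>2 = insert v (marked_set \<sigma> \<union> N)" using e2 by (auto simp: extends_def mk1)
      have v2: "\<sigma>2 v = \<lparr>marked = True, outs = ?X - R, todo = {}, flipped = R, parent = {u}\<rparr>"
        using p2 by (auto simp: scan_outcome_def v1 search_def)
      have RX: "R \<subseteq> ?X" "?X - R \<subseteq> marked_set \<sigma>2" using p2 by (auto simp: scan_outcome_def v1)
      have finR: "finite R" using RX finX finite_subset by blast
      define ok where "ok = (R \<noteq> {})"
      define \<sigma>' where "\<sigma>' = \<sigma>2(v := (\<sigma>2 v)\<lparr>outs := if ok then insert u (?X - R) else ?X - R\<rparr>)"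
      have end2: "after_advance \<sigma>2 v = conf \<sigma>' (emit G v (send {u} (if ok then Accept else Refuse)))"
        by (auto simp: after_advance_def advance_def v2 \<sigma>'_def ok_def)
      have keep: "\<sigma>' x = \<sigma>2 x" if "x \<in> N" for x using that vN by (auto simp: \<sigma>'_def)
      have or2: "orients (edges G) (outs_of \<sigma>2)" using se2 by (simp add: searching_def)
      have u2: "\<sigma>2 u = \<sigma> u" using p2 \<open>u \<noteq> v\<close> u by (auto simp: scan_outcome_def \<sigma>1_def)
      have vu2: "v \<in> outs_of \<sigma>2 u" using v u2 by simp
      have se': "settled u v ok \<sigma>' = (if ok then reverse (outs_of \<sigma>2) u v else outs_of \<sigma>2)"
        using \<open>u \<noteq> v\<close> by (auto simp: settled_def reverse_def fun_eq_iff \<sigma>'_def v2 u2)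
      have mk': "marked_set \<sigma>' = marked_set \<sigma>2" using mk2 by (auto simp: \<sigma>'_def v2)
      have cardXR: "card (?X - R) + card R = \<Delta>"
        using RX finX full by (metis card_Diff_subset card_mono finR le_add_diff_inverse2)
      \<comment> \<open>A processor that accepts has given away at least one arc, so the arc of the
        parent does not lift its outdegree above \<Delta>.\<close>
      have cardR: "ok \<Longrightarrow> 0 < card R" using finR by (auto simp: ok_def card_gt_0_iff)
      have "{v, y} \<in> edges G" if "y \<in> R" for y
        using orients_edge[OF or] RX(1) that by blast
      then have expl: "explored \<sigma>' v"
        using cardXR cardR uX RX u2 u finX mk'
        by (auto simp: explored_def \<sigma>'_def v2 card_insert_if mk2)
      have "probe_outcome \<sigma> u v \<sigma>' (insert v N) ok"
        unfolding probe_outcome_def se'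
      proof (intro conjI allI impI ballI)
        show "finite_state (\<sigma>' x)" for x
          using se2 finX finR by (auto simp: \<sigma>'_def searching_def finite_state_def v2)
        show "resting \<Delta> (\<sigma>' x)" if "\<not> marked (\<sigma>' x)" for x
          using that se2 by (auto simp: \<sigma>'_def searching_def v2 split: if_splits)
        show "extends \<sigma> \<sigma>' (insert v N)"
          using e2 expl keep mk2 full \<open>v \<in> verts G\<close>
          by (auto simp: extends_def mk1 mk' explored_def)
        show "\<sigma>' x = \<sigma> x" if "marked (\<sigma> x)" for x
        proof -
          have "x \<noteq> v" using that full by auto
          then show ?thesis using that p2 by (auto simp: \<sigma>'_def scan_outcome_def \<sigma>1_def)
        qed
        show "orients (edges G) (if ok then reverse (outs_of \<sigma>2) u v else outs_of \<sigma>2)"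
          using or2 orients_reverse[OF or2 vu2] by simp
        show "marked (\<sigma>' v)" by (simp add: \<sigma>'_def v2)
        show "flipped (\<sigma>' x) = {}" if "\<not> ok" "x \<in> insert v N" for x
        proof (cases "x = v")
          case True
          then show ?thesis using that(1) by (simp add: ok_def \<sigma>'_def v2)
        next
          case False
          then have "x \<in> N" using that(2) by simp
          then show ?thesis using that(1) p2 keep[of x] by (simp add: ok_def scan_outcome_def)
        qed
        show "int (disagreement D (if ok then reverse (outs_of \<sigma>2) u v else outs_of \<sigma>2)) =
            int (disagreement D (outs_of \<sigma>)) + total_gain D \<sigma>' (insert v N) +
            (if ok then gain D u v else 0)" for D
        proof -
          have "total_gain D \<sigma>' N = total_gain D \<sigma>2 N"
            using keep by (intro total_gain_cong) simp
          moreover have "total_gain D \<sigma>' (insert v N) = (\<Sum>y\<in>R. gain D v y) + total_gain D \<sigma>' N"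
            using finN vN by (simp add: total_gain_def \<sigma>'_def v2)
          moreover have "int (disagreement D (outs_of \<sigma>2)) = int (disagreement D (outs_of \<sigma>)) +
            total_gain D \<sigma>2 N + (\<Sum>y\<in>R. gain D v y)"
            using p2 unfolding scan_outcome_def outs1 by blast
          ultimately show ?thesis
            using disagreement_reverse[OF or2 vu2, of D] by simp
        qed
        show "rooted (insert v N) {v} \<sigma>'"
          unfolding rooted_def
        proof (intro allI impI)
          fix Z assume Z: "Z \<subseteq> insert v N \<and> Z \<noteq> {} \<and> Z \<inter> {v} = {}"
          show "\<exists>y\<in>insert v N - Z. Z \<inter> (outs (\<sigma>' y) \<union> flipped (\<sigma>' y)) \<noteq> {}"
          \<comment> \<open>A set that meets the original arcs of \<open>v\<close> is entered from
            \<open>v\<close> itself, whether those arcs were reversed or not. A set that avoids them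
            is entered from another vertex of \<open>N\<close>, by the scan.\<close>
          proof (cases "Z \<inter> ?X = {}")
            case True
            then have "Z \<subseteq> N \<and> Z \<noteq> {} \<and> Z \<inter> ?X = {}" using Z by blast
            moreover have "rooted N ?X \<sigma>2"
              using p2 unfolding scan_outcome_def v1 by simp
            ultimately have "\<exists>y\<in>N - Z. Z \<inter> (outs (\<sigma>2 y) \<union> flipped (\<sigma>2 y)) \<noteq> {}"
              unfolding rooted_def by presburger
            then obtain y where y: "y \<in> N" "y \<notin> Z" "Z \<inter> (outs (\<sigma>2 y) \<union> flipped (\<sigma>2 y)) \<noteq> {}"
              by blast
            then show ?thesis by (intro bexI[of _ y]) (simp_all add: keep)
          next
            case False
            then show ?thesis using Z by (intro bexI[of _ v]) (auto simp: \<sigma>'_def v2)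
          qed
        qed
      qed
      moreover have "reaches \<Delta> G ?c (1 + 2 * \<Delta> * card (insert v N))
          (conf \<sigma>' (emit G v (send {u} (if ok then Accept else Refuse))))"
        using reaches_trans[OF r1' r2] full finN vN unfolding end2 by (simp add: algebra_simps)
      ultimately show ?thesis by blast
    qed
  qed
qed

subsection \<open>Release flood and cascade\<close>

text \<open>Several releases may arrive in one round; as they are equal, it does not matter which
  one \<open>respond\<close> selects.\<close>

lemma respond_release:
  assumes "\<And>u. r u = None \<or> r u = Some Release"
  shows "respond \<Delta> s r = (if (\<exists>u. r u \<noteq> None) \<and> marked s
    then (idle (outs s), send (outs s \<union> flipped s) Release) else (s, send {} 0))"
proof (cases "\<exists>u. r u \<noteq> None")
  case True
  then have "r (LEAST u. r u \<noteq> None) \<noteq> None" by (rule LeastI_ex)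
  then have "r (LEAST u. r u \<noteq> None) = Some Release"
    using assms[of "LEAST u. r u \<noteq> None"] by argo
  then show ?thesis using True by (auto simp: respond_def handle_def)
qed (simp add: respond_def)

text \<open>\<open>rooted\<close> is the invariant of the flood: whatever remains marked and is not
  addressed in the next round is entered from a vertex that is itself still marked. Every marked
  vertex sends once, along at most \<Delta> + 1 searched arcs, and then falls silent.\<close>

lemma flood:
  assumes "\<And>x. finite_state (\<sigma> x)" "finite (marked_set \<sigma>)"
    and "\<And>u v. t u v = None \<or> t u v = Some Release"
    and "\<And>x. marked (\<sigma> x) \<Longrightarrow> card (outs (\<sigma> x)) + card (flipped (\<sigma> x)) \<le> \<Delta> + 1"
    and "\<And>x y. marked (\<sigma> x) \<Longrightarrow> y \<in> outs (\<sigma> x) \<union> flipped (\<sigma> x) \<Longrightarrow> {x, y} \<in> edges G"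
    and "rooted (marked_set \<sigma>) {v. \<exists>u. t u v \<noteq> None} \<sigma>"
  shows "reaches \<Delta> G (conf \<sigma> t) (card {(u, v). t u v \<noteq> None} + (\<Delta> + 1) * card (marked_set \<sigma>))
    (conf (\<lambda>x. if marked (\<sigma> x) then idle (outs (\<sigma> x)) else \<sigma> x) (\<lambda>_ _. None))"
  using assms
proof (induction "card (marked_set \<sigma>)" arbitrary: \<sigma> t rule: less_induct)
  case less
  let ?T = "{v. \<exists>u. t u v \<noteq> None}"
  let ?M = "marked_set \<sigma>"
  let ?S = "\<lambda>x. outs (\<sigma> x) \<union> flipped (\<sigma> x)"
  define B where "B = ?M \<inter> ?T"
  define \<sigma>' where "\<sigma>' = (\<lambda>x. if x \<in> B then idle (outs (\<sigma> x)) else \<sigma> x)"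
  define t' where "t' = (\<lambda>u v. if u \<in> B \<and> v \<in> ?S u then Some Release else None)"
  have edge: "{x, y} \<in> edges G" if "x \<in> B" "y \<in> ?S x" for x y
    using less.prems(5) that by (auto simp: B_def)
  have resp: "respond \<Delta> (\<sigma> x) (\<lambda>u. t u x) = (if x \<in> B
      then (idle (outs (\<sigma> x)), send (?S x) Release) else (\<sigma> x, send {} 0))" for x
    using respond_release[of "\<lambda>u. t u x" "\<sigma> x"] less.prems(3) by (auto simp: B_def)
  have "comm_round (token_algorithm \<Delta>) G (conf \<sigma> t) = conf \<sigma>' t'"
    unfolding comm_round_conf[of \<sigma>, OF less.prems(1)] resp
    using edge by (auto simp: conf_def \<sigma>'_def t'_def fun_eq_iff send_def)
  then have r1: "reaches \<Delta> G (conf \<sigma> t) (card {(u, v). t u v \<noteq> None}) (conf \<sigma>' t')"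
    using reaches_step[of \<Delta> G "conf \<sigma> t"] by (simp add: messages_in_def)
  have mk': "marked_set \<sigma>' = ?M - B" by (auto simp: \<sigma>'_def marked_set_def)
  show ?case
  proof (cases "B = {}")
    case True
    have "?M = {}"
    proof (rule ccontr)
      assume "?M \<noteq> {}"
      \<comment> \<open>With no marked receiver, \<open>rooted\<close> applied to the whole marked
        set asks for an entering vertex in the empty set \<open>?M - ?M\<close>.\<close>
      then have "?M \<subseteq> ?M \<and> ?M \<noteq> {} \<and> ?M \<inter> ?T = {}" using True by (simp add: B_def)
      then show False using less.prems(6) unfolding rooted_def by blast
    qed
    then have "\<not> marked (\<sigma> x)" for x by (simp add: marked_set_def)
    then show ?thesis using r1 True by (simp add: \<sigma>'_def t'_def \<open>?M = {}\<close>)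
  next
    case False
    have finB: "finite B" using less.prems(2) by (simp add: B_def)
    have fin: "finite (outs (\<sigma> x))" "finite (flipped (\<sigma> x))" for x
      using less.prems(1)[of x] by (auto simp: finite_state_def)
    have "card {(u, v). t' u v \<noteq> None} = card (SIGMA u:B. ?S u)"
      by (rule arg_cong[of _ _ card]) (auto simp: t'_def)
    also have "\<dots> = (\<Sum>u\<in>B. card (?S u))" using finB fin by simp
    also have "\<dots> \<le> (\<Sum>u\<in>B. \<Delta> + 1)"
      by (intro sum_mono order_trans[OF card_Un_le] less.prems(4)) (auto simp: B_def)
    also have "\<dots> = (\<Delta> + 1) * card B" by simp
    finally have ct: "card {(u, v). t' u v \<noteq> None} \<le> (\<Delta> + 1) * card B" .
    have "rooted (marked_set \<sigma>') {v. \<exists>u. t' u v \<noteq> None} \<sigma>'"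
      unfolding rooted_def
    proof (intro allI impI)
      fix Z assume Z: "Z \<subseteq> marked_set \<sigma>' \<and> Z \<noteq> {} \<and> Z \<inter> {v. \<exists>u. t' u v \<noteq> None} = {}"
      then have "Z \<subseteq> ?M \<and> Z \<noteq> {} \<and> Z \<inter> ?T = {}" using mk' by (auto simp: B_def)
      then have "\<exists>y\<in>?M - Z. Z \<inter> ?S y \<noteq> {}"
        using less.prems(6) unfolding rooted_def by presburger
      then obtain y z where y: "y \<in> ?M" "y \<notin> Z" and z: "z \<in> Z" "z \<in> ?S y" by blast
      \<comment> \<open>A released vertex addresses all its searched arcs, so an arc from it into
        \<open>Z\<close> would make \<open>Z\<close> meet the next targets.\<close>
      have "y \<notin> B"
      proof
        assume "y \<in> B"
        then have "t' y z \<noteq> None" using z(2) by (simp add: t'_def)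
        then show False using Z z(1) by blast
      qed
      then show "\<exists>y\<in>marked_set \<sigma>' - Z. Z \<inter> (outs (\<sigma>' y) \<union> flipped (\<sigma>' y)) \<noteq> {}"
        using y z unfolding mk' by (intro bexI[of _ y]) (auto simp: \<sigma>'_def)
    qed
    moreover have "card (marked_set \<sigma>') < card ?M"
      unfolding mk' using less.prems(2) False by (intro psubset_card_mono) (auto simp: B_def)
    moreover have "finite (marked_set \<sigma>')" using less.prems(2) by (simp add: mk')
    ultimately have r2: "reaches \<Delta> G (conf \<sigma>' t')
        (card {(u, v). t' u v \<noteq> None} + (\<Delta> + 1) * card (marked_set \<sigma>'))
        (conf (\<lambda>x. if marked (\<sigma>' x) then idle (outs (\<sigma>' x)) else \<sigma>' x) (\<lambda>_ _. None))"
      using less.prems(1,2,4,5) fin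
      by (intro less.hyps) (auto simp: \<sigma>'_def t'_def split: if_splits)
    have e: "(\<lambda>x. if marked (\<sigma>' x) then idle (outs (\<sigma>' x)) else \<sigma>' x) =
        (\<lambda>x. if marked (\<sigma> x) then idle (outs (\<sigma> x)) else \<sigma> x)"
      by (auto simp: \<sigma>'_def B_def fun_eq_iff)
    have cM: "card (marked_set \<sigma>') = card ?M - card B" "card B \<le> card ?M"
      unfolding mk' using less.prems(2) finB
      by (auto simp: B_def card_Diff_subset intro: card_mono)
    have "(\<Delta> + 1) * card ?M = (\<Delta> + 1) * card B + (\<Delta> + 1) * card (marked_set \<sigma>')"
      using cM by (simp only: flip: distrib_left) simp
    then show ?thesis
      using ct by (intro reaches_mono[OF reaches_trans[OF r1 r2[unfolded e]]]) linarith
  qed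
qed

section \<open>Counting arcs and the drop of the disagreement\<close>

text \<open>An edge is directed one way only, so forgetting directions is injective on arcs.\<close>

lemma sum_outs_le:
  assumes "orients (edges G) X" "finite T" "S \<subseteq> T" "\<And>x. x \<in> S \<Longrightarrow> X x \<subseteq> T"
  shows "(\<Sum>x\<in>S. card (X x)) \<le> card (induced_edges G T)"
proof -
  have finX: "finite (X x)" for x
    using orients_subset[OF assms(1)] finite_verts finite_subset by blast
  have "(\<Sum>x\<in>S. card (X x)) = card (SIGMA x:S. X x)"
    using finite_subset[OF assms(3,2)] finX by simp
  also have "\<dots> = card ((\<lambda>(a, b). {a, b}) ` (SIGMA x:S. X x))"
  proof (rule card_image[symmetric], rule inj_onI, clarify)
    fix a b c d assume "b \<in> X a" "d \<in> X c" "{a, b} = {c, d}"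
    then show "a = c \<and> b = d"
      using orients_antisym[OF assms(1)] by (auto simp: doubleton_eq_iff)
  qed
  also have "\<dots> \<le> card (induced_edges G T)"
  proof (rule card_mono)
    have "induced_edges G T \<subseteq> Pow T" by (auto simp: induced_edges_def)
    then show "finite (induced_edges G T)" using assms(2) finite_subset by blast
    show "(\<lambda>(a, b). {a, b}) ` (SIGMA x:S. X x) \<subseteq> induced_edges G T"
      using orients_edge[OF assms(1)] assms(3) subsetD[OF assms(4)] by (auto simp: induced_edges_def)
  qed
  finally show ?thesis .
qed

text \<open>On an edge at \<open>x\<close> the gain is -1, or +1 if \<open>D\<close> directs that
  edge away from \<open>x\<close>; the latter happens at most \<delta> times.\<close>

lemma sum_gain_le:
  assumes "bounded_orientation \<delta> G D" "x \<in> verts G" "finite F"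
    and edge: "\<And>y. y \<in> F \<Longrightarrow> {x, y} \<in> edges G"
  shows "(\<Sum>y\<in>F. gain D x y) \<le> 2 * int \<delta> - int (card F)"
proof -
  have D: "is_orientation G D" "card {y. (x, y) \<in> D} \<le> \<delta>"
    using assms(1,2) by (auto simp: bounded_orientation_def)
  have "{y. (x, y) \<in> D} \<subseteq> verts G"
    using D(1) edgeD by (auto simp: is_orientation_def)
  then have fin: "finite {y. (x, y) \<in> D}" using finite_verts finite_subset by blast
  have "gain D x y = 2 * (if (x, y) \<in> D then 1 else 0) - 1" if "y \<in> F" for y
    using D(1) edge[OF that] unfolding is_orientation_def gain_def by auto
  then have "(\<Sum>y\<in>F. gain D x y) = (\<Sum>y\<in>F. 2 * (if (x, y) \<in> D then 1 else 0) - 1)"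
    by simp
  also have "\<dots> = 2 * (\<Sum>y\<in>F. if (x, y) \<in> D then 1 else 0) - int (card F)"
    by (simp add: sum_subtractf sum_distrib_left)
  also have "(\<Sum>y\<in>F. if (x, y) \<in> D then 1 else 0) = int (card (F \<inter> {y. (x, y) \<in> D}))"
    using assms(3) by (simp add: sum.If_cases)
  also have "card (F \<inter> {y. (x, y) \<in> D}) \<le> card {y. (x, y) \<in> D}"
    using fin by (intro card_mono) auto
  finally show ?thesis using D(2) by linarith
qed

text \<open>Here \<open>s\<close> is the number of vertices searched. \<open>D\<close> and \<delta>
  are quantified after the run because the run does not depend on them.\<close>

lemma cascade:
  assumes rest: "\<And>x. x \<noteq> v \<Longrightarrow> resting \<Delta> (\<sigma> x)" and idle: "\<And>x. \<sigma> x = idle (outs (\<sigma> x))"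
    and fin: "\<And>x. finite (outs (\<sigma> x))"
    and v: "v \<in> verts G" "card (outs (\<sigma> v)) = \<Delta> + 1"
    and or: "orients (edges G) (outs_of \<sigma>)"
    and sparse: "\<And>U. U \<subseteq> verts G \<Longrightarrow> U \<noteq> {} \<Longrightarrow> card (induced_edges G U) \<le> \<alpha> * card U"
    and "\<alpha> < \<Delta>"
  shows "\<exists>\<sigma>' m s. reaches \<Delta> G (after_advance (\<sigma>(v := search (outs (\<sigma> v)) {})) v) m (conf \<sigma>' (\<lambda>_ _. None)) \<and>
    (\<forall>x. resting \<Delta> (\<sigma>' x) \<and> finite (outs (\<sigma>' x))) \<and> orients (edges G) (outs_of \<sigma>') \<and> m \<le> 6 * \<Delta> * s \<and>
    (\<forall>D \<delta>. bounded_orientation \<delta> G D \<longrightarrow>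
       int (disagreement D (outs_of \<sigma>')) + (int \<Delta> - int \<alpha> - 2 * int \<delta>) * int s \<le>
       int (disagreement D (outs_of \<sigma>)))"
proof -
  let ?X = "outs (\<sigma> v)"
  define \<sigma>1 where "\<sigma>1 = \<sigma>(v := search ?X {})"
  have unmarked: "\<not> marked (\<sigma> x)" for x by (subst idle) simp
  have outs1: "outs_of \<sigma>1 = outs_of \<sigma>" by (auto simp: \<sigma>1_def fun_eq_iff)
  have mk1: "marked_set \<sigma>1 = {v}" using unmarked by (auto simp: \<sigma>1_def)
  have finidle: "finite_state (\<sigma> x)" for x by (subst idle) (simp add: fin)
  have v1: "\<sigma>1 v = search ?X {}" by (simp add: \<sigma>1_def)
  have "finite_state (\<sigma>1 x)" for x
    using finidle[of x] fin[of v] by (auto simp: \<sigma>1_def finite_state_def)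
  then have se1: "searching \<sigma>1"
    using or v rest unfolding searching_def outs1 mk1 by (auto simp: \<sigma>1_def)
  obtain \<sigma>2 N R where
    r: "reaches \<Delta> G (after_advance \<sigma>1 v) (2 * card ?X + 2 * \<Delta> * card N) (after_advance \<sigma>2 v)" and
    p: "scan_outcome \<sigma>1 v \<sigma>2 N R"
    using scan[OF probe se1 order_refl, of v] by (auto simp: v1)
  have ext: "extends \<sigma>1 \<sigma>2 N" and se2: "searching \<sigma>2" using p by (auto simp: scan_outcome_def)
  have finN: "finite N" using ext finite_verts finite_subset by (auto simp: extends_def)
  have vN: "v \<notin> N" using ext by (auto simp: extends_def mk1)
  have mk2: "marked_set \<sigma>2 = insert v N" using ext by (auto simp: extends_def mk1)
  have v2: "\<sigma>2 v = \<lparr>marked = True, outs = ?X - R, todo = {}, flipped = R, parent = {}\<rparr>"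
    using p by (auto simp: scan_outcome_def v1 search_def)
  have RX: "R \<subseteq> ?X" "?X - R \<subseteq> marked_set \<sigma>2" using p by (auto simp: scan_outcome_def v1)
  have finR: "finite R" using RX fin finite_subset by blast
  have or2: "orients (edges G) (outs_of \<sigma>2)" using se2 by (simp add: searching_def)
  have fin2: "finite_state (\<sigma>2 x)" for x using se2 by (simp add: searching_def)
  have expl: "explored \<sigma>2 x" if "x \<in> N" for x using ext that by (simp add: extends_def)
  let ?S = "insert v N"
  have SV: "?S \<subseteq> verts G" using ext v by (auto simp: extends_def)
  have "outs (\<sigma>2 x) \<subseteq> ?S" if "x \<in> ?S" for x
    using that RX expl unfolding mk2 explored_def by (auto simp: v2)
  \<comment> \<open>Arcs that were not reversed stay inside \<open>?S\<close>, and so do the parent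
    arcs taken over; sparsity bounds them all together.\<close>
  then have "(\<Sum>x\<in>?S. card (outs (\<sigma>2 x))) \<le> card (induced_edges G ?S)"
    using finN by (intro sum_outs_le[OF or2]) auto
  then have dense: "(\<Sum>x\<in>?S. card (outs (\<sigma>2 x))) \<le> \<alpha> * card ?S"
    using sparse[OF SV] by simp
  have cardXR: "card (?X - R) + card R = \<Delta> + 1"
    using RX fin v by (metis card_Diff_subset card_mono finR le_add_diff_inverse2)
  have "\<Delta> \<le> card (outs (\<sigma>2 x)) + card (flipped (\<sigma>2 x))" if "x \<in> ?S" for x
    using that expl cardXR unfolding explored_def by (auto simp: v2)
  then have "(\<Sum>x\<in>?S. \<Delta>) \<le> (\<Sum>x\<in>?S. card (outs (\<sigma>2 x)) + card (flipped (\<sigma>2 x)))"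
    by (rule sum_mono)
  then have total: "\<Delta> * card ?S \<le> (\<Sum>x\<in>?S. card (outs (\<sigma>2 x))) + (\<Sum>x\<in>?S. card (flipped (\<sigma>2 x)))"
    by (simp add: sum.distrib mult.commute)
  have "R \<noteq> {}"
  proof
    assume "R = {}"
    then have "\<forall>x\<in>N. flipped (\<sigma>2 x) = {}" using p by (simp add: scan_outcome_def)
    then have "\<forall>x\<in>?S. flipped (\<sigma>2 x) = {}" using \<open>R = {}\<close> by (simp add: v2)
    then have "(\<Sum>x\<in>?S. card (flipped (\<sigma>2 x))) = 0" by (intro sum.neutral) simp
    then have "\<Delta> * card ?S \<le> \<alpha> * card ?S" using total dense by linarith
    moreover have "0 < card ?S" using finN by (simp add: card_gt_0_iff)
    ultimately show False using \<open>\<alpha> < \<Delta>\<close> by simp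
  qed
  then have cR: "0 < card R" using finR by (simp add: card_gt_0_iff)
  define \<sigma>3 where "\<sigma>3 = \<sigma>2(v := idle (?X - R))"
  have outs3: "outs_of \<sigma>3 = outs_of \<sigma>2" by (auto simp: \<sigma>3_def v2 fun_eq_iff)
  have mk3: "marked_set \<sigma>3 = N" using mk2 vN by (simp add: \<sigma>3_def)
  have keep: "\<sigma>3 x = \<sigma>2 x" if "x \<in> N" for x using that vN by (auto simp: \<sigma>3_def)
  define t where "t = emit G v (send ?X Release)"
  have end2: "after_advance \<sigma>2 v = conf \<sigma>3 t"
  proof -
    have "?X - R \<union> R = ?X" using RX by blast
    then show ?thesis by (simp add: after_advance_def advance_def v2 \<sigma>3_def t_def)
  qed
  have targets: "{w. \<exists>u. t u w \<noteq> None} = ?X"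
    using orients_edge[OF or] by (auto simp: t_def emit_def send_def)
  define \<sigma>' where "\<sigma>' = (\<lambda>x. if marked (\<sigma>3 x) then idle (outs (\<sigma>3 x)) else \<sigma>3 x)"
  have flood: "reaches \<Delta> G (conf \<sigma>3 t) (card {(u, v). t u v \<noteq> None} + (\<Delta> + 1) * card (marked_set \<sigma>3))
    (conf \<sigma>' (\<lambda>_ _. None))"
    unfolding \<sigma>'_def
  proof (rule flood)
    show "finite_state (\<sigma>3 x)" for x using fin2 fin by (simp add: \<sigma>3_def)
    show "finite (marked_set \<sigma>3)" using finN by (simp add: mk3)
    show "t u w = None \<or> t u w = Some Release" for u w by (auto simp: t_def emit_def send_def)
    show "card (outs (\<sigma>3 x)) + card (flipped (\<sigma>3 x)) \<le> \<Delta> + 1" if "marked (\<sigma>3 x)" for x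
      using that mk3 expl keep[of x] mem_marked_set[of x \<sigma>3] unfolding explored_def by auto
    show "{x, y} \<in> edges G" if "marked (\<sigma>3 x)" "y \<in> outs (\<sigma>3 x) \<union> flipped (\<sigma>3 x)" for x y
    proof -
      have "x \<in> N" using that(1) mk3 mem_marked_set[of x \<sigma>3] by simp
      then show ?thesis
        using that(2) expl[of x] keep[of x] orients_edge[OF or2, of y x] unfolding explored_def by auto
    qed
    have "rooted N ?X \<sigma>2" using p unfolding scan_outcome_def v1 by simp
    then show "rooted (marked_set \<sigma>3) {v. \<exists>u. t u v \<noteq> None} \<sigma>3"
      unfolding rooted_def mk3 targets using keep by simp
  qed
  have released: "card {(u, v). t u v \<noteq> None} \<le> \<Delta> + 1"
    using messages_emit[of ?X \<sigma>3 G v Release] fin v unfolding t_def messages_in_def by simp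
  \<comment> \<open>With \<open>card ?S\<close> equal to \<open>card N + 1\<close>, scanning and
    flood cost at most 3 (\<Delta> + 1) at the root and 3 \<Delta> + 1 at each vertex of
    \<open>N\<close>. The lower-order terms are absorbed by 3 \<Delta> per vertex, since \<Delta> is
    at least 1.\<close>
  have cost: "2 * card ?X + 2 * \<Delta> * card N + (card {(u, v). t u v \<noteq> None} +
      (\<Delta> + 1) * card (marked_set \<sigma>3)) \<le> 6 * \<Delta> * card ?S"
  proof -
    have "card ?S \<le> \<Delta> * card ?S" using \<open>\<alpha> < \<Delta>\<close> by simp
    then show ?thesis
      using released finN vN by (simp add: mk3 v algebra_simps)
  qed
  have outs': "outs_of \<sigma>' = outs_of \<sigma>2" unfolding outs3[symmetric] by (auto simp: \<sigma>'_def fun_eq_iff)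
  have "resting \<Delta> (\<sigma>' x)" for x
  proof (cases "x \<in> ?S")
    case True
    then have "\<sigma>' x = idle (outs (\<sigma>2 x))"
      using mk3 keep[of x] mem_marked_set[of x \<sigma>3] by (auto simp: \<sigma>'_def v2 \<sigma>3_def)
    \<comment> \<open>For the root, which starts with \<Delta> + 1 arcs, this is where
      \<open>R\<close> being nonempty is used.\<close>
    moreover have "card (outs (\<sigma>2 x)) \<le> \<Delta>"
      using True expl[of x] cardXR cR unfolding explored_def by (auto simp: v2)
    ultimately show ?thesis by (simp add: resting_def)
  next
    case False
    then have "\<not> marked (\<sigma>2 x)" using mk2 mem_marked_set[of x \<sigma>2] by simp
    moreover have "\<sigma>' x = \<sigma>2 x" using False calculation by (auto simp: \<sigma>'_def \<sigma>3_def)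
    ultimately show ?thesis using se2 by (simp add: searching_def)
  qed
  moreover have "finite (outs (\<sigma>' x))" for x
    using fin2[of x] fun_cong[OF outs', of x] by (simp add: finite_state_def)
  moreover have "int (disagreement D (outs_of \<sigma>')) + (int \<Delta> - int \<alpha> - 2 * int \<delta>) * int (card ?S) \<le>
       int (disagreement D (outs_of \<sigma>))" if D: "bounded_orientation \<delta> G D" for D \<delta>
  proof -
    have "int (disagreement D (outs_of \<sigma>2)) = int (disagreement D (outs_of \<sigma>)) +
        total_gain D \<sigma>2 N + (\<Sum>y\<in>R. gain D v y)"
      using p unfolding scan_outcome_def outs1 by blast
    moreover have "total_gain D \<sigma>2 N + (\<Sum>y\<in>R. gain D v y) = (\<Sum>x\<in>?S. \<Sum>y\<in>flipped (\<sigma>2 x). gain D x y)"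
      using finN vN by (simp add: total_gain_def v2)
    moreover have "\<dots> \<le> (\<Sum>x\<in>?S. 2 * int \<delta> - int (card (flipped (\<sigma>2 x))))"
    proof (rule sum_mono)
      fix x assume x: "x \<in> ?S"
      have "{x, y} \<in> edges G" if "y \<in> flipped (\<sigma>2 x)" for y
        using that x expl[of x] RX orients_edge[OF or, of y v] unfolding explored_def by (auto simp: v2)
      then show "(\<Sum>y\<in>flipped (\<sigma>2 x). gain D x y) \<le> 2 * int \<delta> - int (card (flipped (\<sigma>2 x)))"
        using x SV fin2[of x] by (intro sum_gain_le[OF D]) (auto simp: finite_state_def)
    qed
    moreover have "\<dots> = 2 * int \<delta> * int (card ?S) - int (\<Sum>x\<in>?S. card (flipped (\<sigma>2 x)))"
      by (simp add: sum_subtractf)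
    moreover have "\<Delta> * card ?S \<le> \<alpha> * card ?S + (\<Sum>x\<in>?S. card (flipped (\<sigma>2 x)))"
      using total dense by linarith
    then have "int \<Delta> * int (card ?S) \<le> int \<alpha> * int (card ?S) + int (\<Sum>x\<in>?S. card (flipped (\<sigma>2 x)))"
      unfolding of_nat_mult[symmetric] of_nat_add[symmetric] of_nat_le_iff .
    moreover have "(int \<Delta> - int \<alpha> - 2 * int \<delta>) * int (card ?S) =
        int \<Delta> * int (card ?S) - int \<alpha> * int (card ?S) - 2 * int \<delta> * int (card ?S)"
      by (simp add: left_diff_distrib)
    ultimately show ?thesis unfolding outs' by linarith
  qed
  moreover have "reaches \<Delta> G (after_advance \<sigma>1 v) (2 * card ?X + 2 * \<Delta> * card N +
      (card {(u, v). t u v \<noteq> None} + (\<Delta> + 1) * card (marked_set \<sigma>3))) (conf \<sigma>' (\<lambda>_ _. None))"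
    using reaches_trans[OF r flood[folded end2]] .
  ultimately show ?thesis
    using cost or2 unfolding \<sigma>1_def[symmetric] outs'[symmetric] by blast
qed

end

section \<open>A single update\<close>

lemma network_apply_update:
  assumes "network G" "legal G x"
  shows "network (apply_update G x)"
proof -
  obtain V E where G: "G = (V, E)" by (cases G)
  show ?thesis
    using assms unfolding G
    by (cases x) (fastforce simp: network_def verts_def edges_def)+
qed

lemma network_comm_graph: "network G \<Longrightarrow> legal G x \<Longrightarrow> network (comm_graph G x)"
  using network_apply_update[of G x] by (cases x) auto

definition stable :: "nat \<Rightarrow> graph \<Rightarrow> (nat \<Rightarrow> pstate) \<Rightarrow> bool" where
  "stable \<Delta> G \<sigma> \<longleftrightarrow> (\<forall>x. resting \<Delta> (\<sigma> x) \<and> finite (outs (\<sigma> x))) \<and> orients (edges G) (outs_of \<sigma>)"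

lemma stable_idle: "stable \<Delta> G \<sigma> \<Longrightarrow> \<sigma> x = idle (outs (\<sigma> x))"
  by (simp add: stable_def resting_def)

lemma stable_finite_state: "stable \<Delta> G \<sigma> \<Longrightarrow> finite_state (\<sigma> x)"
  by (metis finite_state_idle stable_def stable_idle)

lemma resting_idle [simp]: "resting \<Delta> (idle X) \<longleftrightarrow> card X \<le> \<Delta>"
  by (simp add: resting_def)

lemma wakeup_conf:
  assumes "\<And>v. finite_state (\<sigma> v)"
  shows "wakeup (token_algorithm \<Delta>) G x (\<lambda>v. encode (\<sigma> v)) =
    conf (\<lambda>v. if v \<in> affected x then fst (start \<Delta> v (\<sigma> v) (event_at x v)) else \<sigma> v)
      (\<lambda>u v. if u \<in> affected x \<and> {u, v} \<in> edges G then snd (start \<Delta> u (\<sigma> u) (event_at x u)) v else None)"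
  using assms
  by (auto simp: wakeup_def perform_def conf_def token_algorithm_def action_of_def decode_encode fun_eq_iff)

section \<open>Potential and cost of a single update\<close>

definition reversal_count :: "(nat \<times> nat) set \<Rightarrow> (nat \<times> nat) set \<Rightarrow> nat" where
  "reversal_count D D' = card {(u, v). (u, v) \<in> D \<and> (v, u) \<in> D'}"

context network
begin

lemma disagreement_mono:
  assumes "orients (edges G) X" "\<And>a. X' a \<subseteq> X a"
  shows "disagreement D X' \<le> disagreement D X"
  unfolding disagreement_def using assms(2) by (intro card_mono orients_finite[OF assms(1)]) auto

text \<open>\<open>D\<close> directs every edge that \<open>X\<close> directs, so an arc that
  disagrees with \<open>D'\<close> but not with \<open>D\<close> is one of the counted reversals.
  \<open>D'\<close> is arbitrary because it belongs to the graph after the update.\<close>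

lemma disagreement_change:
  assumes "orients (edges G) X" "is_orientation G D"
  shows "disagreement D' X \<le> disagreement D X + reversal_count D D'"
proof -
  have "u \<in> verts G \<and> v \<in> verts G" if "(u, v) \<in> D" for u v
    using assms(2) that edgeD[of u v] by (auto simp: is_orientation_def)
  then have "D \<subseteq> verts G \<times> verts G" by auto
  then have "finite D" by (rule finite_subset) (simp add: finite_verts)
  then have fin: "finite {(u, v). (u, v) \<in> D \<and> (v, u) \<in> D'}"
    by (rule finite_subset[rotated]) auto
  have dir: "(a, b) \<in> D \<or> (b, a) \<in> D" if "b \<in> X a" for a b
    using orients_edge[OF assms(1) that] assms(2) unfolding is_orientation_def by blast
  have "{(a, b). b \<in> X a \<and> (b, a) \<in> D'} \<subseteq>
      {(a, b). b \<in> X a \<and> (b, a) \<in> D} \<union> {(u, v). (u, v) \<in> D \<and> (v, u) \<in> D'}"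
    by (clarsimp, drule dir) simp
  then have "disagreement D' X \<le> card ({(a, b). b \<in> X a \<and> (b, a) \<in> D} \<union> {(u, v). (u, v) \<in> D \<and> (v, u) \<in> D'})"
    unfolding disagreement_def using fin orients_finite[OF assms(1)] by (intro card_mono) auto
  also have "\<dots> \<le> disagreement D X + reversal_count D D'"
    unfolding disagreement_def reversal_count_def by (rule card_Un_le)
  finally show ?thesis .
qed

lemma finite_edges: "finite (edges G)"
proof -
  have "edges G \<subseteq> Pow (verts G)" using edge_cases by fastforce
  then show ?thesis using finite_verts finite_subset by blast
qed

end

text \<open>Besides \<open>12\<close> times the disagreement, the number of edges enters the potential: it pays for the
  messages of a deleted vertex to its neighbors.\<close>

definition update_cost ::
  "nat \<Rightarrow> nat \<Rightarrow> graph \<Rightarrow> (nat \<Rightarrow> pstate) \<Rightarrow> graph \<Rightarrow> (nat \<Rightarrow> pstate) \<Rightarrow> nat \<Rightarrow> bool" where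
  "update_cost \<alpha> \<Delta> G \<sigma> G' \<sigma>' m \<longleftrightarrow>
     (\<forall>\<delta> D D'. bounded_orientation \<delta> G D \<longrightarrow> bounded_orientation \<delta> G' D' \<longrightarrow> \<alpha> \<le> \<delta> \<longrightarrow> 6 * \<delta> \<le> \<Delta> \<longrightarrow>
        m + 12 * disagreement D' (outs_of \<sigma>') + card (edges G') \<le>
        12 * disagreement D (outs_of \<sigma>) + card (edges G) +
        13 * (1 + reversal_count D D'))"

text \<open>This covers all updates other than edge insertions: arcs can only disappear, so the
  disagreement grows at most through flips of the compared orientation, and messages are paid for by
  removed edges.\<close>

lemma update_cost_shrink:
  assumes "network G" "orients (edges G) (outs_of \<sigma>)"
    and "\<And>a. outs (\<sigma>' a) \<subseteq> outs (\<sigma> a)" "m + card (edges G') \<le> card (edges G)"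
  shows "update_cost \<alpha> \<Delta> G \<sigma> G' \<sigma>' m"
  unfolding update_cost_def
proof (intro allI impI)
  fix \<delta> D D' assume "bounded_orientation \<delta> G D"
  then have "is_orientation G D" by (simp add: bounded_orientation_def)
  then have "disagreement D' (outs_of \<sigma>) \<le>
      disagreement D (outs_of \<sigma>) + reversal_count D D'"
    using network.disagreement_change[OF assms(1,2)] by blast
  moreover have "disagreement D' (outs_of \<sigma>') \<le> disagreement D' (outs_of \<sigma>)"
    by (rule network.disagreement_mono[OF assms(1,2,3)])
  ultimately show "m + 12 * disagreement D' (outs_of \<sigma>') + card (edges G') \<le>
        12 * disagreement D (outs_of \<sigma>) + card (edges G) +
        13 * (1 + reversal_count D D')"
    using assms(4) unfolding distrib_left by linarith
qed

definition update_result :: "nat \<Rightarrow> nat \<Rightarrow> graph \<Rightarrow> (nat \<Rightarrow> pstate) \<Rightarrow> update \<Rightarrow> bool" where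
  "update_result \<alpha> \<Delta> G \<sigma> x \<longleftrightarrow> (\<exists>\<sigma>' m.
     reaches \<Delta> (comm_graph G x) (wakeup (token_algorithm \<Delta>) (comm_graph G x) x (\<lambda>v. encode (\<sigma> v))) m
       (conf \<sigma>' (\<lambda>_ _. None)) \<and>
     discard_deleted x (\<lambda>v. encode (\<sigma>' v)) = (\<lambda>v. encode (\<sigma>' v)) \<and>
     stable \<Delta> (apply_update G x) \<sigma>' \<and> update_cost \<alpha> \<Delta> G \<sigma> (apply_update G x) \<sigma>' m)"

lemma insert_vertex:
  assumes net: "network G" and st: "stable \<Delta> G \<sigma>" and "v \<notin> verts G"
  shows "update_result \<alpha> \<Delta> G \<sigma> (InsVertex v)"
proof -
  obtain V E where G: "G = (V, E)" by (cases G)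
  have or: "orients (edges G) (outs_of \<sigma>)" using st by (simp add: stable_def)
  \<comment> \<open>An absent vertex is already in the empty idle state, so waking it changes
    nothing.\<close>
  have "outs (\<sigma> v) = {}"
    using orients_edge[OF or] network.edgeD(1)[OF net] \<open>v \<notin> verts G\<close> by blast
  then have v: "\<sigma> v = idle {}" using stable_idle[OF st, of v] by simp
  have w: "wakeup (token_algorithm \<Delta>) (comm_graph G (InsVertex v)) (InsVertex v) (\<lambda>v. encode (\<sigma> v)) =
      conf \<sigma> (\<lambda>_ _. None)"
    unfolding wakeup_conf[of \<sigma>, OF stable_finite_state[OF st]] using v by (auto simp: conf_def fun_eq_iff)
  have e: "edges (apply_update G (InsVertex v)) = edges G" by (simp add: G edges_def)
  show ?thesis
    unfolding update_result_def w
  proof (intro exI conjI)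
    show "reaches \<Delta> (comm_graph G (InsVertex v)) (conf \<sigma> (\<lambda>_ _. None)) 0 (conf \<sigma> (\<lambda>_ _. None))"
      by (rule reaches_refl)
    show "update_cost \<alpha> \<Delta> G \<sigma> (apply_update G (InsVertex v)) \<sigma> 0"
      by (rule update_cost_shrink[OF net or]) (auto simp: e)
    show "stable \<Delta> (apply_update G (InsVertex v)) \<sigma>"
      using st unfolding stable_def e .
  qed simp
qed

lemma delete_edge:
  assumes net: "network G" and st: "stable \<Delta> G \<sigma>" and uv: "{u, v} \<in> edges G"
  shows "update_result \<alpha> \<Delta> G \<sigma> (DelEdge u v)"
proof -
  obtain V E where G: "G = (V, E)" by (cases G)
  have or: "orients (edges G) (outs_of \<sigma>)" using st by (simp add: stable_def)
  have "u \<noteq> v" using network.edgeD(3)[OF net uv] .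
  define \<sigma>' where "\<sigma>' = \<sigma>(u := idle (outs (\<sigma> u) - {v}), v := idle (outs (\<sigma> v) - {u}))"
  have w: "wakeup (token_algorithm \<Delta>) (comm_graph G (DelEdge u v)) (DelEdge u v) (\<lambda>v. encode (\<sigma> v)) =
      conf \<sigma>' (\<lambda>_ _. None)"
    unfolding wakeup_conf[of \<sigma>, OF stable_finite_state[OF st]]
    using \<open>u \<noteq> v\<close> by (auto simp: conf_def fun_eq_iff \<sigma>'_def)
  have e: "edges (apply_update G (DelEdge u v)) = edges G - {{u, v}}" by (simp add: G edges_def)
  have outs': "outs (\<sigma>' a) = outs (\<sigma> a) - {b. {a, b} = {u, v}}" for a
    using \<open>u \<noteq> v\<close> by (auto simp: \<sigma>'_def doubleton_eq_iff)
  have sub: "outs (\<sigma>' a) \<subseteq> outs (\<sigma> a)" for a unfolding outs' by blast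
  show ?thesis
    unfolding update_result_def w
  proof (intro exI conjI)
    show "reaches \<Delta> (comm_graph G (DelEdge u v)) (conf \<sigma>' (\<lambda>_ _. None)) 0 (conf \<sigma>' (\<lambda>_ _. None))"
      by (rule reaches_refl)
    have "card (edges G - {{u, v}}) \<le> card (edges G)"
      using network.finite_edges[OF net] by (intro card_mono) auto
    then show "update_cost \<alpha> \<Delta> G \<sigma> (apply_update G (DelEdge u v)) \<sigma>' 0"
      by (intro update_cost_shrink[OF net or] sub) (simp add: e)
    have "resting \<Delta> (\<sigma>' x) \<and> finite (outs (\<sigma>' x))" for x
    proof -
      have fin: "finite (outs (\<sigma> x))" and c: "card (outs (\<sigma> x)) \<le> \<Delta>"
        using st by (auto simp: stable_def resting_def)
      have "\<sigma>' x = idle (outs (\<sigma>' x))" using stable_idle[OF st, of x] by (simp add: \<sigma>'_def)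
      moreover have "card (outs (\<sigma>' x)) \<le> \<Delta>" using card_mono[OF fin sub] c by linarith
      moreover have "finite (outs (\<sigma>' x))" using fin sub by (rule finite_subset[rotated])
      ultimately show ?thesis by (simp add: resting_def)
    qed
    moreover have "outs_of \<sigma>' = (\<lambda>a. {b \<in> outs (\<sigma> a). {a, b} \<in> edges G - {{u, v}}})"
      using orients_edge[OF or] by (auto simp: fun_eq_iff outs')
    then have "orients (edges G - {{u, v}}) (outs_of \<sigma>')"
      using orients_restrict[OF or, of "edges G - {{u, v}}"] by simp
    ultimately show "stable \<Delta> (apply_update G (DelEdge u v)) \<sigma>'"
      unfolding stable_def e by blast
  qed simp
qed

text \<open>The leaving vertex cannot tell which neighbors list it as a head, so it notifies all of
  them in one round. The number of messages is its degree, hence the number of edges that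
  disappear.\<close>

lemma delete_vertex:
  assumes net: "network G" and st: "stable \<Delta> G \<sigma>"
  shows "update_result \<alpha> \<Delta> G \<sigma> (DelVertex v)"
proof -
  interpret network \<Delta> G using net .
  obtain V E where G: "G = (V, E)" by (cases G)
  have or: "orients (edges G) (outs_of \<sigma>)" using st by (simp add: stable_def)
  define \<sigma>1 where "\<sigma>1 = \<sigma>(v := idle {})"
  define t where "t = emit G v (send UNIV Leave)"
  define \<sigma>' where "\<sigma>' = (\<lambda>x. if x = v then idle {} else idle (outs (\<sigma> x) - {v}))"
  have w: "wakeup (token_algorithm \<Delta>) (comm_graph G (DelVertex v)) (DelVertex v) (\<lambda>v. encode (\<sigma> v)) =
      conf \<sigma>1 t"
    unfolding wakeup_conf[of \<sigma>, OF stable_finite_state[OF st]]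
    by (auto simp: conf_def fun_eq_iff \<sigma>1_def t_def emit_def)
  have fin1: "finite_state (\<sigma>1 x)" for x
    using stable_finite_state[OF st] by (simp add: \<sigma>1_def)
  have "respond \<Delta> (\<sigma>1 x) (\<lambda>u. t u x) = (\<sigma>' x, send {} 0)" for x
  proof (cases "{v, x} \<in> edges G")
    case True
    then have "x \<noteq> v" using edgeD(3) by blast
    have r: "(\<lambda>u. t u x) = (\<lambda>u. if u = v then Some Leave else None)"
      using True by (auto simp: t_def emit_def send_def fun_eq_iff)
    have L: "(LEAST u. (if u = v then Some Leave else None) \<noteq> None) = v"
      by (rule Least_equality) (auto split: if_splits)
    have s: "\<sigma>1 x = idle (outs (\<sigma> x))"
      using \<open>x \<noteq> v\<close> stable_idle[OF st, of x] by (simp add: \<sigma>1_def)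
    have "handle \<Delta> (idle (outs (\<sigma> x))) v Leave = (idle (outs (\<sigma> x) - {v}), send {} 0)"
      by (simp add: handle_def idle_def)
    then show ?thesis
      unfolding r respond_def L s using \<open>x \<noteq> v\<close> by (simp add: \<sigma>'_def)
  next
    case False
    then have "(\<lambda>u. t u x) = (\<lambda>_. None)" by (auto simp: t_def emit_def fun_eq_iff)
    moreover have "v \<notin> outs (\<sigma> x)"
      using orients_edge[OF or, of v x] False by (auto simp: insert_commute)
    ultimately show ?thesis
      using stable_idle[OF st, of x] by (simp add: \<sigma>1_def \<sigma>'_def)
  qed
  then have "comm_round (token_algorithm \<Delta>) G (conf \<sigma>1 t) = conf \<sigma>' (\<lambda>_ _. None)"
    unfolding comm_round_conf[of \<sigma>1, OF fin1] by (simp add: conf_def fun_eq_iff)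
  then have r: "reaches \<Delta> G (conf \<sigma>1 t) (messages_in (conf \<sigma>1 t)) (conf \<sigma>' (\<lambda>_ _. None))"
    using reaches_step[of \<Delta> G "conf \<sigma>1 t"] by simp
  let ?E' = "{e \<in> edges G. v \<notin> e}"
  have e: "edges (apply_update G (DelVertex v)) = ?E'" by (simp add: G edges_def)
  have "messages_in (conf \<sigma>1 t) = card {(u, x). t u x \<noteq> None}" by (simp add: messages_in_def)
  also have "{(u, x). t u x \<noteq> None} = (\<lambda>x. (v, x)) ` {x. {v, x} \<in> edges G}"
    by (auto simp: t_def emit_def send_def)
  also have "card \<dots> = card {x. {v, x} \<in> edges G}"
    by (rule card_image) (auto intro: inj_onI)
  \<comment> \<open>Counting recipients as incident edges makes the decrease of the number of edges
    pay for the messages.\<close>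
  also have "\<dots> = card ((\<lambda>x. {v, x}) ` {x. {v, x} \<in> edges G})"
    by (rule card_image[symmetric]) (auto intro!: inj_onI simp: doubleton_eq_iff)
  also have "\<dots> \<le> card (edges G - ?E')"
    using finite_edges by (intro card_mono) auto
  also have "\<dots> = card (edges G) - card ?E'"
    using finite_edges by (intro card_Diff_subset) auto
  finally have m: "messages_in (conf \<sigma>1 t) + card ?E' \<le> card (edges G)"
    using card_mono[OF finite_edges, of ?E'] by auto
  have sub: "outs (\<sigma>' a) \<subseteq> outs (\<sigma> a)" for a by (auto simp: \<sigma>'_def)
  show ?thesis
    unfolding update_result_def w
  proof (intro exI conjI)
    show "reaches \<Delta> (comm_graph G (DelVertex v)) (conf \<sigma>1 t) (messages_in (conf \<sigma>1 t)) (conf \<sigma>' (\<lambda>_ _. None))"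
      using r by simp
    show "discard_deleted (DelVertex v) (\<lambda>v. encode (\<sigma>' v)) = (\<lambda>v. encode (\<sigma>' v))"
      by (auto simp: \<sigma>'_def fun_eq_iff)
    show "update_cost \<alpha> \<Delta> G \<sigma> (apply_update G (DelVertex v)) \<sigma>' (messages_in (conf \<sigma>1 t))"
      using m by (intro update_cost_shrink[OF net or] sub) (simp add: e)
    have "resting \<Delta> (\<sigma>' x) \<and> finite (outs (\<sigma>' x))" for x
    proof -
      have fin: "finite (outs (\<sigma> x))" and c: "card (outs (\<sigma> x)) \<le> \<Delta>"
        using st by (auto simp: stable_def resting_def)
      have "card (outs (\<sigma>' x)) \<le> \<Delta>" using card_mono[OF fin sub] c by linarith
      then show ?thesis using fin by (auto simp: \<sigma>'_def)
    qed
    moreover have "outs_of \<sigma>' = (\<lambda>a. {b \<in> outs (\<sigma> a). {a, b} \<in> ?E'})"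
      using orients_edge[OF or] by (auto simp: fun_eq_iff \<sigma>'_def)
    then have "orients ?E' (outs_of \<sigma>')"
      using orients_restrict[OF or, of ?E'] by simp
    ultimately show "stable \<Delta> (apply_update G (DelVertex v)) \<sigma>'"
      unfolding stable_def e by blast
  qed
qed

lemma insert_edge:
  assumes net: "network G" and st: "stable \<Delta> G \<sigma>"
    and uv: "legal G (InsEdge u v)"
    and sparse: "\<And>U. U \<subseteq> verts (apply_update G (InsEdge u v)) \<Longrightarrow> U \<noteq> {} \<Longrightarrow>
      card (induced_edges (apply_update G (InsEdge u v)) U) \<le> \<alpha> * card U"
    and "\<alpha> < \<Delta>"
  shows "update_result \<alpha> \<Delta> G \<sigma> (InsEdge u v)"
proof -
  obtain V E where G: "G = (V, E)" by (cases G)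
  define G' where "G' = apply_update G (InsEdge u v)"
  have net': "network G'" using network_apply_update[OF net uv] by (simp add: G'_def)
  interpret network \<Delta> G' using net' .
  have or: "orients (edges G) (outs_of \<sigma>)" using st by (simp add: stable_def)
  define a b where "a = min u v" and "b = max u v"
  have "u \<noteq> v" using uv by (simp add: G)
  then have "a < b" and ab: "{u, v} = {a, b}" by (auto simp: a_def b_def)
  have new: "{a, b} \<notin> edges G" "a \<in> verts G'"
    using uv unfolding ab[symmetric] by (auto simp: G edges_def verts_def G'_def a_def min_def)
  have e: "edges G' = insert {a, b} (edges G)" by (simp add: G edges_def G'_def ab)
  define X where "X = insert b (outs (\<sigma> a))"
  have bX: "b \<notin> outs (\<sigma> a)" using orients_edge[OF or] new(1) by blast
  have fin: "finite (outs (\<sigma> x))" and c: "card (outs (\<sigma> x)) \<le> \<Delta>" for x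
    using st by (auto simp: stable_def resting_def)
  have cX: "card X = card (outs (\<sigma> a)) + 1" unfolding X_def using fin bX by simp
  \<comment> \<open>The reference point of the accounting: the new arc is placed at its tail and
    nothing else has happened. If \<open>X\<close> is too large this state never occurs in the run,
    which begins directly with a search.\<close>
  define \<sigma>0 where "\<sigma>0 = \<sigma>(a := idle X)"
  have outs0: "outs_of \<sigma>0 = (outs_of \<sigma>)(a := X)" by (auto simp: \<sigma>0_def fun_eq_iff)
  have or0: "orients (edges G') (outs_of \<sigma>0)"
    unfolding e outs0 X_def using \<open>a < b\<close> by (intro orients_insert[OF or new(1)]) simp
  have dis0: "disagreement D' (outs_of \<sigma>0) \<le> disagreement D (outs_of \<sigma>) + 1 +
      reversal_count D D'" if "bounded_orientation \<delta> G D" for \<delta> D D'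
  proof -
    have "{(p, q). q \<in> outs (\<sigma>0 p) \<and> (q, p) \<in> D'} \<subseteq>
        insert (a, b) {(p, q). q \<in> outs (\<sigma> p) \<and> (q, p) \<in> D'}"
      by (auto simp: \<sigma>0_def X_def split: if_splits)
    then have "disagreement D' (outs_of \<sigma>0) \<le> card (insert (a, b) {(p, q). q \<in> outs (\<sigma> p) \<and> (q, p) \<in> D'})"
      unfolding disagreement_def using network.orients_finite[OF net or] by (intro card_mono) auto
    also have "\<dots> \<le> disagreement D' (outs_of \<sigma>) + 1"
      unfolding disagreement_def using network.orients_finite[OF net or] by (simp add: card_insert_if)
    also have "disagreement D' (outs_of \<sigma>) \<le>
        disagreement D (outs_of \<sigma>) + reversal_count D D'"
      using network.disagreement_change[OF net or] that by (simp add: bounded_orientation_def)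
    finally show ?thesis by simp
  qed
  have cE: "card (edges G') = card (edges G) + 1"
    unfolding e using new(1) network.finite_edges[OF net] by simp
  define p where "p = start \<Delta> a (\<sigma> a) (EdgeInserted b)"
  have w: "wakeup (token_algorithm \<Delta>) (comm_graph G (InsEdge u v)) (InsEdge u v) (\<lambda>v. encode (\<sigma> v)) =
      conf (\<sigma>(a := fst p)) (emit G' a (snd p))"
    unfolding wakeup_conf[of \<sigma>, OF stable_finite_state[OF st]] p_def
    using \<open>u \<noteq> v\<close> by (auto simp: conf_def fun_eq_iff emit_def a_def b_def min_def max_def G'_def)
  show ?thesis
  proof (cases "card X \<le> \<Delta>")
    case True
    then have p: "p = (idle X, send {} 0)" using \<open>a < b\<close> by (simp add: p_def X_def)
    have w': "conf (\<sigma>(a := fst p)) (emit G' a (snd p)) = conf \<sigma>0 (\<lambda>_ _. None)"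
      by (auto simp: p \<sigma>0_def conf_def emit_def fun_eq_iff)
    show ?thesis
      unfolding update_result_def w w'
    proof (intro exI conjI)
      show "reaches \<Delta> (comm_graph G (InsEdge u v)) (conf \<sigma>0 (\<lambda>_ _. None)) 0 (conf \<sigma>0 (\<lambda>_ _. None))"
        by (rule reaches_refl)
      show "stable \<Delta> (apply_update G (InsEdge u v)) \<sigma>0"
        unfolding G'_def[symmetric] using or0 st True fin
        by (auto simp: stable_def \<sigma>0_def X_def)
      show "update_cost \<alpha> \<Delta> G \<sigma> (apply_update G (InsEdge u v)) \<sigma>0 0"
        unfolding G'_def[symmetric] update_cost_def
      proof (intro allI impI)
        fix \<delta> D D' assume "bounded_orientation \<delta> G D"
        from dis0[OF this, of D'] show "0 + 12 * disagreement D' (outs_of \<sigma>0) + card (edges G') \<le>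
            12 * disagreement D (outs_of \<sigma>) + card (edges G) +
            13 * (1 + reversal_count D D')"
          using cE unfolding distrib_left by linarith
      qed
    qed simp
  next
    case False
    then have cX': "card X = \<Delta> + 1" using cX c[of a] by simp
    have p: "p = advance (search X {})" using \<open>a < b\<close> False by (simp add: p_def X_def)
    have w': "conf (\<sigma>(a := fst p)) (emit G' a (snd p)) =
        after_advance (\<sigma>0(a := search (outs (\<sigma>0 a)) {})) a"
      by (simp add: after_advance_def p \<sigma>0_def)
    have "\<exists>\<sigma>' m s. reaches \<Delta> G' (after_advance (\<sigma>0(a := search (outs (\<sigma>0 a)) {})) a) m (conf \<sigma>' (\<lambda>_ _. None)) \<and>
      (\<forall>x. resting \<Delta> (\<sigma>' x) \<and> finite (outs (\<sigma>' x))) \<and> orients (edges G') (outs_of \<sigma>') \<and> m \<le> 6 * \<Delta> * s \<and>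
      (\<forall>D \<delta>. bounded_orientation \<delta> G' D \<longrightarrow>
         int (disagreement D (outs_of \<sigma>')) + (int \<Delta> - int \<alpha> - 2 * int \<delta>) * int s \<le>
         int (disagreement D (outs_of \<sigma>0)))"
    proof (rule cascade)
      show "resting \<Delta> (\<sigma>0 x)" if "x \<noteq> a" for x using that st by (simp add: \<sigma>0_def stable_def)
      show "\<sigma>0 x = idle (outs (\<sigma>0 x))" for x using stable_idle[OF st, of x] by (simp add: \<sigma>0_def)
      show "finite (outs (\<sigma>0 x))" for x using fin by (simp add: \<sigma>0_def X_def)
      show "card (outs (\<sigma>0 a)) = \<Delta> + 1" using cX' by (simp add: \<sigma>0_def)
      show "card (induced_edges G' U) \<le> \<alpha> * card U" if "U \<subseteq> verts G'" "U \<noteq> {}" for U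
        using sparse that by (simp add: G'_def)
    qed (use or0 new \<open>\<alpha> < \<Delta>\<close> in auto)
    then obtain \<sigma>' m s where
      r: "reaches \<Delta> G' (after_advance (\<sigma>0(a := search (outs (\<sigma>0 a)) {})) a) m (conf \<sigma>' (\<lambda>_ _. None))" and
      st': "stable \<Delta> G' \<sigma>'" and m: "m \<le> 6 * \<Delta> * s" and
      drop: "\<And>D \<delta>. bounded_orientation \<delta> G' D \<Longrightarrow>
         int (disagreement D (outs_of \<sigma>')) + (int \<Delta> - int \<alpha> - 2 * int \<delta>) * int s \<le>
         int (disagreement D (outs_of \<sigma>0))"
      unfolding stable_def by blast
    show ?thesis
      unfolding update_result_def w w'
    proof (intro exI conjI)
      show "reaches \<Delta> (comm_graph G (InsEdge u v)) (after_advance (\<sigma>0(a := search (outs (\<sigma>0 a)) {})) a) m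
          (conf \<sigma>' (\<lambda>_ _. None))" using r by (simp add: G'_def)
      show "stable \<Delta> (apply_update G (InsEdge u v)) \<sigma>'" using st' by (simp add: G'_def)
      show "update_cost \<alpha> \<Delta> G \<sigma> (apply_update G (InsEdge u v)) \<sigma>' m"
        unfolding G'_def[symmetric] update_cost_def
      proof (intro allI impI)
        fix \<delta> D D'
        assume D: "bounded_orientation \<delta> G D" and D': "bounded_orientation \<delta> G' D'"
          and \<delta>: "\<alpha> \<le> \<delta>" "6 * \<delta> \<le> \<Delta>"
        \<comment> \<open>Since \<alpha> + 2 \<delta> \<le> 3 \<delta> and 6 \<delta> \<le>
          \<Delta>, the drop per searched vertex is at least half of \<Delta>. Thus 6 \<Delta>
          messages per vertex are covered by 12 times the drop.\<close>
        have "int \<Delta> * int s \<le> (2 * (int \<Delta> - int \<alpha> - 2 * int \<delta>)) * int s"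
          using \<delta> by (intro mult_right_mono) auto
        moreover have "int m \<le> 6 * (int \<Delta> * int s)"
          using m by (metis mult.assoc of_nat_le_iff of_nat_mult of_nat_numeral)
        ultimately have "int m \<le> 12 * ((int \<Delta> - int \<alpha> - 2 * int \<delta>) * int s)"
          unfolding mult.assoc by linarith
        then have "m + 12 * disagreement D' (outs_of \<sigma>') \<le> 12 * disagreement D' (outs_of \<sigma>0)"
          using drop[OF D'] by linarith
        \<comment> \<open>The new edge contributes 12 through one possible disagreement and 1
          through the number of edges, which explains the 13.\<close>
        then show "m + 12 * disagreement D' (outs_of \<sigma>') + card (edges G') \<le>
            12 * disagreement D (outs_of \<sigma>) + card (edges G) +
            13 * (1 + reversal_count D D')"
          using dis0[OF D, of D'] cE unfolding distrib_left by linarith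
      qed
    qed simp
  qed
qed

lemma update:
  assumes "network G" "stable \<Delta> G \<sigma>" "legal G x"
    and "\<And>U. U \<subseteq> verts (apply_update G x) \<Longrightarrow> U \<noteq> {} \<Longrightarrow>
      card (induced_edges (apply_update G x) U) \<le> \<alpha> * card U"
    and "\<alpha> < \<Delta>"
  shows "update_result \<alpha> \<Delta> G \<sigma> x"
proof -
  obtain V E where G: "G = (V, E)" by (cases G)
  show ?thesis
  proof (cases x)
    case (InsVertex v)
    then show ?thesis using assms insert_vertex by (simp add: G verts_def)
  next
    case (DelVertex v)
    then show ?thesis using delete_vertex[OF assms(1,2)] by simp
  next
    case (InsEdge u v)
    then show ?thesis using insert_edge[OF assms(1,2) _ _ assms(5)] assms(3,4) by blast
  next
    case (DelEdge u v)
    then show ?thesis using assms delete_edge by (simp add: G edges_def)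
  qed
qed

section \<open>Sequences of updates\<close>

lemma graph_after_Nil [simp]: "graph_after [] = empty_graph"
  by (simp add: graph_after_def)

lemma graph_after_take_Suc:
  "i < length us \<Longrightarrow> graph_after (take (Suc i) us) = apply_update (graph_after (take i us)) (us ! i)"
  by (simp add: graph_after_def take_Suc_conv_app_nth)

lemma network_empty: "network empty_graph"
  by (simp add: network_def empty_graph_def verts_def edges_def)

lemma network_graph_after:
  assumes "arboricity_preserving \<alpha> us" "i \<le> length us"
  shows "network (graph_after (take i us))"
  using assms(2)
proof (induction i)
  case (Suc i)
  then show ?case
    using assms(1) network_apply_update by (simp add: graph_after_take_Suc arboricity_preserving_def)
qed (simp add: network_empty)

text \<open>The maximum in \<open>arboricity\<close> ranges over sets of at least two vertices; a
  single vertex is covered by the absence of loops.\<close>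

lemma (in network) induced_edges_arboricity:
  assumes "U \<subseteq> verts G" "U \<noteq> {}"
  shows "card (induced_edges G U) \<le> arboricity G * (card U - 1)"
proof -
  have finU: "finite U" using assms(1) finite_verts finite_subset by blast
  then have "0 < card U" using assms(2) by (simp add: card_gt_0_iff)
  show ?thesis
  proof (cases "card U = 1")
    case True
    then obtain x where "U = {x}" by (rule card_1_singletonE)
    then have "induced_edges G U = {}"
      using edge_cases by (fastforce simp: induced_edges_def)
    then show ?thesis by simp
  next
    case False
    then have U: "2 \<le> card U" using \<open>0 < card U\<close> by simp
    let ?f = "\<lambda>U. nat \<lceil>real (card (induced_edges G U)) / (real (card U) - 1)\<rceil>"
    let ?A = "{?f U | U. U \<subseteq> verts G \<and> 2 \<le> card U}"
    have "?A \<subseteq> ?f ` Pow (verts G)" by auto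
    then have "finite ?A" by (rule finite_subset) (simp add: finite_verts)
    then have "?f U \<le> arboricity G"
      unfolding arboricity_def using U assms(1) by (intro Max_ge) auto
    then have "real (card (induced_edges G U)) / (real (card U) - 1) \<le> real (arboricity G)"
      by (simp add: nat_le_iff ceiling_le_iff)
    then have "real (card (induced_edges G U)) \<le> real (arboricity G) * (real (card U) - 1)"
      using U by (simp add: divide_le_eq)
    also have "\<dots> = real (arboricity G * (card U - 1))"
      using \<open>0 < card U\<close> by (simp add: of_nat_diff)
    finally show ?thesis by linarith
  qed
qed

lemma (in network) induced_edges_le:
  assumes "arboricity G \<le> \<alpha>" "U \<subseteq> verts G" "U \<noteq> {}"
  shows "card (induced_edges G U) \<le> \<alpha> * card U"
proof -
  have "arboricity G * (card U - 1) \<le> \<alpha> * card U"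
    using assms(1) by (intro mult_le_mono) auto
  then show ?thesis using induced_edges_arboricity[OF assms(2,3)] by linarith
qed

section \<open>From reachability to rounds and messages of the procedure\<close>

lemma quiescent_comm_round:
  assumes "quiescent c"
  shows "comm_round A G c = c"
proof -
  have "transit c = (\<lambda>_ _. None)" "awake c = {}"
    using assms by (auto simp: quiescent_def fun_eq_iff)
  then show ?thesis
    by (cases c) (simp add: comm_round_def perform_def)
qed

lemma quiescent_funpow: "quiescent c \<Longrightarrow> (comm_round A G ^^ j) c = c"
  by (induction j) (simp_all add: quiescent_comm_round)

text \<open>The run described by \<open>reaches\<close> may continue beyond the first quiescent
  configuration. Such a configuration is a fixed point of \<open>comm_round\<close>, so the first
  one equals the last, and stopping earlier cannot increase the number of messages.\<close>

lemma reaches_quiescent: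
  assumes r: "reaches \<Delta> (comm_graph G x) (wakeup (token_algorithm \<Delta>) (comm_graph G x) x M) m c"
    and q: "quiescent c"
  shows "\<exists>j. quiescent (config_after (token_algorithm \<Delta>) G M x j)"
    and "config_after (token_algorithm \<Delta>) G M x (num_rounds (token_algorithm \<Delta>) G M x) = c"
    and "num_messages (token_algorithm \<Delta>) G M x \<le> m"
proof -
  let ?A = "token_algorithm \<Delta>"
  let ?c = "config_after ?A G M x"
  let ?n = "num_rounds ?A G M x"
  from r obtain J where J: "?c J = c" "(\<Sum>j<J. messages_in (?c j)) \<le> m"
    unfolding reaches_def config_after_def by blast
  then show "\<exists>j. quiescent (?c j)" using q by blast
  have qn: "quiescent (?c ?n)" unfolding num_rounds_def using J q by (metis LeastI)
  have nJ: "?n \<le> J" unfolding num_rounds_def using J q by (intro Least_le) simp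
  have "?c J = (comm_round ?A (comm_graph G x) ^^ (J - ?n)) (?c ?n)"
    unfolding config_after_def using nJ by (metis comp_apply funpow_add le_add_diff_inverse2)
  also have "\<dots> = ?c ?n" by (rule quiescent_funpow[OF qn])
  finally show "?c ?n = c" using J by simp
  have "num_messages ?A G M x \<le> (\<Sum>j<J. messages_in (?c j))"
    unfolding num_messages_def using nJ by (intro sum_mono2) auto
  then show "num_messages ?A G M x \<le> m" using J by linarith
qed

lemma fst_foldl_run_update: "fst (foldl (run_update A) (G, M) us) = foldl apply_update G us"
proof (induction us rule: rev_induct)
  case (snoc x us)
  then show ?case by (cases "foldl (run_update A) (G, M) us") (simp add: run_update_def)
qed simp

lemma memory_after_Nil [simp]: "memory_after A [] = (\<lambda>_. [])"
  by (simp add: memory_after_def)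

lemma memory_after_take_Suc:
  assumes "i < length us"
  shows "memory_after A (take (Suc i) us) =
    (let G = graph_after (take i us); M = memory_after A (take i us); x = us ! i in
     discard_deleted x (memory (config_after A G M x (num_rounds A G M x))))"
proof -
  let ?p = "foldl (run_update A) (empty_graph, \<lambda>_. []) (take i us)"
  have "fst ?p = graph_after (take i us)"
    by (simp add: fst_foldl_run_update graph_after_def)
  then show ?thesis
    using assms by (cases ?p) (simp add: memory_after_def take_Suc_conv_app_nth run_update_def Let_def)
qed

definition states_after :: "nat \<Rightarrow> update list \<Rightarrow> nat \<Rightarrow> pstate" where
  "states_after \<Delta> us = (\<lambda>v. decode (memory_after (token_algorithm \<Delta>) us v))"

text \<open>The memories themselves have to be encodings, as \<open>wakeup_conf\<close> speaks of
  encoded states and not of arbitrary lists that decode to them.\<close>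

definition well_encoded :: "nat \<Rightarrow> update list \<Rightarrow> bool" where
  "well_encoded \<Delta> us \<longleftrightarrow> stable \<Delta> (graph_after us) (states_after \<Delta> us) \<and>
     memory_after (token_algorithm \<Delta>) us = (\<lambda>v. encode (states_after \<Delta> us v))"

lemma one_update:
  assumes ap: "arboricity_preserving \<alpha> us" and "\<alpha> < \<Delta>" and i: "i < length us"
    and we: "well_encoded \<Delta> (take i us)"
  shows "well_encoded \<Delta> (take (Suc i) us)"
    and "\<exists>j. quiescent (config_at (token_algorithm \<Delta>) us i j)"
    and "update_cost \<alpha> \<Delta> (graph_after (take i us)) (states_after \<Delta> (take i us))
      (graph_after (take (Suc i) us)) (states_after \<Delta> (take (Suc i) us))
      (num_messages (token_algorithm \<Delta>) (graph_after (take i us))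
        (memory_after (token_algorithm \<Delta>) (take i us)) (us ! i))"
proof -
  let ?A = "token_algorithm \<Delta>"
  let ?G = "graph_after (take i us)" and ?G' = "graph_after (take (Suc i) us)"
  let ?M = "memory_after ?A (take i us)" and ?x = "us ! i"
  have st: "stable \<Delta> ?G (states_after \<Delta> (take i us))"
    and M: "?M = (\<lambda>v. encode (states_after \<Delta> (take i us) v))"
    using we by (simp_all add: well_encoded_def)
  have G': "?G' = apply_update ?G ?x" using graph_after_take_Suc[OF i] .
  have net: "network ?G" "network ?G'" using network_graph_after[OF ap] i by auto
  have leg: "legal ?G ?x" and arb: "arboricity ?G' \<le> \<alpha>"
    using ap i unfolding arboricity_preserving_def by (simp, meson Suc_leI)
  have "update_result \<alpha> \<Delta> ?G (states_after \<Delta> (take i us)) ?x"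
    using network.induced_edges_le[OF net(2) arb] \<open>\<alpha> < \<Delta>\<close> unfolding G'
    by (intro update[OF net(1) st leg]) auto
  then obtain \<sigma> m where
    r: "reaches \<Delta> (comm_graph ?G ?x) (wakeup ?A (comm_graph ?G ?x) ?x ?M) m (conf \<sigma> (\<lambda>_ _. None))" and
    d: "discard_deleted ?x (\<lambda>v. encode (\<sigma> v)) = (\<lambda>v. encode (\<sigma> v))" and
    st': "stable \<Delta> ?G' \<sigma>" and
    cost: "update_cost \<alpha> \<Delta> ?G (states_after \<Delta> (take i us)) ?G' \<sigma> m"
    unfolding update_result_def M[symmetric] G'[symmetric] by blast
  have q: "quiescent (conf \<sigma> (\<lambda>_ _. None))" by (simp add: quiescent_def)
  note R = reaches_quiescent[OF r q]
  have M': "memory_after ?A (take (Suc i) us) = (\<lambda>v. encode (\<sigma> v))"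
    unfolding memory_after_take_Suc[OF i] Let_def R(2) using d by simp
  then have s: "states_after \<Delta> (take (Suc i) us) = \<sigma>"
    by (simp add: states_after_def fun_eq_iff decode_encode stable_finite_state[OF st'])
  show "well_encoded \<Delta> (take (Suc i) us)"
    using M' s st' by (simp add: well_encoded_def)
  show "\<exists>j. quiescent (config_at ?A us i j)" using R(1) by (simp add: config_at_def)
  show "update_cost \<alpha> \<Delta> ?G (states_after \<Delta> (take i us)) ?G' (states_after \<Delta> (take (Suc i) us))
      (num_messages ?A ?G ?M ?x)"
    unfolding update_cost_def s
  proof (intro allI impI)
    fix \<delta> D D'
    assume "bounded_orientation \<delta> ?G D" "bounded_orientation \<delta> ?G' D'" "\<alpha> \<le> \<delta>" "6 * \<delta> \<le> \<Delta>"
    then have "m + 12 * disagreement D' (outs_of \<sigma>) + card (edges ?G') \<le>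
        12 * disagreement D (outs_of (states_after \<Delta> (take i us))) + card (edges ?G) +
        13 * (1 + reversal_count D D')"
      using cost unfolding update_cost_def by blast
    then show "num_messages ?A ?G ?M ?x + 12 * disagreement D' (outs_of \<sigma>) + card (edges ?G') \<le>
        12 * disagreement D (outs_of (states_after \<Delta> (take i us))) + card (edges ?G) +
        13 * (1 + reversal_count D D')"
      using R(3) by linarith
  qed
qed

lemma well_encoded_take:
  assumes "arboricity_preserving \<alpha> us" "\<alpha> < \<Delta>" "i \<le> length us"
  shows "well_encoded \<Delta> (take i us)"
  using assms(3)
proof (induction i)
  case 0
  have "states_after \<Delta> [] = (\<lambda>_. idle {})"
    by (simp add: states_after_def fun_eq_iff decode_Nil)
  then show ?case
    by (auto simp: well_encoded_def stable_def orients_def edges_def empty_graph_def)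
next
  case (Suc i)
  then show ?case using one_update(1)[OF assms(1,2), of i] by simp
qed

lemma terminating_token_algorithm:
  assumes "arboricity_preserving \<alpha> us" "\<alpha> < \<Delta>"
  shows "terminating (token_algorithm \<Delta>) us"
  unfolding terminating_def using one_update(2)[OF assms] well_encoded_take[OF assms] by simp

lemma maintains_orientation_token_algorithm:
  assumes "arboricity_preserving \<alpha> us" "\<alpha> < \<Delta>"
  shows "maintains_orientation \<Delta> (token_algorithm \<Delta>) us"
  unfolding maintains_orientation_def maintained_by_def
proof (intro allI impI)
  fix i assume i: "i \<le> length us"
  let ?G = "graph_after (take i us)" and ?\<sigma> = "states_after \<Delta> (take i us)"
  have st: "stable \<Delta> ?G ?\<sigma>"
    using well_encoded_take[OF assms i] by (simp add: well_encoded_def)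
  then have or: "orients (edges ?G) (outs_of ?\<sigma>)" by (simp add: stable_def)
  have "u \<in> verts ?G" if "v \<in> outs (?\<sigma> u)" for u v
    using network.edgeD(1)[OF network_graph_after[OF assms(1) i] orients_edge[OF or that]] .
  then have D: "orientation_after (token_algorithm \<Delta>) (take i us) = {(u, v). v \<in> outs (?\<sigma> u)}"
    by (auto simp: orientation_after_def states_after_def token_algorithm_def)
  have "is_orientation ?G {(u, v). v \<in> outs (?\<sigma> u)}"
    using or by (auto simp: is_orientation_def orients_def)
  moreover have "card (outs (?\<sigma> u)) \<le> \<Delta>" for u
    using st by (simp add: stable_def resting_def)
  ultimately show "bounded_orientation \<Delta> ?G (orientation_after (token_algorithm \<Delta>) (take i us))"
    unfolding D bounded_orientation_def by simp
qed

lemma flips_reversal_count: "flips us D = (\<Sum>i<length us. reversal_count (D i) (D (Suc i)))"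
  by (simp add: flips_def reversal_count_def)

lemma total_messages_le:
  assumes ap: "arboricity_preserving \<alpha> us" and \<delta>: "1 \<le> \<alpha>" "\<alpha> \<le> \<delta>" "6 * \<delta> \<le> \<Delta>"
    and D: "maintained_by \<delta> us D"
  shows "total_messages (token_algorithm \<Delta>) us \<le> 13 * (length us + flips us D)"
proof -
  let ?A = "token_algorithm \<Delta>"
  let ?m = "\<lambda>i. num_messages ?A (graph_after (take i us)) (memory_after ?A (take i us)) (us ! i)"
  let ?d = "\<lambda>i. disagreement (D i) (outs_of (states_after \<Delta> (take i us)))"
  let ?e = "\<lambda>i. card (edges (graph_after (take i us)))"
  have "\<alpha> < \<Delta>" using \<delta> by linarith
  have "(\<Sum>i<k. ?m i) + 12 * ?d k + ?e k \<le> 13 * (k + (\<Sum>i<k. reversal_count (D i) (D (Suc i))))"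
    if "k \<le> length us" for k
    using that
  proof (induction k)
    case 0
    have "states_after \<Delta> [] = (\<lambda>_. idle {})"
      by (simp add: states_after_def fun_eq_iff decode_Nil)
    then show ?case by (simp add: disagreement_def edges_def empty_graph_def)
  next
    case (Suc k)
    then have k: "k < length us" by simp
    have we: "well_encoded \<Delta> (take k us)" using well_encoded_take[OF ap \<open>\<alpha> < \<Delta>\<close>] k by simp
    have "bounded_orientation \<delta> (graph_after (take k us)) (D k)"
      "bounded_orientation \<delta> (graph_after (take (Suc k) us)) (D (Suc k))"
      using D k by (simp_all add: maintained_by_def)
    from one_update(3)[OF ap \<open>\<alpha> < \<Delta>\<close> k we, unfolded update_cost_def, rule_format, OF this \<delta>(2,3)]
    have "?m k + 12 * ?d (Suc k) + ?e (Suc k) \<le> 12 * ?d k + ?e k + 13 * (1 + reversal_count (D k) (D (Suc k)))" .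
    then show ?case using Suc by simp
  qed
  from this[of "length us"] show ?thesis
    unfolding total_messages_def flips_reversal_count by simp
qed

lemma num_rounds_le_num_messages:
  assumes "network (comm_graph G x)"
  shows "num_rounds (token_algorithm \<Delta>) G M x \<le> num_messages (token_algorithm \<Delta>) G M x"
proof -
  let ?A = "token_algorithm \<Delta>"
  let ?c = "config_after ?A G M x"
  have c: "awake (?c j) = {} \<and> (\<forall>u v. transit (?c j) u v \<noteq> None \<longrightarrow> {u, v} \<in> edges (comm_graph G x))" for j
    by (cases j) (auto simp: config_after_def wakeup_def comm_round_def perform_def
        token_algorithm_def action_of_def split: if_splits)
  have "1 \<le> messages_in (?c j)" if "j < num_rounds ?A G M x" for j
  proof -
    have "\<not> quiescent (?c j)" using that unfolding num_rounds_def by (rule not_less_Least)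
    then have "{(u, v). transit (?c j) u v \<noteq> None} \<noteq> {}" using c[of j] by (auto simp: quiescent_def)
    moreover have "{(u, v). transit (?c j) u v \<noteq> None} \<subseteq>
        verts (comm_graph G x) \<times> verts (comm_graph G x)"
      using c[of j] network.edgeD(1,2)[OF assms] by blast
    \<comment> \<open>Without finiteness the number of messages in a busy round could be 0, the
      cardinality assigned to infinite sets.\<close>
    then have "finite {(u, v). transit (?c j) u v \<noteq> None}"
      by (rule finite_subset) (use assms in \<open>simp add: network_def\<close>)
    ultimately show ?thesis unfolding messages_in_def by (simp add: Suc_le_eq card_gt_0_iff)
  qed
  then have "(\<Sum>j<num_rounds ?A G M x. 1) \<le> num_messages ?A G M x"
    unfolding num_messages_def by (intro sum_mono) simp
  then show ?thesis by simp
qed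

lemma total_rounds_le_total_messages:
  assumes "arboricity_preserving \<alpha> us"
  shows "total_rounds (token_algorithm \<Delta>) us \<le> total_messages (token_algorithm \<Delta>) us"
  unfolding total_rounds_def total_messages_def
  using assms by (intro sum_mono num_rounds_le_num_messages network_comm_graph network_graph_after)
    (auto simp: arboricity_preserving_def)

section \<open>Memory and message sizes\<close>

text \<open>The memory bound concerns every round, whereas \<open>reaches\<close> describes only the
  ends of a run, so a separate invariant of single rounds is required. The last conjunct reserves a
  place for the arc of the parent, which may enter \<open>outs\<close> later; acceptance then leaves
  the bound unchanged.\<close>

definition compact :: "nat \<Rightarrow> nat set \<Rightarrow> pstate \<Rightarrow> bool" where
  "compact \<Delta> V s \<longleftrightarrow> finite_state s \<and> outs s \<union> flipped s \<union> parent s \<subseteq> V \<and> todo s \<subseteq> outs s \<and>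
     (\<not> marked s \<longrightarrow> s = idle (outs s)) \<and>
     card ((outs s \<union> flipped s) - parent s) + card (parent s) \<le> \<Delta> + 1"

lemma compact_idle: "compact \<Delta> V (idle X) \<longleftrightarrow> finite X \<and> X \<subseteq> V \<and> card X \<le> \<Delta> + 1"
  by (auto simp: compact_def)

lemma compact_card_outs:
  assumes "compact \<Delta> V s"
  shows "card (outs s \<union> flipped s \<union> parent s) \<le> \<Delta> + 1"
proof -
  have "outs s \<union> flipped s \<union> parent s = ((outs s \<union> flipped s) - parent s) \<union> parent s" by blast
  then have "card (outs s \<union> flipped s \<union> parent s) \<le>
      card ((outs s \<union> flipped s) - parent s) + card (parent s)"
    by (metis card_Un_le)
  then show ?thesis using assms by (simp add: compact_def)
qed

lemma compact_fin:
  assumes "compact \<Delta> V s"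
  shows "finite (outs s)" "finite (flipped s)" "finite (parent s)" "finite (todo s)"
  using assms by (simp_all add: compact_def finite_state_def)

lemma compact_release:
  assumes "compact \<Delta> V s"
  shows "compact \<Delta> V (idle (outs s))"
proof -
  have "card (outs s) \<le> card (outs s \<union> flipped s \<union> parent s)"
    using compact_fin[OF assms] by (intro card_mono) auto
  then show ?thesis
    using compact_card_outs[OF assms] assms compact_fin[OF assms]
    unfolding compact_idle by (simp add: compact_def)
qed

lemma compact_advance:
  assumes "compact \<Delta> V s" "marked s"
  shows "compact \<Delta> V (fst (advance s))"
proof -
  \<comment> \<open>The arc taken over on acceptance was counted in \<open>parent\<close> from the
    start.\<close>
  have "(outs s \<union> parent s \<union> flipped s) - parent s = (outs s \<union> flipped s) - parent s" by blast
  then have "compact \<Delta> V (s\<lparr>outs := outs s \<union> parent s\<rparr>)"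
    using assms by (auto simp: compact_def finite_state_def)
  then show ?thesis using assms compact_release[OF assms(1)] by (simp add: advance_def)
qed

lemma compact_search:
  assumes "finite X" "X \<subseteq> V" "P \<subseteq> V" "finite P" "card X + card P \<le> \<Delta> + 1"
  shows "compact \<Delta> V (fst (advance (search X P)))"
proof (rule compact_advance)
  have "card (X - P) \<le> card X" using assms(1) by (intro card_mono) auto
  then show "compact \<Delta> V (search X P)"
    using assms by (auto simp: compact_def finite_state_def)
qed simp

text \<open>The message is arbitrary, so preservation needs no knowledge of the course of the
  search. Accepted arcs move from \<open>outs\<close> to \<open>flipped\<close>; only a probe brings
  in a new identifier, and it is answered according to the free capacity.\<close>

lemma compact_handle:
  assumes s: "compact \<Delta> V s" and u: "u \<in> V"
  shows "compact \<Delta> V (fst (handle \<Delta> s u m))"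
proof -
  note fin = compact_fin[OF s]
  have idle: "s = idle (outs s)" if "\<not> marked s" using s that by (simp add: compact_def)
  have probe: "compact \<Delta> V (s\<lparr>outs := insert u (outs s)\<rparr>)" if "\<not> marked s" "card (outs s) < \<Delta>"
  proof -
    have "s\<lparr>outs := insert u (outs s)\<rparr> = idle (insert u (outs s))"
      by (subst idle[OF that(1)]) (simp add: idle_def)
    then show ?thesis
      using that s u fin by (simp add: compact_idle card_insert_if) (simp add: compact_def)
  qed
  have full: "compact \<Delta> V (fst (advance (search (outs s) {u})))" if "card (outs s) = \<Delta>"
    using that s u fin by (intro compact_search) (auto simp: compact_def)
  have accept: "compact \<Delta> V (fst (advance (s\<lparr>outs := outs s - {u}, todo := todo s - {u},
      flipped := insert u (flipped s)\<rparr>)))" if "u \<in> todo s"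
  proof (rule compact_advance)
    have "u \<in> outs s" using that s by (auto simp: compact_def)
    then have "outs s - {u} \<union> insert u (flipped s) = outs s \<union> flipped s" by blast
    moreover have "marked s"
    proof (rule ccontr)
      assume "\<not> marked s"
      from idle[OF this] have "todo s = {}" by (metis idle_simps(3))
      then show False using that by simp
    qed
    ultimately show "compact \<Delta> V (s\<lparr>outs := outs s - {u}, todo := todo s - {u}, flipped := insert u (flipped s)\<rparr>)"
      using s u by (auto simp: compact_def finite_state_def)
    show "marked (s\<lparr>outs := outs s - {u}, todo := todo s - {u}, flipped := insert u (flipped s)\<rparr>)"
      using \<open>marked s\<close> by simp
  qed
  have refuse: "compact \<Delta> V (fst (advance (s\<lparr>todo := todo s - {u}\<rparr>)))"
  proof (cases "marked s")
    case True
    then show ?thesis using s by (intro compact_advance) (auto simp: compact_def finite_state_def)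
  next
    case False
    \<comment> \<open>A stray refusal at an idle processor leaves it idle with the same
      arcs.\<close>
    then have "s\<lparr>todo := todo s - {u}\<rparr> = s" by (subst (1 2 3) idle) (simp_all add: idle_def)
    moreover have "fst (advance s) = idle (outs s)"
      by (subst (1) idle[OF False]) (simp add: advance_def)
    ultimately show ?thesis using compact_release[OF s] by simp
  qed
  have leave: "compact \<Delta> V (s\<lparr>outs := outs s - {u}, todo := todo s - {u}\<rparr>)"
  proof -
    have "card ((outs s - {u} \<union> flipped s) - parent s) \<le> card ((outs s \<union> flipped s) - parent s)"
      using fin by (intro card_mono) auto
    moreover have "s\<lparr>outs := outs s - {u}, todo := todo s - {u}\<rparr> = idle (outs s - {u})" if "\<not> marked s"
      by (subst (1 2 3) idle[OF that]) (simp add: idle_def)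
    ultimately show ?thesis using s by (auto simp: compact_def finite_state_def)
  qed
  show ?thesis
    using s probe full accept refuse leave compact_release[OF s]
    by (auto simp: handle_def not_less le_antisym)
qed

lemma advance_messages: "snd (advance s) v = Some m \<Longrightarrow> m \<le> 4"
  by (auto simp: advance_def send_def split: if_splits)

lemma respond_messages: "snd (respond \<Delta> s r) v = Some m \<Longrightarrow> m \<le> 4"
  by (auto simp: respond_def handle_def send_def split: if_splits dest: advance_messages)

lemma start_messages: "snd (start \<Delta> u s ev) v = Some m \<Longrightarrow> m \<le> 4"
  by (cases ev) (auto simp: send_def split: if_splits dest: advance_messages)

definition compact_config :: "nat \<Rightarrow> graph \<Rightarrow> config \<Rightarrow> bool" where
  "compact_config \<Delta> G c \<longleftrightarrow> (\<exists>\<sigma> t. c = conf \<sigma> t \<and> (\<forall>v. compact \<Delta> (verts G) (\<sigma> v)) \<and>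
     (\<forall>u v m. t u v = Some m \<longrightarrow> {u, v} \<in> edges G \<and> m \<le> 4))"

lemma compact_comm_round:
  assumes net: "network G" and c: "compact_config \<Delta> G c"
  shows "compact_config \<Delta> G (comm_round (token_algorithm \<Delta>) G c)"
proof -
  from c obtain \<sigma> t where c: "c = conf \<sigma> t" and \<sigma>: "\<And>v. compact \<Delta> (verts G) (\<sigma> v)"
    and t: "\<And>u v m. t u v = Some m \<Longrightarrow> {u, v} \<in> edges G \<and> m \<le> 4"
    unfolding compact_config_def by blast
  have fin: "finite_state (\<sigma> v)" for v using \<sigma> by (simp add: compact_def)
  have "compact \<Delta> (verts G) (fst (respond \<Delta> (\<sigma> v) (\<lambda>u. t u v)))" for v
  proof (cases "\<exists>u. t u v \<noteq> None")
    case True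
    define u where "u = (LEAST u. t u v \<noteq> None)"
    have "t u v \<noteq> None" unfolding u_def using True by (rule LeastI_ex)
    then have "u \<in> verts G" using t network.edgeD(1)[OF net] by blast
    then show ?thesis
      using True compact_handle[OF \<sigma>] by (simp add: respond_def u_def)
  qed (use \<sigma> in \<open>simp add: respond_def\<close>)
  then show ?thesis
    unfolding compact_config_def c comm_round_conf[of \<sigma>, OF fin]
    by (intro exI conjI) (auto split: if_splits dest: respond_messages)
qed

lemma verts_comm_graph: "verts G \<subseteq> verts (comm_graph G x)"
  by (cases G; cases x) (auto simp: verts_def)

lemma compact_wakeup:
  assumes net: "network G" and leg: "legal G x" and st: "stable \<Delta> G \<sigma>"
  shows "compact_config \<Delta> (comm_graph G x)
    (wakeup (token_algorithm \<Delta>) (comm_graph G x) x (\<lambda>v. encode (\<sigma> v)))"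
proof -
  let ?V = "verts (comm_graph G x)"
  have or: "orients (edges G) (outs_of \<sigma>)" using st by (simp add: stable_def)
  have fin: "finite (outs (\<sigma> v))" and c: "card (outs (\<sigma> v)) \<le> \<Delta>" for v
    using st by (auto simp: stable_def resting_def)
  have sub: "outs (\<sigma> v) \<subseteq> ?V" for v
    using network.orients_subset[OF net or] verts_comm_graph by blast
  have old: "compact \<Delta> ?V (\<sigma> v)" for v
    by (subst stable_idle[OF st]) (use fin c[of v] sub in \<open>simp add: compact_idle\<close>)
  have "compact \<Delta> ?V (fst (start \<Delta> v (\<sigma> v) (event_at x v)))" if "v \<in> affected x" for v
  proof (cases "event_at x v")
    case (EdgeInserted w)
    have ci: "card (insert w (outs (\<sigma> v))) \<le> \<Delta> + 1"
      using fin c[of v] by (simp add: card_insert_if)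
    have "w \<in> ?V"
      using EdgeInserted leg by (cases x; cases G) (auto simp: verts_def split: if_splits)
    then show ?thesis
      using EdgeInserted old sub fin ci by (auto simp: compact_idle intro!: compact_search)
  next
    case (EdgeDeleted w)
    have "card (outs (\<sigma> v) - {w}) \<le> \<Delta> + 1"
      using card_mono[OF fin, of "outs (\<sigma> v) - {w}" v] c[of v] by auto
    then show ?thesis using EdgeDeleted sub[of v] fin by (auto simp: compact_idle)
  qed (auto simp: compact_idle)
  then show ?thesis
    unfolding compact_config_def wakeup_conf[of \<sigma>, OF stable_finite_state[OF st]]
    by (intro exI conjI) (auto simp: old split: if_splits dest: start_messages)
qed

lemma compact_config_at:
  assumes "arboricity_preserving \<alpha> us" "\<alpha> < \<Delta>" "i < length us"
  shows "compact_config \<Delta> (comm_graph (graph_after (take i us)) (us ! i)) (config_at (token_algorithm \<Delta>) us i j)"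
proof -
  let ?G = "graph_after (take i us)"
  have net: "network ?G" and leg: "legal ?G (us ! i)"
    using assms network_graph_after[OF assms(1), of i] by (auto simp: arboricity_preserving_def)
  have we: "well_encoded \<Delta> (take i us)" using well_encoded_take[OF assms(1,2)] assms(3) by simp
  show ?thesis
    unfolding config_at_def config_after_def
  proof (induction j)
    case 0
    have "stable \<Delta> ?G (states_after \<Delta> (take i us))" and
      M: "memory_after (token_algorithm \<Delta>) (take i us) = (\<lambda>v. encode (states_after \<Delta> (take i us) v))"
      using we by (simp_all add: well_encoded_def)
    then show ?case using compact_wakeup[OF net leg] unfolding M by simp
  next
    case (Suc j)
    then show ?case using compact_comm_round[OF network_comm_graph[OF net leg]] by simp
  qed
qed

section \<open>Number and size of the stored words\<close>

text \<open>One word for the mark and four sets of at most \<Delta> + 1 identifiers, hence 1 + 4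
  (\<Delta> + 1).\<close>

lemma card_state_words:
  assumes "compact \<Delta> V s"
  shows "card (state_words s) \<le> 4 * \<Delta> + 5"
proof -
  note fin = compact_fin[OF assms]
  have le: "card A \<le> \<Delta> + 1" if "A \<subseteq> outs s \<union> flipped s \<union> parent s" for A
    using card_mono[OF _ that] compact_card_outs[OF assms] fin by (simp add: le_trans)
  have "card (state_words s) \<le> card (if marked s then {0::nat} else {}) + card (outs s) + card (todo s) +
      card (flipped s) + card (parent s)"
    unfolding state_words_def
    by (intro order_trans[OF card_Un_le] add_mono card_image_le fin order_refl)
  moreover have "card (if marked s then {0::nat} else {}) \<le> 1" by simp
  moreover have "todo s \<subseteq> outs s" using assms by (simp add: compact_def)
  then have "card (todo s) \<le> \<Delta> + 1" by (intro le) auto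
  moreover have "card (outs s) \<le> \<Delta> + 1" "card (flipped s) \<le> \<Delta> + 1" "card (parent s) \<le> \<Delta> + 1"
    by (intro le; auto)+
  ultimately show ?thesis by linarith
qed

text \<open>The largest word that an identifier below \<open>N\<close> can produce is 5
  (\<open>N\<close> - 1) + 4.\<close>

lemma state_words_less:
  assumes "compact \<Delta> V s" "V \<subseteq> {..<N}" "w \<in> state_words s" "0 < N"
  shows "w < 5 * N"
proof -
  have "outs s \<union> todo s \<union> flipped s \<union> parent s \<subseteq> {..<N}"
    using assms(1,2) unfolding compact_def by blast
  then have "x < N" if "x \<in> outs s \<union> todo s \<union> flipped s \<union> parent s" for x using that by blast
  then show ?thesis
    using assms(3,4) unfolding state_words_def by (fastforce split: if_splits)
qed

lemma verts_comm_graph_size_bounded: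
  assumes "size_bounded k n us" "i < length us"
  shows "verts (comm_graph (graph_after (take i us)) (us ! i)) \<subseteq> {..<n ^ k}"
proof -
  have "verts (graph_after (take i us)) \<subseteq> {..<n ^ k}" "verts (graph_after (take (Suc i) us)) \<subseteq> {..<n ^ k}"
    using assms by (auto simp: size_bounded_def)
  then show ?thesis
    unfolding graph_after_take_Suc[OF assms(2)] by (cases "us ! i") auto
qed

text \<open>The factor 5 is below 8, hence at most \<open>n ^ 3\<close>, and 3 + \<open>k\<close> is
  at most 4 \<open>k\<close>; this is where the lower bound 4 for \<open>C\<close> comes
  from.\<close>

lemma word_bound:
  fixes n :: nat
  assumes "1 \<le> k" "2 \<le> n" "4 \<le> C"
  shows "5 * n ^ k \<le> n ^ (C * k)"
proof -
  have "(5::nat) \<le> 2 ^ 3" by simp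
  also have "\<dots> \<le> n ^ 3" using assms(2) by (rule power_mono) simp
  finally have "5 * n ^ k \<le> n ^ 3 * n ^ k" by simp
  also have "\<dots> = n ^ (3 + k)" by (simp add: power_add)
  also have "\<dots> \<le> n ^ (C * k)"
  proof (rule power_increasing)
    have "4 * k \<le> C * k" using assms(3) by simp
    then show "3 + k \<le> C * k" using assms(1) by linarith
  qed (use assms(2) in simp)
  finally show ?thesis .
qed

lemma congest_token_algorithm:
  assumes "arboricity_preserving \<alpha> us" "\<alpha> < \<Delta>" "1 \<le> k" "2 \<le> n" "4 \<le> C"
  shows "congest (C * k) n (token_algorithm \<Delta>) us"
  unfolding congest_def
proof (intro allI impI)
  fix i j u v m
  assume "i < length us" "transit (config_at (token_algorithm \<Delta>) us i j) u v = Some m"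
  then have "m \<le> 4"
    using compact_config_at[OF assms(1,2), of i j] unfolding compact_config_def by auto
  also have "4 < 5 * n ^ k" using assms(4) by (simp add: less_le_trans[of 4 5])
  also have "\<dots> \<le> n ^ (C * k)" using word_bound assms by blast
  finally show "m < n ^ (C * k)" .
qed

lemma memory_bounded_token_algorithm:
  assumes "arboricity_preserving \<alpha> us" "\<alpha> < \<Delta>" "1 \<le> k" "2 \<le> n" "4 \<le> C"
    and sb: "size_bounded k n us" and "real (9 * \<Delta>) \<le> r"
  shows "memory_bounded r (C * k) n (token_algorithm \<Delta>) us"
  unfolding memory_bounded_def
proof (intro allI impI ballI)
  fix i j v assume i: "i < length us"
  obtain \<sigma> t where c: "config_at (token_algorithm \<Delta>) us i j = conf \<sigma> t"
    and \<sigma>: "compact \<Delta> (verts (comm_graph (graph_after (take i us)) (us ! i))) (\<sigma> v)"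
    using compact_config_at[OF assms(1,2) i, of j] unfolding compact_config_def by blast
  have fin: "finite (state_words (\<sigma> v))"
    using compact_fin[OF \<sigma>] by (simp add: state_words_def)
  have "length (encode (\<sigma> v)) \<le> 4 * \<Delta> + 5"
    using card_state_words[OF \<sigma>] by (simp add: encode_def)
  \<comment> \<open>\<Delta> is positive, so the additive 5 is at most 5 \<Delta>.\<close>
  then have "length (encode (\<sigma> v)) \<le> 9 * \<Delta>" using assms(2) by linarith
  then have "real (length (encode (\<sigma> v))) \<le> r" using assms(7) by linarith
  moreover have "w < n ^ (C * k)" if "w \<in> set (encode (\<sigma> v))" for w
  proof -
    have "w \<in> state_words (\<sigma> v)" using that fin by (simp add: encode_def)
    then have "w < 5 * n ^ k"
      using assms(4) by (intro state_words_less[OF \<sigma> verts_comm_graph_size_bounded[OF sb i]]) auto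
    also have "\<dots> \<le> n ^ (C * k)" using word_bound assms by blast
    finally show ?thesis .
  qed
  ultimately show "real (length (memory (config_at (token_algorithm \<Delta>) us i j) v)) \<le> r \<and>
      (\<forall>w\<in>set (memory (config_at (token_algorithm \<Delta>) us i j) v). w < n ^ (C * k))"
    unfolding c by simp
qed

section \<open>Orientations with few flips\<close>

definition arcs :: "(nat \<Rightarrow> nat set) \<Rightarrow> (nat \<times> nat) set" where
  "arcs X = {(a, b). b \<in> X a}"

lemma arcs_iff [simp]: "(a, b) \<in> arcs X \<longleftrightarrow> b \<in> X a"
  by (simp add: arcs_def)

text \<open>The layers are cumulative: balls of directed radius \<open>i\<close> around
  \<open>u\<close>, not spheres.\<close>

fun layer :: "(nat \<Rightarrow> nat set) \<Rightarrow> nat \<Rightarrow> nat \<Rightarrow> nat set" where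
  "layer X u 0 = {u}"
| "layer X u (Suc i) = layer X u i \<union> \<Union> (X ` layer X u i)"

lemma layer_mono: "i \<le> j \<Longrightarrow> layer X u i \<subseteq> layer X u j"
  by (induction rule: dec_induct) auto

context network
begin

text \<open>\<open>Y\<close> directs every edge, so an edge on which \<open>X\<close> and
  \<open>Z\<close> differ changes direction on the way to \<open>Y\<close> or after it.\<close>

lemma reversal_count_trans:
  assumes "orients (edges G) X" "orients (edges G) Y" "orients (edges G) Z"
  shows "reversal_count (arcs X) (arcs Z) \<le>
    reversal_count (arcs X) (arcs Y) + reversal_count (arcs Y) (arcs Z)"
proof -
  have "b \<in> Y a \<or> a \<in> Y b" if "b \<in> X a" for a b
    using orients_edge[OF assms(1) that] assms(2) unfolding orients_def by blast
  then have "{(a, b). b \<in> X a \<and> a \<in> Z b} \<subseteq>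
      {(a, b). b \<in> X a \<and> a \<in> Y b} \<union> {(a, b). b \<in> Y a \<and> a \<in> Z b}"
    by auto
  then have "card {(a, b). b \<in> X a \<and> a \<in> Z b} \<le>
      card ({(a, b). b \<in> X a \<and> a \<in> Y b} \<union> {(a, b). b \<in> Y a \<and> a \<in> Z b})"
    using orients_finite[OF assms(1)] orients_finite[OF assms(2)] by (intro card_mono) auto
  also have "\<dots> \<le> card {(a, b). b \<in> X a \<and> a \<in> Y b} + card {(a, b). b \<in> Y a \<and> a \<in> Z b}"
    by (rule card_Un_le)
  finally show ?thesis by (simp add: reversal_count_def)
qed

lemma reversal_count_self:
  assumes "orients E X" "\<And>a. X' a \<subseteq> X a"
  shows "reversal_count (arcs X) (arcs X') = 0"
proof -
  have "{(a, b). b \<in> X a \<and> a \<in> X' b} = {}"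
    using orients_antisym[OF assms(1)] assms(2) by blast
  then show ?thesis unfolding reversal_count_def arcs_iff by (simp only: card.empty)
qed

lemma reversal_count_reverse:
  assumes "orients (edges G) X"
  shows "reversal_count (arcs X) (arcs (reverse X v w)) \<le> 1"
proof -
  have "{(a, b). b \<in> X a \<and> a \<in> reverse X v w b} \<subseteq> {(v, w)}"
    using orients_antisym[OF assms] by (auto simp: reverse_def split: if_splits)
  then have "card {(a, b). b \<in> X a \<and> a \<in> reverse X v w b} \<le> card {(v, w)}"
    by (intro card_mono) auto
  then show ?thesis by (simp add: reversal_count_def)
qed

text \<open>Flipping the last edge of a shortest path from \<open>u\<close> to a vertex of small outdegree leaves the
  earlier layers reachable, so the deficiency moves towards \<open>u\<close> one layer at a time.\<close>

lemma rebalance: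
  assumes "orients (edges G) X" "\<And>x. x \<noteq> u \<Longrightarrow> card (X x) \<le> d" "card (X u) \<le> d + 1"
    and "w \<in> layer X u i" "card (X w) < d"
  shows "\<exists>X'. orients (edges G) X' \<and> (\<forall>x. card (X' x) \<le> d) \<and> reversal_count (arcs X) (arcs X') \<le> i"
  using assms
proof (induction i arbitrary: X w rule: less_induct)
  case (less i)
  have fin: "finite (X x)" for x
    using orients_subset[OF less.prems(1)] finite_verts finite_subset by blast
  show ?case
  proof (cases "card (X u) \<le> d")
    case True
    then have "\<forall>x. card (X x) \<le> d" using less.prems(2) by metis
    then show ?thesis using less.prems(1) reversal_count_self[OF less.prems(1), of X] by (intro exI[of _ X]) simp
  next
    case False
    show ?thesis
    \<comment> \<open>A closer vertex of small outdegree is left to the induction hypothesis.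
      Otherwise \<open>w\<close> is at distance exactly \<open>i\<close>, so the path to it is a
      shortest one.\<close>
    proof (cases "\<exists>j<i. \<exists>w\<in>layer X u j. card (X w) < d")
      case True
      then obtain j w' where "j < i" "w' \<in> layer X u j" "card (X w') < d" by blast
      from less.IH[OF this(1) less.prems(1-3) this(2,3)] \<open>j < i\<close> show ?thesis
        by (meson less_imp_le order_trans)
    next
      case earlier: False
      have "i \<noteq> 0" using less.prems(4,5) False by (cases i) auto
      then obtain j where i: "i = Suc j" by (cases i) auto
      then have nw: "w \<notin> layer X u j" using earlier less.prems(5) by blast
      then obtain v where v: "v \<in> layer X u j" "w \<in> X v" using less.prems(4) i by auto
      have "u \<in> layer X u j" using layer_mono[of 0 j X u] by auto
      then have "w \<noteq> u" "v \<noteq> w" using nw v by auto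
      define Y where "Y = reverse X v w"
      have orY: "orients (edges G) Y" unfolding Y_def by (rule orients_reverse[OF less.prems(1) v(2)])
      have cv: "card (Y v) < card (X v)" using \<open>v \<noteq> w\<close> card_Diff1_less[OF fin v(2)]
        by (simp add: Y_def reverse_def)
      have cw: "card (Y w) \<le> d" using less.prems(5) fin by (simp add: Y_def reverse_def card_insert_if)
      have other: "Y x = X x" if "x \<noteq> v" "x \<noteq> w" for x using that by (simp add: Y_def reverse_def)
      have le: "card (Y x) \<le> d" if "x \<noteq> u" for x
        using less.prems(2)[OF that] cv cw other[of x] by (cases "x = v"; cases "x = w") auto
      have r1: "reversal_count (arcs X) (arcs Y) \<le> 1"
        unfolding Y_def by (rule reversal_count_reverse[OF less.prems(1)])
      show ?thesis
      proof (cases "v = u")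
        case True
        then have "card (Y u) \<le> d" using cv less.prems(3) by simp
        then have "\<forall>x. card (Y x) \<le> d" using le by metis
        then show ?thesis using orY r1 i by (intro exI[of _ Y]) simp
      next
        case False
        \<comment> \<open>The reversed arc ends in \<open>w\<close>, outside the ball of radius
          \<open>j\<close>, so every arc between members of that ball survives.\<close>
        have "layer X u l \<subseteq> layer Y u l" if "l \<le> j" for l
          using that
        proof (induction l)
          case (Suc l)
          have "y \<in> layer Y u (Suc l)" if x: "x \<in> layer X u l" and y: "y \<in> X x" for x y
          proof -
            have "x \<in> layer X u j" "y \<in> layer X u j"
              using x y layer_mono[of l j X u] layer_mono[of "Suc l" j X u] Suc.prems by auto
            then have "x \<noteq> w" "y \<noteq> w" using nw by auto
            then have "y \<in> Y x" using y by (auto simp: Y_def reverse_def)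
            then show ?thesis using x Suc by auto
          qed
          then show ?case using Suc by auto
        qed simp
        then have "v \<in> layer Y u j" using v(1) by blast
        \<comment> \<open>Having lost an arc, \<open>v\<close> takes over the role of
          \<open>w\<close> at distance at most \<open>j\<close>.\<close>
        moreover have "card (Y v) < d" using cv less.prems(2)[OF False] by simp
        moreover have "card (Y u) \<le> d + 1" using less.prems(3) other[of u] False \<open>w \<noteq> u\<close> by metis
        ultimately obtain Z where Z: "orients (edges G) Z" "\<forall>x. card (Z x) \<le> d"
          "reversal_count (arcs Y) (arcs Z) \<le> j"
          using less.IH[of j Y v] orY le i by blast
        have "reversal_count (arcs X) (arcs Z) \<le> i"
          using reversal_count_trans[OF less.prems(1) orY Z(1)] r1 Z(3) i by linarith
        then show ?thesis using Z by blast
      qed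
    qed
  qed
qed

lemma layer_subset: "orients (edges G) X \<Longrightarrow> u \<in> verts G \<Longrightarrow> layer X u i \<subseteq> verts G"
  using orients_subset by (induction i) auto

text \<open>The arcs leaving a ball, at least 2 \<alpha> per vertex, are edges induced by the next
  ball \<open>?T\<close>, and these number at most \<alpha> (|\<open>?T\<close>| - 1). Cancelling
  \<alpha> gives the doubling.\<close>

lemma layer_growth:
  assumes "orients (edges G) X" "u \<in> verts G" "1 \<le> \<alpha>" "arboricity G \<le> \<alpha>"
    and "\<And>j x. j < i \<Longrightarrow> x \<in> layer X u j \<Longrightarrow> 2 * \<alpha> \<le> card (X x)"
  shows "2 ^ i \<le> card (layer X u i)"
  using assms(5)
proof (induction i)
  case (Suc i)
  note sub = layer_subset[OF assms(1,2)]
  let ?S = "layer X u i" and ?T = "layer X u (Suc i)"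
  have fin: "finite ?S" "finite ?T" using sub finite_verts finite_subset by blast+
  have "2 * \<alpha> * card ?S = (\<Sum>x\<in>?S. 2 * \<alpha>)" by simp
  also have "\<dots> \<le> (\<Sum>x\<in>?S. card (X x))" using Suc.prems by (intro sum_mono) auto
  also have "\<dots> \<le> card (induced_edges G ?T)"
    using fin by (intro sum_outs_le[OF assms(1)]) auto
  also have "\<dots> \<le> arboricity G * (card ?T - 1)"
  proof (rule induced_edges_arboricity)
    show "?T \<noteq> {}" using layer_mono[of 0 "Suc i" X u] by auto
  qed (rule sub)
  also have "\<dots> \<le> \<alpha> * (card ?T - 1)" using assms(4) by (rule mult_le_mono1)
  finally have "\<alpha> * (2 * card ?S) \<le> \<alpha> * (card ?T - 1)" by (simp add: mult.assoc mult.left_commute)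
  then have "2 * card ?S \<le> card ?T - 1" using assms(3) by simp
  moreover have "2 ^ i \<le> card ?S"
    by (rule Suc.IH) (use Suc.prems less_SucI in blast)
  ultimately show ?case by simp
qed simp

end

section \<open>A low-flip orientation of a whole update sequence\<close>

definition balanced :: "nat \<Rightarrow> graph \<Rightarrow> (nat \<Rightarrow> nat set) \<Rightarrow> bool" where
  "balanced d G X \<longleftrightarrow> orients (edges G) X \<and> (\<forall>x. card (X x) \<le> d)"

lemma balanced_update:
  assumes net: "network G" and leg: "legal G x" and X: "balanced (2 * \<alpha>) G X"
    and arb: "1 \<le> \<alpha>" "arboricity (apply_update G x) \<le> \<alpha>"
    and n: "card (verts (apply_update G x)) < 2 ^ Suc L"
  shows "\<exists>X'. balanced (2 * \<alpha>) (apply_update G x) X' \<and> reversal_count (arcs X) (arcs X') \<le> L"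
proof -
  let ?G' = "apply_update G x"
  have net': "network ?G'" by (rule network_apply_update[OF net leg])
  have or: "orients (edges G) X" and cX: "\<And>x. card (X x) \<le> 2 * \<alpha>"
    using X by (auto simp: balanced_def)
  have fin: "finite (X a)" for a
    using network.orients_subset[OF net or] net finite_subset unfolding network_def by blast
  show ?thesis
  proof (cases "edges ?G' \<subseteq> edges G")
    case True
    let ?Y = "\<lambda>a. {b \<in> X a. {a, b} \<in> edges ?G'}"
    have "card (?Y a) \<le> 2 * \<alpha>" for a
      using card_mono[OF fin, of "?Y a" a] cX[of a] by (auto intro: le_trans)
    then have "balanced (2 * \<alpha>) ?G' ?Y"
      using orients_restrict[OF or True] by (simp add: balanced_def)
    moreover have "reversal_count (arcs X) (arcs ?Y) = 0"
      by (rule network.reversal_count_self[OF net or]) auto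
    ultimately show ?thesis by (intro exI[of _ ?Y]) simp
  next
    case False
    obtain V E where G: "G = (V, E)" by (cases G)
    obtain u v where x: "x = InsEdge u v"
      using False by (cases x) (auto simp: G edges_def)
    have uv: "u \<noteq> v" "{u, v} \<notin> edges G" "u \<in> verts ?G'"
      using leg by (auto simp: x G edges_def verts_def)
    have e: "edges ?G' = insert {u, v} (edges G)" by (simp add: x G edges_def)
    define Y where "Y = X(u := insert v (X u))"
    have orY: "orients (edges ?G') Y" unfolding e Y_def by (rule orients_insert[OF or uv(2,1)])
    have Yx: "card (Y x) \<le> 2 * \<alpha>" if "x \<noteq> u" for x using that cX by (simp add: Y_def)
    have Yu: "card (Y u) \<le> 2 * \<alpha> + 1" using cX[of u] fin by (simp add: Y_def card_insert_if)
    \<comment> \<open>If every vertex within distance \<open>L\<close> had outdegree at least 2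
      \<alpha>, the ball of radius \<open>L\<close> + 1 would contain more vertices than the
      graph.\<close>
    have "\<exists>j w. j \<le> L \<and> w \<in> layer Y u j \<and> card (Y w) < 2 * \<alpha>"
    proof (rule ccontr)
      assume "\<not> ?thesis"
      then have "2 ^ Suc L \<le> card (layer Y u (Suc L))"
        using network.layer_growth[OF net' orY uv(3) arb, of "Suc L"] by (meson less_Suc_eq_le not_less)
      moreover have "card (layer Y u (Suc L)) \<le> card (verts ?G')"
        by (rule card_mono[OF network.finite_verts[OF net'] network.layer_subset[OF net' orY uv(3)]])
      ultimately show False using n by linarith
    qed
    then obtain j w where j: "j \<le> L" "w \<in> layer Y u j" "card (Y w) < 2 * \<alpha>" by blast
    obtain Z where Z: "orients (edges ?G') Z" "\<forall>x. card (Z x) \<le> 2 * \<alpha>"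
      "reversal_count (arcs Y) (arcs Z) \<le> j"
      using network.rebalance[OF net' orY Yx Yu j(2,3)] by blast
    \<comment> \<open>\<open>X\<close> lacks the new arc, so redirecting that arc during the
      rebalancing is not counted as a flip.\<close>
    have "reversal_count (arcs X) (arcs Z) \<le> reversal_count (arcs Y) (arcs Z)"
      unfolding reversal_count_def arcs_iff
      using network.orients_finite[OF net' orY] by (intro card_mono) (auto simp: Y_def)
    then show ?thesis using Z j(1) by (intro exI[of _ Z]) (auto simp: balanced_def)
  qed
qed

lemma few_flips_orientation:
  assumes ap: "arboricity_preserving \<alpha> us" and "1 \<le> \<alpha>"
    and n: "\<And>i. i \<le> length us \<Longrightarrow> card (verts (graph_after (take i us))) < 2 ^ Suc L"
  shows "\<exists>D. maintained_by (2 * \<alpha>) us D \<and> flips us D \<le> length us * L"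
proof -
  let ?G = "\<lambda>i. graph_after (take i us)"
  \<comment> \<open>Guarding the conditions by the length of the sequence allows a dependent choice
    over all natural numbers; beyond the end any map will do.\<close>
  have "\<exists>X. \<forall>i. (i \<le> length us \<longrightarrow> balanced (2 * \<alpha>) (?G i) (X i)) \<and>
      (i < length us \<longrightarrow> reversal_count (arcs (X i)) (arcs (X (Suc i))) \<le> L)"
  proof (rule dependent_nat_choice)
    have "balanced (2 * \<alpha>) (?G 0) (\<lambda>_. {})"
      by (simp add: balanced_def orients_def edges_def empty_graph_def)
    then show "\<exists>X. 0 \<le> length us \<longrightarrow> balanced (2 * \<alpha>) (?G 0) X" by blast
  next
    fix X i assume X: "i \<le> length us \<longrightarrow> balanced (2 * \<alpha>) (?G i) X"
    show "\<exists>Y. (Suc i \<le> length us \<longrightarrow> balanced (2 * \<alpha>) (?G (Suc i)) Y) \<and>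
        (i < length us \<longrightarrow> reversal_count (arcs X) (arcs Y) \<le> L)"
    proof (cases "i < length us")
      case True
      have "legal (?G i) (us ! i)" "arboricity (?G (Suc i)) \<le> \<alpha>"
        using ap True unfolding arboricity_preserving_def by (simp, meson Suc_leI)
      then show ?thesis
        using balanced_update[OF network_graph_after[OF ap], of i "us ! i" \<alpha> X L] X True n[of "Suc i"] \<open>1 \<le> \<alpha>\<close>
        unfolding graph_after_take_Suc[OF True] by auto
    qed auto
  qed
  then obtain X where X: "\<And>i. i \<le> length us \<Longrightarrow> balanced (2 * \<alpha>) (?G i) (X i)"
    "\<And>i. i < length us \<Longrightarrow> reversal_count (arcs (X i)) (arcs (X (Suc i))) \<le> L"
    by blast
  have "bounded_orientation (2 * \<alpha>) (?G i) (arcs (X i))" if "i \<le> length us" for i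
    using X(1)[OF that] by (auto simp: bounded_orientation_def is_orientation_def balanced_def orients_def arcs_def)
  then have "maintained_by (2 * \<alpha>) us (\<lambda>i. arcs (X i))" by (simp add: maintained_by_def)
  moreover have "flips us (\<lambda>i. arcs (X i)) \<le> (\<Sum>i<length us. L)"
    unfolding flips_reversal_count by (intro sum_mono X(2)) simp
  ultimately show ?thesis by (intro exI[of _ "\<lambda>i. arcs (X i)"]) simp
qed

lemma total_messages_log:
  assumes "arboricity_preserving \<alpha> us" "1 \<le> \<alpha>" "12 * \<alpha> \<le> \<Delta>" "size_bounded k n us" "2 \<le> n"
  shows "real (total_messages (token_algorithm \<Delta>) us) \<le> 26 * log 2 (real n) * real (length us)"
proof -
  define L where "L = nat \<lfloor>log 2 (real n)\<rfloor>"
  have log: "1 \<le> log 2 (real n)" using assms(5) by simp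
  then have L: "real L \<le> log 2 (real n)" "log 2 (real n) < real (Suc L)"
    unfolding L_def by linarith+
  have "real n < 2 powr real (Suc L)" using L(2) assms(5) by (subst (asm) log_less_iff) auto
  also have "\<dots> = real (2 ^ Suc L)" by (simp add: powr_realpow del: of_nat_Suc)
  finally have "n < 2 ^ Suc L" by (simp only: of_nat_less_iff)
  then have "card (verts (graph_after (take i us))) < 2 ^ Suc L" if "i \<le> length us" for i
    using assms(4) that unfolding size_bounded_def by (meson le_less_trans)
  then obtain D where D: "maintained_by (2 * \<alpha>) us D" "flips us D \<le> length us * L"
    using few_flips_orientation[OF assms(1,2)] by blast
  \<comment> \<open>The comparison is made with \<delta> = 2 \<alpha>, so the requirement 6 \<delta>
    \<le> \<Delta> becomes 12 \<alpha> \<le> \<Delta>. This is the origin of \<open>c\<close> =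
    12.\<close>
  have "total_messages (token_algorithm \<Delta>) us \<le> 13 * (length us + flips us D)"
    using assms(3) by (intro total_messages_le[OF assms(1,2) _ _ D(1)]) auto
  also have "\<dots> \<le> 13 * (length us + length us * L)" using D(2) by simp
  finally have "real (total_messages (token_algorithm \<Delta>) us) \<le> 13 * (1 + real L) * real (length us)"
    by (simp add: algebra_simps flip: of_nat_le_iff[where ?'a = real])
  \<comment> \<open>For \<open>n\<close> at least 2 the logarithm is at least 1, so 1 +
    \<open>L\<close> is at most twice the logarithm.\<close>
  also have "\<dots> \<le> 26 * log 2 (real n) * real (length us)"
    using L(1) log by (intro mult_right_mono) auto
  finally show ?thesis .
qed

lemma amortized_update_time_le:
  "amortized_update_time (token_algorithm \<Delta>) \<alpha> k n \<le> amortized_message_complexity (token_algorithm \<Delta>) \<alpha> k n"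
  unfolding amortized_update_time_def amortized_message_complexity_def
proof (rule SUP_mono, intro bexI)
  fix us assume "us \<in> update_sequences \<alpha> k n"
  then have "arboricity_preserving \<alpha> us" by (simp add: update_sequences_def)
  then show "ennreal (real (total_rounds (token_algorithm \<Delta>) us) / real (length us)) \<le>
      ennreal (real (total_messages (token_algorithm \<Delta>) us) / real (length us))"
    using total_rounds_le_total_messages by (intro ennreal_leI divide_right_mono) auto
qed

lemma amortized_message_complexity_log:
  assumes "1 \<le> \<alpha>" "12 * \<alpha> \<le> \<Delta>" "2 \<le> n" "26 \<le> C"
  shows "amortized_message_complexity (token_algorithm \<Delta>) \<alpha> k n \<le> ennreal (C * log 2 (real n))"
  unfolding amortized_message_complexity_def
proof (intro SUP_least ennreal_leI)
  fix us assume "us \<in> update_sequences \<alpha> k n"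
  then have us: "us \<noteq> []" "arboricity_preserving \<alpha> us" "size_bounded k n us"
    by (auto simp: update_sequences_def)
  have "real (total_messages (token_algorithm \<Delta>) us) / real (length us) \<le> 26 * log 2 (real n)"
    using total_messages_log[OF us(2) assms(1,2) us(3) assms(3)] us(1) by (simp add: divide_le_eq)
  also have "\<dots> \<le> C * log 2 (real n)" using assms(3,4) by (intro mult_right_mono) auto
  finally show "real (total_messages (token_algorithm \<Delta>) us) / real (length us) \<le> C * log 2 (real n)" .
qed

theorem theorem1:
  shows "\<exists>c::real. c \<ge> 1 \<and> (\<exists>A :: nat \<Rightarrow> nat \<Rightarrow> algorithm.
    (\<exists>C::nat. \<forall>\<alpha> \<Delta> :: nat. \<alpha> \<ge> 1 \<and> real \<Delta> \<ge> c * real \<alpha> \<longrightarrow>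
       (\<forall>us. arboricity_preserving \<alpha> us \<longrightarrow>
          terminating (A \<alpha> \<Delta>) us \<and>
          maintains_orientation \<Delta> (A \<alpha> \<Delta>) us \<and>
          (\<forall>(\<delta>::nat) D. \<delta> \<ge> \<alpha> \<and> real \<Delta> \<ge> c * real \<delta> \<and> maintained_by \<delta> us D \<longrightarrow>
             total_messages (A \<alpha> \<Delta>) us \<le> C * (length us + flips us D)) \<and>
          (\<forall>k n. k \<ge> 1 \<and> n \<ge> 2 \<and> size_bounded k n us \<longrightarrow>
             congest (C * k) n (A \<alpha> \<Delta>) us \<and>
             memory_bounded (real C * real \<Delta>) (C * k) n (A \<alpha> \<Delta>) us)) \<and>
       (\<forall>k n. k \<ge> 1 \<and> n \<ge> 2 \<longrightarrow>
          amortized_update_time (A \<alpha> \<Delta>) \<alpha> k n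
            \<le> of_nat C * amortized_message_complexity (A \<alpha> \<Delta>) \<alpha> k n)) \<and>
    (\<forall>b::real. \<exists>C::nat. \<forall>\<alpha> \<Delta> :: nat.
       \<alpha> \<ge> 1 \<and> real \<Delta> \<ge> c * real \<alpha> \<and> real \<Delta> \<le> b * real \<alpha> \<longrightarrow>
       (\<forall>k n. k \<ge> 1 \<and> n \<ge> 2 \<longrightarrow>
          amortized_update_time (A \<alpha> \<Delta>) \<alpha> k n \<le> ennreal (real C * log 2 (real n)) \<and>
          amortized_message_complexity (A \<alpha> \<Delta>) \<alpha> k n \<le> ennreal (real C * log 2 (real n)) \<and>
          (\<forall>us. arboricity_preserving \<alpha> us \<and> size_bounded k n us \<longrightarrow>
             memory_bounded (real C * real \<alpha>) (C * k) n (A \<alpha> \<Delta>) us))))"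
proof (rule exI[of _ "12::real"], rule conjI, simp, rule exI[of _ "\<lambda>\<alpha>. token_algorithm"], rule conjI, goal_cases)
  case 1
  show ?case
  \<comment> \<open>One constant serves all bounds: 13 is the message constant, and it is also at
    least the 9 of the memory bound and the 4 of the word size.\<close>
  proof (rule exI[of _ "13::nat"], intro allI impI conjI; (elim conjE)?)
    fix \<alpha> \<Delta> :: nat and us assume "\<alpha> \<ge> 1" "12 * real \<alpha> \<le> real \<Delta>" and ap: "arboricity_preserving \<alpha> us"
    then have "\<alpha> < \<Delta>" by linarith
    show "terminating (token_algorithm \<Delta>) us"
      by (rule terminating_token_algorithm[OF ap \<open>\<alpha> < \<Delta>\<close>])
    show "maintains_orientation \<Delta> (token_algorithm \<Delta>) us"
      by (rule maintains_orientation_token_algorithm[OF ap \<open>\<alpha> < \<Delta>\<close>])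
    show "total_messages (token_algorithm \<Delta>) us \<le> 13 * (length us + flips us D)"
      if "\<alpha> \<le> \<delta>" "12 * real \<delta> \<le> real \<Delta>" "maintained_by \<delta> us D" for \<delta> D
      using that(2) by (intro total_messages_le[OF ap \<open>\<alpha> \<ge> 1\<close> that(1) _ that(3)]) linarith
    show "congest (13 * k) n (token_algorithm \<Delta>) us" if "1 \<le> k" "2 \<le> n" for k n
      using that by (intro congest_token_algorithm[OF ap \<open>\<alpha> < \<Delta>\<close>]) auto
    show "memory_bounded (real 13 * real \<Delta>) (13 * k) n (token_algorithm \<Delta>) us"
      if "1 \<le> k" "2 \<le> n" "size_bounded k n us" for k n
      using that by (intro memory_bounded_token_algorithm[OF ap \<open>\<alpha> < \<Delta>\<close>]) auto
  next
    fix \<alpha> \<Delta> k n :: nat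
    have "1 * amortized_message_complexity (token_algorithm \<Delta>) \<alpha> k n \<le>
        of_nat 13 * amortized_message_complexity (token_algorithm \<Delta>) \<alpha> k n"
      by (intro mult_right_mono) auto
    then show "amortized_update_time (token_algorithm \<Delta>) \<alpha> k n \<le>
        of_nat 13 * amortized_message_complexity (token_algorithm \<Delta>) \<alpha> k n"
      using amortized_update_time_le[of \<Delta> \<alpha> k n] by simp
  qed
next
  case 2
  show ?case
  proof (intro allI)
    fix b :: real
    \<comment> \<open>The summand 26 serves the logarithmic bound; the other one turns the memory
      bound 9 \<Delta> \<le> 9 \<open>b\<close> \<alpha> into a multiple of \<alpha>.\<close>
    define C where "C = nat \<lceil>9 * b\<rceil> + 26"
    have C: "9 * b \<le> real C" "26 \<le> real C" unfolding C_def by linarith+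
    show "\<exists>C::nat. \<forall>\<alpha> \<Delta> :: nat. \<alpha> \<ge> 1 \<and> real \<Delta> \<ge> 12 * real \<alpha> \<and> real \<Delta> \<le> b * real \<alpha> \<longrightarrow>
       (\<forall>k n. k \<ge> 1 \<and> n \<ge> 2 \<longrightarrow>
          amortized_update_time (token_algorithm \<Delta>) \<alpha> k n \<le> ennreal (real C * log 2 (real n)) \<and>
          amortized_message_complexity (token_algorithm \<Delta>) \<alpha> k n \<le> ennreal (real C * log 2 (real n)) \<and>
          (\<forall>us. arboricity_preserving \<alpha> us \<and> size_bounded k n us \<longrightarrow>
             memory_bounded (real C * real \<alpha>) (C * k) n (token_algorithm \<Delta>) us))"
    proof (rule exI[of _ C], intro allI impI conjI; elim conjE)
      fix \<alpha> \<Delta> k n :: nat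
      assume \<alpha>: "1 \<le> \<alpha>" "12 * real \<alpha> \<le> real \<Delta>" "real \<Delta> \<le> b * real \<alpha>" and kn: "1 \<le> k" "2 \<le> n"
      have "12 * \<alpha> \<le> \<Delta>" using \<alpha>(2) by linarith
      then show m: "amortized_message_complexity (token_algorithm \<Delta>) \<alpha> k n \<le> ennreal (real C * log 2 (real n))"
        by (intro amortized_message_complexity_log \<alpha>(1) kn(2) C(2))
      then show "amortized_update_time (token_algorithm \<Delta>) \<alpha> k n \<le> ennreal (real C * log 2 (real n))"
        using amortized_update_time_le order_trans by blast
      fix us assume us: "arboricity_preserving \<alpha> us" "size_bounded k n us"
      have "real (9 * \<Delta>) \<le> 9 * (b * real \<alpha>)" using \<alpha>(3) by simp
      also have "\<dots> \<le> real C * real \<alpha>"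
        using C(1) mult_right_mono[of "9 * b" "real C" "real \<alpha>"] by simp
      finally show "memory_bounded (real C * real \<alpha>) (C * k) n (token_algorithm \<Delta>) us"
        using us kn C(2) \<alpha>(1) \<open>12 * \<alpha> \<le> \<Delta>\<close>
        by (intro memory_bounded_token_algorithm[OF us(1)]) auto
    qed
  qed
qed

end
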